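(* Let $\mathcal S$ be a set and $\omega:\mathrm{Conf}(T\mathcal B,T\mathcal E)\to\mathcal S$ a function. Then $\omega$ is frame invariant, i.e. $\omega(F)=\omega(O\circ F)$ for all $F\in\mathrm{Conf}(T\mathcal B,T\mathcal E)$ and all $O\in T\mathfrak{Gal}$, if and only if there exists a (unique) $\widehat\omega:\mathrm{Im}(\mathbb I)\to\mathcal S$ such that $\omega=\widehat\omega\circ\mathbb I$, where $\mathbb I(F)=\big(F^*\mathfrak g_v^v,F^*\vartheta,F^*\gamma,(T\varphi)^*\gamma\big)$ for $F\in \mathrm{Conf}(T\mathcal B,T\mathcal E)$ with punctual shadow $\varphi$.
   Context: Smooth means at least $C^1$ (maps are understood to be regular enough that the tangent maps occurring are again smooth). Affine bundles. An affine bundle $\pi_{A}:A\to\mathbb A$ is a smooth surjection between smooth connected orientable manifolds which is locally trivial with typical fibre a finite-dimensional real affine space $F_A$, with transition maps affine on the fibres; its rank is $\dim F_A$. Affine trivialising coordinates are local coordinates $(\bar x,y)$ on $A$ with $\bar x$ coordinates on $\mathbb A$ and $y$ affine coordinates on each fibre; they induce coordinates $(\bar x,y,\delta\bar x,\delta y)$ on $TA$ ("vectorial coordinates" $(\delta \bar x,\delta y)$). $VA=\ker T\pi_A\subset TA$. Ambient space. $\mathbb E=\mathbb R^3$ with Euclidean metric $\mathbf g$; $\mathcal E=\mathbb R^3\times\mathbb R^3\ni(\bar x,y)$ with $\pi_{\mathcal E}(\bar x,y)=\bar x$. In the canonical coordinates, the connection is $\gamma_{(\bar x,y)}(\delta\bar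 x)=((\bar x,y),(\delta\bar x,0))$, the solder form is $\vartheta_{(\bar x,y)}(\delta\bar x)=((\bar x,y),(0,\delta\bar x))$, the projection of interpretation is $\iota:T\mathcal E\to T\mathbb E$, $((\bar x,y),(\delta\bar x,\delta y))\mapsto(\bar x,\delta\bar x+\delta y)$, and the pseudo-metric is $\mathfrak g=\iota^*\mathbf g$. $\mathfrak g_v^v$ is the restriction of $\mathfrak g$ to $V\mathcal E$. Material bundle. $\pi_{\mathcal B}:\mathcal B\to\mathbb B$ is an affine bundle of rank $3$, $\dim\mathbb B\in\{1,2,3\}$. Placements. For affine bundles $A\to\mathbb A$, $D\to\mathbb D$, $\mathrm{Aff}(A,D)$ is the set of smooth maps $\ell:A\to D$ such that there is a smooth $\bar\ell:\mathbb A\to\mathbb D$ with $\pi_D\circ\ell=\bar\ell\circ\pi_A$, and $\ell$ is affine on each fibre. A smooth map $L:TA\to TD$ is physically acceptable, $L\in\mathcal L_{pa}(TA,TD)$, if: (1) $L$ is a vector bundle morphism $TA\to TD$ over some $\ell\in\mathrm{Aff}(A,D)$ (its punctual shadow); (2) $T\pi_D\circ L=\bar L\circ T\pi_A$ with $\bar L:=T\bar\ell$; (3) $L|_{VA}=(T\ell)|_{VA}$; (4) in affine trivialising coordinates, the vectorial coordinates of $L_a u$ (for fixed vectorial coordinates of $u\in T_aA$) are affine in the vertical coordinate $y$ of $a$. $\mathrm{Conf}(T\mathcal B,T\mathcal E)$ is the set of $F\in\mathcal L_{pa}(T\mathcal B,T\mathcal E)$ that are differential embeddings and whose punctual shadow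 $\varphi:\mathcal B\to\mathcal E$ is a differential embedding. Pull-backs. For such $F$ with shadow $\varphi$: $(F^*\gamma)_X=F_X^{-1}\circ\gamma_{\varphi(X)}\circ\bar F$ and $(F^*\vartheta)_X=F_X^{-1}\circ\vartheta_{\varphi(X)}\circ\bar F$ for $X\in\mathcal B$, as maps $T_{\bar X}\mathbb B\to T_X\mathcal B$, and $F^*\mathfrak g_v^v$ is the form $(U,W)\mapsto\langle FU,FW\rangle_{\mathfrak g}$ on $V\mathcal B$. The same definition applies with $T\varphi$ in place of $F$. Galilean group. $\mathrm{Gal}$ is the group of maps $\bar x\mapsto R\bar x+\bar t$ of $\mathbb R^3$ with $R\in O(3)$, $\bar t\in\mathbb R^3$; $T\mathrm{Gal}=\{T O: O\in\mathrm{Gal}\}$. The generalised Galilean group is $T\mathfrak{Gal}=\{Ta: a\in\mathrm{Aff}(\mathcal E,\mathcal E),\ \exists\, O\in T\mathrm{Gal},\ \iota\circ Ta=O\circ\iota\}$; it acts on $\mathrm{Conf}(T\mathcal B,T\mathcal E)$ by left composition. *)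

theory Defs
  imports "HOL-Analysis.Analysis" "HOL-Combinatorics.Permutations" "HOL-Library.Extended_Nat"
begin

section \<open>Maps of class \<open>C\<^sup>k\<close> between open subsets of Euclidean spaces\<close>

primrec Ck_on_nat ::
  "nat \<Rightarrow> 'a::euclidean_space set \<Rightarrow> ('a \<Rightarrow> 'b::real_normed_vector) \<Rightarrow> bool" where
  "Ck_on_nat 0 = (\<lambda>S f. continuous_on S f)"
| "Ck_on_nat (Suc k) = (\<lambda>S f. (\<forall>x\<in>S. f differentiable (at x)) \<and>
     (\<forall>v. Ck_on_nat k S (\<lambda>x. frechet_derivative f (at x) v)))"

text \<open>Only meant for open \<open>S\<close>; the value \<open>\<infinity>\<close> of \<open>k\<close> means infinitely differentiable.\<close>
definition Ck_on ::
  "enat \<Rightarrow> 'a::euclidean_space set \<Rightarrow> ('a \<Rightarrow> 'b::real_normed_vector) \<Rightarrow> bool" where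
  "Ck_on k S f \<longleftrightarrow> open S \<and> (\<forall>n. enat n \<le> k \<longrightarrow> Ck_on_nat n S f)"

text \<open>Leibniz formula in the orthonormal basis \<open>Basis\<close>.\<close>
definition lin_det :: "('a::euclidean_space \<Rightarrow> 'a) \<Rightarrow> real" where
  "lin_det g = (\<Sum>p | p permutes Basis. of_int (sign p) * (\<Prod>b\<in>Basis. g b \<bullet> p b))"

definition affine_fun :: "('a::real_vector \<Rightarrow> 'b::real_vector) \<Rightarrow> bool" where
  "affine_fun h \<longleftrightarrow> (\<exists>g c. linear g \<and> (\<forall>y. h y = g y + c))"


section \<open>Manifolds\<close>

text \<open>
  A chart is a pair of a domain and a coordinate map (whose values outside the domain are
  irrelevant). A manifold is represented by an atlas alone: its points are those covered by the
  charts, and its topology is the one in which the charts are homeomorphisms onto open sets.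
\<close>

type_synonym ('p, 'a) chart = "'p set \<times> ('p \<Rightarrow> 'a)"
type_synonym ('p, 'a) atlas = "('p, 'a) chart set"

definition pts :: "('p, 'a) atlas \<Rightarrow> 'p set" where
  "pts M = (\<Union>c\<in>M. fst c)"

definition chart_inv :: "('p, 'a) chart \<Rightarrow> 'a \<Rightarrow> 'p" where
  "chart_inv c = inv_into (fst c) (snd c)"

definition transition :: "('p, 'a) chart \<Rightarrow> ('p, 'a) chart \<Rightarrow> 'a \<Rightarrow> 'a" where
  "transition c d = snd d \<circ> chart_inv c"

definition is_atlas :: "enat \<Rightarrow> ('p, 'a::euclidean_space) atlas \<Rightarrow> bool" where
  "is_atlas k M \<longleftrightarrow>
     (\<forall>c\<in>M. inj_on (snd c) (fst c) \<and> open (snd c ` fst c)) \<and>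
     (\<forall>c\<in>M. \<forall>d\<in>M. Ck_on k (snd c ` (fst c \<inter> fst d)) (transition c d))"

definition mtop :: "('p, 'a::euclidean_space) atlas \<Rightarrow> 'p topology" where
  "mtop M = topology (\<lambda>W. W \<subseteq> pts M \<and> (\<forall>c\<in>M. open (snd c ` (W \<inter> fst c))))"

lemma openin_mtop:
  assumes "is_atlas k M"
  shows "openin (mtop M) W \<longleftrightarrow> W \<subseteq> pts M \<and> (\<forall>c\<in>M. open (snd c ` (W \<inter> fst c)))"
proof -
  have "istopology (\<lambda>W. W \<subseteq> pts M \<and> (\<forall>c\<in>M. open (snd c ` (W \<inter> fst c))))"
    unfolding istopology_def
  proof (intro conjI allI impI, goal_cases)
    case (1 S T)
    then show ?case by blast
  next
    case (2 S T)
    show ?case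
    proof
      fix c assume c: "c \<in> M"
      then have "inj_on (snd c) (fst c)" using assms by (auto simp: is_atlas_def)
      then have "snd c ` (S \<inter> T \<inter> fst c) = snd c ` (S \<inter> fst c) \<inter> snd c ` (T \<inter> fst c)"
        by (auto simp: inj_on_def)
      then show "open (snd c ` (S \<inter> T \<inter> fst c))" using 2 c by auto
    qed
  next
    case (3 \<K>)
    then show ?case by blast
  next
    case (4 \<K>)
    show ?case
    proof
      fix c assume c: "c \<in> M"
      have "snd c ` (\<Union> \<K> \<inter> fst c) = (\<Union>K\<in>\<K>. snd c ` (K \<inter> fst c))" by auto
      then show "open (snd c ` (\<Union> \<K> \<inter> fst c))" using 4 c by auto
    qed
  qed
  then show ?thesis by (simp add: mtop_def topology_inverse')
qed

definition manifold :: "enat \<Rightarrow> ('p, 'a::euclidean_space) atlas \<Rightarrow> bool" where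
  "manifold k M \<longleftrightarrow> is_atlas k M \<and> Hausdorff_space (mtop M) \<and> second_countable (mtop M)"

definition orientable :: "enat \<Rightarrow> ('p, 'a::euclidean_space) atlas \<Rightarrow> bool" where
  "orientable k M \<longleftrightarrow>
     (\<exists>N. is_atlas k (M \<union> N) \<and> pts N = pts M \<and>
        (\<forall>c\<in>N. \<forall>d\<in>N. \<forall>p\<in>fst c \<inter> fst d.
           0 < lin_det (frechet_derivative (transition c d) (at (snd c p)))))"

definition smooth_map :: "enat \<Rightarrow> ('p, 'a::euclidean_space) atlas \<Rightarrow>
    ('q, 'b::euclidean_space) atlas \<Rightarrow> ('p \<Rightarrow> 'q) \<Rightarrow> bool" where
  "smooth_map k M N h \<longleftrightarrow> h \<in> pts M \<rightarrow> pts N \<and> continuous_map (mtop M) (mtop N) h \<and>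
     (\<forall>c\<in>M. \<forall>d\<in>N. Ck_on k (snd c ` {p\<in>fst c. h p \<in> fst d}) (snd d \<circ> h \<circ> chart_inv c))"

definition diffeo :: "enat \<Rightarrow> ('p, 'a::euclidean_space) atlas \<Rightarrow>
    ('q, 'b::euclidean_space) atlas \<Rightarrow> ('p \<Rightarrow> 'q) \<Rightarrow> bool" where
  "diffeo k M N h \<longleftrightarrow> bij_betw h (pts M) (pts N) \<and> smooth_map k M N h \<and>
     smooth_map k N M (inv_into (pts M) h)"

definition open_submanifold :: "('p, 'a) atlas \<Rightarrow> 'p set \<Rightarrow> ('p, 'a) atlas" where
  "open_submanifold M W = (\<lambda>c. (fst c \<inter> W, snd c)) ` M"

definition prod_manifold :: "('p, 'a) atlas \<Rightarrow> ('q, 'b) atlas \<Rightarrow> ('p \<times> 'q, 'a \<times> 'b) atlas" where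
  "prod_manifold M N = (\<lambda>(c, d). (fst c \<times> fst d, map_prod (snd c) (snd d))) ` (M \<times> N)"

definition vec_manifold :: "('v, 'v) atlas" where
  "vec_manifold = {(UNIV, id)}"


section \<open>Tangent bundles\<close>

text \<open>
  A tangent vector at \<open>p\<close> is \<open>(p, v)\<close> where \<open>v\<close> assigns to each chart around \<open>p\<close> the
  coordinates of the vector in that chart (and the junk value \<open>0\<close> to everything else), subject
  to the usual transformation rule. The vector space operations are pointwise in \<open>v\<close>.
\<close>

type_synonym ('p, 'a) tvec = "'p \<times> (('p, 'a) chart \<Rightarrow> 'a)"

definition tangent_space :: "('p, 'a::euclidean_space) atlas \<Rightarrow> 'p \<Rightarrow> ('p, 'a) tvec set" where
  "tangent_space M p = {(p, v) | v.
     (\<forall>c\<in>M. \<forall>d\<in>M. p \<in> fst c \<and> p \<in> fst d \<longrightarrow>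
        v d = frechet_derivative (transition c d) (at (snd c p)) (v c)) \<and>
     (\<forall>c. \<not> (c \<in> M \<and> p \<in> fst c) \<longrightarrow> v c = 0)}"

definition tangent_pts :: "('p, 'a::euclidean_space) atlas \<Rightarrow> ('p, 'a) tvec set" where
  "tangent_pts M = (\<Union>p\<in>pts M. tangent_space M p)"

definition tangent_atlas ::
  "('p, 'a::euclidean_space) atlas \<Rightarrow> (('p, 'a) tvec, 'a \<times> 'a) atlas" where
  "tangent_atlas M =
     (\<lambda>c. ({u\<in>tangent_pts M. fst u \<in> fst c}, \<lambda>u. (snd c (fst u), snd u c))) ` M"

definition tzero :: "'p \<Rightarrow> ('p, 'a::zero) tvec" where
  "tzero p = (p, \<lambda>_. 0)"

definition tlincomb ::
  "real \<Rightarrow> ('p, 'a::real_vector) tvec \<Rightarrow> real \<Rightarrow> ('p, 'a) tvec \<Rightarrow> ('p, 'a) tvec" where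
  "tlincomb s u t w = (fst u, \<lambda>c. s *\<^sub>R snd u c + t *\<^sub>R snd w c)"

text \<open>The differential at a tangent vector \<open>u\<close> of a vector valued function \<open>\<kappa>\<close> defined near the
  base point of \<open>u\<close>; the result does not depend on the chart used.\<close>
definition differential ::
  "('p, 'a::euclidean_space) atlas \<Rightarrow> ('p \<Rightarrow> 'b::real_normed_vector) \<Rightarrow> ('p, 'a) tvec \<Rightarrow> 'b" where
  "differential M \<kappa> u =
     (let c = (SOME c. c \<in> M \<and> fst u \<in> fst c)
      in frechet_derivative (\<kappa> \<circ> chart_inv c) (at (snd c (fst u))) (snd u c))"

definition tangent_map :: "('p, 'a::euclidean_space) atlas \<Rightarrow> ('q, 'b::euclidean_space) atlas \<Rightarrow>
    ('p \<Rightarrow> 'q) \<Rightarrow> ('p, 'a) tvec \<Rightarrow> ('q, 'b) tvec" where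
  "tangent_map M N h = (\<lambda>u\<in>tangent_pts M.
     (h (fst u), \<lambda>d. if d \<in> N \<and> h (fst u) \<in> fst d then differential M (snd d \<circ> h) u else 0))"

definition smooth_embedding :: "enat \<Rightarrow> ('p, 'a::euclidean_space) atlas \<Rightarrow>
    ('q, 'b::euclidean_space) atlas \<Rightarrow> ('p \<Rightarrow> 'q) \<Rightarrow> bool" where
  "smooth_embedding k M N h \<longleftrightarrow> smooth_map k M N h \<and>
     (\<forall>p\<in>pts M. inj_on (tangent_map M N h) (tangent_space M p)) \<and>
     embedding_map (mtop M) (mtop N) h"


section \<open>Affine bundles\<close>

text \<open>
  A local trivialisation is given by an open set \<open>U\<close> of the base and the fibre component
  \<open>\<psi>\<close> of a diffeomorphism \<open>\<pi>\<^sup>-\<^sup>1(U) \<rightarrow> U \<times> 'f\<close> over \<open>U\<close>. The typical fibre is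
  the affine space underlying the Euclidean space \<open>'f\<close>; only maps that are affine in the fibre
  coordinate are used, so neither its origin nor its inner product matters.
\<close>

record ('p, 'a, 'q, 'm, 'f) bundle_data =
  total :: "('p, 'a) atlas"
  base :: "('q, 'm) atlas"
  proj :: "'p \<Rightarrow> 'q"
  trivs :: "('q set \<times> ('p \<Rightarrow> 'f)) set"

definition fibre :: "('p, 'a, 'q, 'm, 'f) bundle_data \<Rightarrow> 'q \<Rightarrow> 'p set" where
  "fibre A x = {a \<in> pts (total A). proj A a = x}"

definition affine_bundle ::
  "enat \<Rightarrow> ('p, 'a::euclidean_space, 'q, 'm::euclidean_space, 'f::euclidean_space) bundle_data \<Rightarrow> bool"
where
  "affine_bundle k A \<longleftrightarrow>
     manifold k (total A) \<and> connected_space (mtop (total A)) \<and> orientable k (total A) \<and>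
     manifold k (base A) \<and> connected_space (mtop (base A)) \<and> orientable k (base A) \<and>
     smooth_map k (total A) (base A) (proj A) \<and>
     proj A ` pts (total A) = pts (base A) \<and>
     pts (base A) = (\<Union>(U, \<psi>)\<in>trivs A. U) \<and>
     (\<forall>(U, \<psi>)\<in>trivs A. openin (mtop (base A)) U \<and>
        diffeo k (open_submanifold (total A) {a \<in> pts (total A). proj A a \<in> U})
          (prod_manifold (open_submanifold (base A) U) vec_manifold)
          (\<lambda>a. (proj A a, \<psi> a))) \<and>
     (\<forall>(U, \<psi>)\<in>trivs A. \<forall>(U', \<psi>')\<in>trivs A. \<forall>x\<in>U \<inter> U'.
        \<exists>h. affine_fun h \<and> (\<forall>a\<in>fibre A x. \<psi>' a = h (\<psi> a)))"

text \<open>The affine trivialising coordinates \<open>(x, y)\<close> built from a base chart and a trivialisation.\<close>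
definition triv_coords :: "('p, 'a, 'q, 'm, 'f) bundle_data \<Rightarrow> ('q, 'm) chart \<Rightarrow>
    ('q set \<times> ('p \<Rightarrow> 'f)) \<Rightarrow> 'p \<Rightarrow> 'm \<times> 'f" where
  "triv_coords A c t = (\<lambda>a. (snd c (proj A a), snd t a))"

definition Tproj :: "('p, 'a::euclidean_space, 'q, 'm::euclidean_space, 'f) bundle_data \<Rightarrow>
    ('p, 'a) tvec \<Rightarrow> ('q, 'm) tvec" where
  "Tproj A = tangent_map (total A) (base A) (proj A)"

definition vertical_space :: "('p, 'a::euclidean_space, 'q, 'm::euclidean_space, 'f) bundle_data \<Rightarrow>
    'p \<Rightarrow> ('p, 'a) tvec set" where
  "vertical_space A a = {u \<in> tangent_space (total A) a. Tproj A u = tzero (proj A a)}"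


section \<open>Affine maps and physically acceptable maps\<close>

text \<open>
  Maps on \<open>A\<close> and \<open>TA\<close> are extensional functions, so that equality of functions is equality of
  maps. The parameter \<open>r\<close> is the class of the maps between tangent bundles; bundles, maps between
  them and hence punctual shadows are of class \<open>r + 1\<close>, so that their tangent maps
  are of class \<open>r\<close>.
\<close>

definition Aff_maps :: "enat \<Rightarrow>
    ('p, 'a::euclidean_space, 'q, 'm::euclidean_space, 'f::euclidean_space) bundle_data \<Rightarrow>
    ('p2, 'a2::euclidean_space, 'q2, 'm2::euclidean_space, 'f2::euclidean_space) bundle_data \<Rightarrow>
    ('p \<Rightarrow> 'p2) set" where
  "Aff_maps r A D = {l \<in> extensional (pts (total A)).
     smooth_map (r + 1) (total A) (total D) l \<and>
     (\<exists>lb. smooth_map (r + 1) (base A) (base D) lb \<and>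
        (\<forall>a\<in>pts (total A). proj D (l a) = lb (proj A a)) \<and>
        (\<forall>(U, \<psi>)\<in>trivs A. \<forall>(U', \<psi>')\<in>trivs D. \<forall>x\<in>U. lb x \<in> U' \<longrightarrow>
           (\<exists>h. affine_fun h \<and> (\<forall>a\<in>fibre A x. \<psi>' (l a) = h (\<psi> a)))))}"

definition base_map :: "('p, 'a, 'q, 'm, 'f) bundle_data \<Rightarrow> ('p2, 'a2, 'q2, 'm2, 'f2) bundle_data \<Rightarrow>
    ('p \<Rightarrow> 'p2) \<Rightarrow> 'q \<Rightarrow> 'q2" where
  "base_map A D l = (THE lb. lb \<in> extensional (pts (base A)) \<and>
     (\<forall>a\<in>pts (total A). proj D (l a) = lb (proj A a)))"

definition Tbase_map ::
  "('p, 'a, 'q, 'm::euclidean_space, 'f) bundle_data \<Rightarrow>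
    ('p2, 'a2, 'q2, 'm2::euclidean_space, 'f2) bundle_data \<Rightarrow>
    ('p \<Rightarrow> 'p2) \<Rightarrow> ('q, 'm) tvec \<Rightarrow> ('q2, 'm2) tvec" where
  "Tbase_map A D l = tangent_map (base A) (base D) (base_map A D l)"

definition vb_morphism_over ::
  "enat \<Rightarrow> ('p, 'a::euclidean_space) atlas \<Rightarrow> ('q, 'b::euclidean_space) atlas \<Rightarrow>
    ('p \<Rightarrow> 'q) \<Rightarrow> (('p, 'a) tvec \<Rightarrow> ('q, 'b) tvec) \<Rightarrow> bool" where
  "vb_morphism_over r M N l L \<longleftrightarrow>
     L \<in> extensional (tangent_pts M) \<and>
     smooth_map r (tangent_atlas M) (tangent_atlas N) L \<and>
     (\<forall>p\<in>pts M. \<forall>u\<in>tangent_space M p. L u \<in> tangent_space N (l p)) \<and>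
     (\<forall>p\<in>pts M. \<forall>u\<in>tangent_space M p. \<forall>w\<in>tangent_space M p. \<forall>s t.
        L (tlincomb s u t w) = tlincomb s (L u) t (L w))"

definition pa_over :: "enat \<Rightarrow>
    ('p, 'a::euclidean_space, 'q, 'm::euclidean_space, 'f::euclidean_space) bundle_data \<Rightarrow>
    ('p2, 'a2::euclidean_space, 'q2, 'm2::euclidean_space, 'f2::euclidean_space) bundle_data \<Rightarrow>
    ('p \<Rightarrow> 'p2) \<Rightarrow> (('p, 'a) tvec \<Rightarrow> ('p2, 'a2) tvec) \<Rightarrow> bool" where
  "pa_over r A D l L \<longleftrightarrow>
     l \<in> Aff_maps r A D \<and>
     vb_morphism_over r (total A) (total D) l L \<and>
     (\<forall>u\<in>tangent_pts (total A). Tproj D (L u) = Tbase_map A D l (Tproj A u)) \<and>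
     (\<forall>a\<in>pts (total A). \<forall>u\<in>vertical_space A a. L u = tangent_map (total A) (total D) l u) \<and>
     (\<forall>c\<in>base A. \<forall>t\<in>trivs A. \<forall>d\<in>base D. \<forall>t'\<in>trivs D.
        \<forall>x \<in> fst c \<inter> fst t. base_map A D l x \<in> fst d \<inter> fst t' \<longrightarrow>
        (\<forall>w. \<exists>h. affine_fun h \<and>
           (\<forall>a\<in>fibre A x. \<forall>u\<in>tangent_space (total A) a.
              differential (total A) (triv_coords A c t) u = w \<longrightarrow>
              differential (total D) (triv_coords D d t') (L u) = h (snd t a))))"

definition shadow :: "('p, 'a::euclidean_space, 'q, 'm, 'f) bundle_data \<Rightarrow>
    (('p, 'a) tvec \<Rightarrow> ('p2, 'a2) tvec) \<Rightarrow> 'p \<Rightarrow> 'p2" where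
  "shadow A L = (THE l. l \<in> extensional (pts (total A)) \<and>
     (\<forall>u\<in>tangent_pts (total A). fst (L u) = l (fst u)))"

definition L_pa :: "enat \<Rightarrow>
    ('p, 'a::euclidean_space, 'q, 'm::euclidean_space, 'f::euclidean_space) bundle_data \<Rightarrow>
    ('p2, 'a2::euclidean_space, 'q2, 'm2::euclidean_space, 'f2::euclidean_space) bundle_data \<Rightarrow>
    (('p, 'a) tvec \<Rightarrow> ('p2, 'a2) tvec) set" where
  "L_pa r A D = {L. \<exists>l. pa_over r A D l L}"


section \<open>The ambient bundle\<close>

type_synonym R3 = "real^3"
type_synonym E_tot = "R3 \<times> R3"

definition EE :: "(E_tot, E_tot, R3, R3, R3) bundle_data" where
  "EE = \<lparr>total = vec_manifold, base = vec_manifold, proj = fst, trivs = {(UNIV, snd)}\<rparr>"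

text \<open>Canonical coordinates on the tangent bundle of a vector space.\<close>
definition vec_tvec :: "'v \<Rightarrow> 'v \<Rightarrow> ('v::zero, 'v) tvec" where
  "vec_tvec x w = (x, \<lambda>c. if c = (UNIV, id) then w else 0)"

definition vec_coord :: "('v, 'v) tvec \<Rightarrow> 'v" where
  "vec_coord u = snd u (UNIV, id)"

definition connection :: "E_tot \<Rightarrow> (R3, R3) tvec \<Rightarrow> (E_tot, E_tot) tvec" where
  "connection e u = vec_tvec e (vec_coord u, 0)"

definition solder :: "E_tot \<Rightarrow> (R3, R3) tvec \<Rightarrow> (E_tot, E_tot) tvec" where
  "solder e u = vec_tvec e (0, vec_coord u)"

definition iota :: "(E_tot, E_tot) tvec \<Rightarrow> (R3, R3) tvec" where
  "iota u = vec_tvec (fst (fst u)) (fst (vec_coord u) + snd (vec_coord u))"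

definition euclid_metric :: "(R3, R3) tvec \<Rightarrow> (R3, R3) tvec \<Rightarrow> real" where
  "euclid_metric u w = vec_coord u \<bullet> vec_coord w"

definition pseudo_metric :: "(E_tot, E_tot) tvec \<Rightarrow> (E_tot, E_tot) tvec \<Rightarrow> real" where
  "pseudo_metric u w = euclid_metric (iota u) (iota w)"

definition Gal :: "(R3 \<Rightarrow> R3) set" where
  "Gal = {\<lambda>x. R *v x + t | R t. orthogonal_matrix R}"

definition TGal :: "((R3, R3) tvec \<Rightarrow> (R3, R3) tvec) set" where
  "TGal = tangent_map vec_manifold vec_manifold ` Gal"

definition TGGal :: "enat \<Rightarrow> ((E_tot, E_tot) tvec \<Rightarrow> (E_tot, E_tot) tvec) set" where
  "TGGal r = {tangent_map (total EE) (total EE) a | a.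
     a \<in> Aff_maps r EE EE \<and>
     (\<exists>Q\<in>TGal. \<forall>u\<in>tangent_pts (total EE).
        iota (tangent_map (total EE) (total EE) a u) = Q (iota u))}"


section \<open>Configurations, pull-backs, frame invariance\<close>

definition Conf :: "enat \<Rightarrow>
    ('p, 'a::euclidean_space, 'q, 'm::euclidean_space, 'f::euclidean_space) bundle_data \<Rightarrow>
    (('p, 'a) tvec \<Rightarrow> (E_tot, E_tot) tvec) set" where
  "Conf r B = {F \<in> L_pa r B EE.
     smooth_embedding r (tangent_atlas (total B)) (tangent_atlas (total EE)) F \<and>
     smooth_embedding (r + 1) (total B) (total EE) (shadow B F)}"

text \<open>
  Pull-back of \<open>\<kappa> = connection\<close> or \<open>\<kappa> = solder\<close>. For the maps \<open>L\<close> used here, \<open>L\<close> is injective on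
  each tangent space and the argument of \<open>inv_into\<close> lies in its image.
\<close>
definition pull_back ::
  "('p, 'a::euclidean_space, 'q, 'm::euclidean_space, 'f) bundle_data \<Rightarrow>
    (E_tot \<Rightarrow> (R3, R3) tvec \<Rightarrow> (E_tot, E_tot) tvec) \<Rightarrow>
    (('p, 'a) tvec \<Rightarrow> (E_tot, E_tot) tvec) \<Rightarrow> 'p \<Rightarrow> ('q, 'm) tvec \<Rightarrow> ('p, 'a) tvec" where
  "pull_back B \<kappa> L = (\<lambda>X\<in>pts (total B). \<lambda>u\<in>tangent_space (base B) (proj B X).
     inv_into (tangent_space (total B) X) L
       (\<kappa> (shadow B L X) (Tbase_map B EE (shadow B L) u)))"

definition pull_back_metric_v ::
  "('p, 'a::euclidean_space, 'q, 'm::euclidean_space, 'f) bundle_data \<Rightarrow>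
    (('p, 'a) tvec \<Rightarrow> (E_tot, E_tot) tvec) \<Rightarrow> ('p, 'a) tvec \<times> ('p, 'a) tvec \<Rightarrow> real" where
  "pull_back_metric_v B F =
     (\<lambda>(u, w)\<in>(\<Union>X\<in>pts (total B). vertical_space B X \<times> vertical_space B X).
        pseudo_metric (F u) (F w))"

definition invariants where
  "invariants B F =
     (pull_back_metric_v B F,
      pull_back B solder F,
      pull_back B connection F,
      pull_back B connection (tangent_map (total B) (total EE) (shadow B F)))"

definition frame_invariant where
  "frame_invariant r B \<omega> \<longleftrightarrow>
     (\<forall>F\<in>Conf r B. \<forall>Q\<in>TGGal r. \<omega> F = \<omega> (compose (tangent_pts (total B)) Q F))"

end

theory Submission
  imports Defs
begin

text \<open>
  A generalised Galilean transformation has the form \<open>T(\<lambda>(x, y). (R x + t, R y + c))\<close> with \<open>R\<close>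
  orthogonal and \<open>t\<close>, \<open>c\<close> constant, so it preserves all four invariants. Conversely, let \<open>F\<^sub>1\<close>, \<open>F\<^sub>2\<close> with
  shadows \<open>\<phi>\<^sub>1\<close>, \<open>\<phi>\<^sub>2\<close> have equal invariants, and fix a point \<open>X\<close>. On vertical vectors \<open>F\<^sub>i\<close> is an
  isomorphism onto \<open>\<real>\<^sup>3\<close>, and equality of the metrics gives an orthogonal \<open>R\<^sub>X\<close> with \<open>F\<^sub>2 = R\<^sub>X F\<^sub>1\<close> there.
  The solder forms give the same relation between the tangent maps of the base maps, and the
  connections extend it to \<open>F\<^sub>2 = (R\<^sub>X \<times> R\<^sub>X) F\<^sub>1\<close> and \<open>T\<phi>\<^sub>2 = (R\<^sub>X \<times> R\<^sub>X) T\<phi>\<^sub>1\<close> on the whole tangent space.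

  In a trivialisation, the fibre component of \<open>\<phi>\<^sub>i\<close> is \<open>A\<^sub>i(x) y + c\<^sub>i(x)\<close> with \<open>A\<^sub>i(x)\<close> invertible. Hence
  \<open>A\<^sub>2 = R A\<^sub>1\<close>, so that \<open>R\<close> depends on \<open>x\<close> only, and also \<open>dA\<^sub>2 = R dA\<^sub>1\<close>; together they force
  \<open>dR = 0\<close>. Thus \<open>R\<close>, and with it \<open>\<phi>\<^sub>2 - (R \<times> R) \<phi>\<^sub>1\<close>, is locally constant, hence constant because the
  bundle is connected.
\<close>

section \<open>Maps of class \<open>C\<^sup>k\<close>\<close>

text \<open>The rotation at a point comes from a choice, so nothing is known in advance about how it
  varies. The fibre directions remedy this: since \<open>A\<^sub>1(x)\<close> is invertible, they
  determine \<open>R\<close>. So one rotation serves a whole fibre, rotations found on neighbouring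
  pieces agree, and all control of \<open>R\<close> can be drawn from
  \<open>A\<^sub>2 = R A\<^sub>1\<close> and orthogonality. The relation
  \<open>dA\<^sub>2 = R dA\<^sub>1\<close> is where the fourth invariant enters. The pull-backs
  under \<open>F\<close> do not control how the fibre component of the shadow varies along the base,
  because \<open>F\<close> and \<open>T\<phi>\<close> are tied together only on vertical vectors and
  in the first component. Subtracting the base derivatives of the fibre component at fibre
  coordinates \<open>w\<close> and \<open>0\<close> removes \<open>c\<^sub>i\<close> and leaves the
  derivative of \<open>A\<^sub>i(x) w\<close>. A pull-back is formed by choosing a preimage, so
  equality of pull-backs is informative only once preimages are known to exist; the vertical vectors
  provide them. In the other direction, most of the work is to show that composing with a Galilean
  map does not leave \<open>Conf\<close>.\<close>

lemma frechet_derivative_cong_open: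
  assumes "open S" "x \<in> S" "\<And>y. y \<in> S \<Longrightarrow> f y = g y"
  shows "frechet_derivative f (at x) = frechet_derivative g (at x)"
proof -
  have "(f has_derivative D) (at x) \<longleftrightarrow> (g has_derivative D) (at x)" for D
    using assms has_derivative_transform_within_open[of _ _ x UNIV S]
    by (metis (no_types, lifting))
  then show ?thesis by (simp add: frechet_derivative_def)
qed

lemma differentiable_cong_open:
  assumes "open S" "x \<in> S" "\<And>y. y \<in> S \<Longrightarrow> f y = g y" "f differentiable (at x)"
  shows "g differentiable (at x)"
  using assms has_derivative_transform_within_open[of f _ x UNIV S g]
  unfolding differentiable_def by blast

lemma frechet_derivative_eq:
  assumes "(f has_derivative D) (at x)" shows "frechet_derivative f (at x) = D"
  using assms frechet_derivative_at by metis

lemma frechet_derivative_affine_comp: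
  fixes K :: "'b::euclidean_space \<Rightarrow> 'c::real_normed_vector"
  assumes "linear K" "f differentiable (at x)"
  shows "((\<lambda>x. K (f x) + c) has_derivative (\<lambda>v. K (frechet_derivative f (at x) v))) (at x)"
proof -
  have K: "bounded_linear K" using assms(1) linear_conv_bounded_linear by blast
  have "(f has_derivative frechet_derivative f (at x)) (at x)"
    using assms(2) frechet_derivative_works by blast
  then show ?thesis
    using bounded_linear.has_derivative[OF K] by (auto intro!: derivative_eq_intros)
qed

lemma Ck_on_nat_cong:
  assumes "open S" "\<And>x. x \<in> S \<Longrightarrow> f x = g x" "Ck_on_nat n S f"
  shows "Ck_on_nat n S g"
  using assms(2,3)
proof (induction n arbitrary: f g)
  case 0
  then show ?case using continuous_on_eq[of S f g] by simp
next
  case (Suc n)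
  have "frechet_derivative f (at x) = frechet_derivative g (at x)" if "x \<in> S" for x
    using frechet_derivative_cong_open[OF assms(1) that] Suc.prems(1) by blast
  then have "Ck_on_nat n S (\<lambda>x. frechet_derivative g (at x) v)" for v
    using Suc.IH[of "\<lambda>x. frechet_derivative f (at x) v" "\<lambda>x. frechet_derivative g (at x) v"]
      Suc.prems(2) by simp
  moreover have "g differentiable (at x)" if "x \<in> S" for x
    using differentiable_cong_open[OF assms(1) that, of f g] Suc.prems that by simp
  ultimately show ?case by simp
qed

lemma Ck_on_nat_affine_comp:
  fixes K :: "'b::euclidean_space \<Rightarrow> 'c::real_normed_vector"
  assumes "open S" "linear K" "Ck_on_nat n S f"
  shows "Ck_on_nat n S (\<lambda>x. K (f x) + c)"
  using assms(3)
proof (induction n arbitrary: f c)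
  case 0
  have "bounded_linear K" using assms(2) linear_conv_bounded_linear by blast
  then show ?case using 0 using bounded_linear.continuous_on by (auto intro!: continuous_on_add continuous_on_const)
next
  case (Suc n)
  have d: "((\<lambda>x. K (f x) + c) has_derivative (\<lambda>v. K (frechet_derivative f (at x) v))) (at x)"
    if "x \<in> S" for x
    using frechet_derivative_affine_comp[OF assms(2), of f x c] Suc.prems that by simp
  have "Ck_on_nat n S (\<lambda>x. frechet_derivative (\<lambda>x. K (f x) + c) (at x) v)" for v
  proof (rule Ck_on_nat_cong[OF assms(1)])
    show "Ck_on_nat n S (\<lambda>x. K (frechet_derivative f (at x) v) + 0)"
      by (rule Suc.IH) (use Suc.prems in simp)
    show "K (frechet_derivative f (at x) v) + 0 =
      frechet_derivative (\<lambda>x. K (f x) + c) (at x) v" if "x \<in> S" for x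
      using frechet_derivative_eq[OF d[OF that]] by simp
  qed
  then show ?case using d by (auto simp: differentiable_def)
qed

lemma Ck_on_nat_const: "Ck_on_nat n S (\<lambda>_. c)"
  by (induction n arbitrary: c) auto

lemma Ck_on_nat_ident: "Ck_on_nat n S (\<lambda>x. x)"
proof (cases n)
  case (Suc m)
  then show ?thesis using Ck_on_nat_const by (auto simp: frechet_derivative_ident)
qed auto

lemma Ck_on_cong:
  assumes "Ck_on k S f" "\<And>x. x \<in> S \<Longrightarrow> f x = g x"
  shows "Ck_on k S g"
  using assms Ck_on_nat_cong unfolding Ck_on_def by metis

lemma Ck_on_affine_comp:
  fixes K :: "'b::euclidean_space \<Rightarrow> 'c::real_normed_vector"
  assumes "linear K" "Ck_on k S f"
  shows "Ck_on k S (\<lambda>x. K (f x) + c)"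
  using assms Ck_on_nat_affine_comp unfolding Ck_on_def by metis

lemma Ck_on_affine:
  assumes "linear K"
  shows "Ck_on k UNIV (\<lambda>x::'a::euclidean_space. K x + c)"
  using Ck_on_affine_comp[OF assms, of k UNIV "\<lambda>x. x" c] Ck_on_nat_ident
  by (auto simp: Ck_on_def)

lemma Ck_on_differentiable:
  assumes "Ck_on k S f" "1 \<le> k" "x \<in> S"
  shows "f differentiable (at x)"
proof -
  have "Ck_on_nat (Suc 0) S f" using assms unfolding Ck_on_def one_enat_def One_nat_def by blast
  then show ?thesis using assms(3) by simp
qed

lemma Ck_on_open: "Ck_on k S f \<Longrightarrow> open S"
  by (simp add: Ck_on_def)


section \<open>Charts, topology and tangent vectors\<close>

text \<open>Injectivity of the charts is what the intersection axiom for open sets rests on. This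
  version serves atlases such as the tangent atlas, for which injective charts are all that is
  established.\<close>

lemma openin_mtop_iff:
  assumes "\<And>c. c \<in> M \<Longrightarrow> inj_on (snd c) (fst c)"
  shows "openin (mtop M) W \<longleftrightarrow> W \<subseteq> pts M \<and> (\<forall>c\<in>M. open (snd c ` (W \<inter> fst c)))"
proof -
  have "istopology (\<lambda>W. W \<subseteq> pts M \<and> (\<forall>c\<in>M. open (snd c ` (W \<inter> fst c))))"
    unfolding istopology_def
  proof (intro conjI allI impI, goal_cases)
    case (2 S T)
    show ?case
    proof
      fix c assume c: "c \<in> M"
      then have "snd c ` (S \<inter> T \<inter> fst c) = snd c ` (S \<inter> fst c) \<inter> snd c ` (T \<inter> fst c)"
        using assms[OF c] by (auto simp: inj_on_def)
      then show "open (snd c ` (S \<inter> T \<inter> fst c))" using 2 c by auto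
    qed
  next
    case (4 \<K>)
    show ?case
    proof
      fix c assume c: "c \<in> M"
      have "snd c ` (\<Union> \<K> \<inter> fst c) = (\<Union>K\<in>\<K>. snd c ` (K \<inter> fst c))" by auto
      then show "open (snd c ` (\<Union> \<K> \<inter> fst c))" using 4 c by auto
    qed
  qed blast+
  then show ?thesis by (simp add: mtop_def topology_inverse')
qed

lemma topspace_mtop_subset:
  assumes "\<And>c. c \<in> M \<Longrightarrow> inj_on (snd c) (fst c)"
  shows "topspace (mtop M) \<subseteq> pts M"
  using openin_mtop_iff[OF assms] openin_topspace by blast

lemma topspace_mtop:
  assumes "is_atlas k M"
  shows "topspace (mtop M) = pts M"
proof -
  have "openin (mtop M) (pts M)"
    unfolding openin_mtop[OF assms]
  proof (intro conjI ballI subset_refl)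
    fix c assume c: "c \<in> M"
    then have "pts M \<inter> fst c = fst c" by (auto simp: pts_def)
    then show "open (snd c ` (pts M \<inter> fst c))" using c assms by (simp add: is_atlas_def)
  qed
  moreover have "topspace (mtop M) \<subseteq> pts M"
    by (rule topspace_mtop_subset) (use assms in \<open>auto simp: is_atlas_def\<close>)
  ultimately show ?thesis using openin_subset by blast
qed

lemma chart_inv_snd [simp]: "inj_on (snd c) (fst c) \<Longrightarrow> p \<in> fst c \<Longrightarrow> chart_inv c (snd c p) = p"
  by (simp add: chart_inv_def)

lemma atlas_chart_inv: "is_atlas k M \<Longrightarrow> c \<in> M \<Longrightarrow> p \<in> fst c \<Longrightarrow> chart_inv c (snd c p) = p"
  by (simp add: is_atlas_def)

lemma atlas_chart_open: "is_atlas k M \<Longrightarrow> c \<in> M \<Longrightarrow> open (snd c ` fst c)"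
  by (simp add: is_atlas_def)

lemma atlas_transition:
  assumes "is_atlas k M" "c \<in> M" "d \<in> M"
  shows "Ck_on k (snd c ` (fst c \<inter> fst d)) (transition c d)"
  using assms by (simp add: is_atlas_def)

text \<open>Near \<open>p\<close> the representative of \<open>\<kappa>\<close> in \<open>c\<close>
  is its representative in \<open>d\<close> after the transition map. This chain rule yields the
  cocycle rule for transitions, with \<open>\<kappa>\<close> a chart map, and the chart independence
  of \<open>differential\<close>.\<close>

lemma differentiable_change_chart:
  assumes M: "is_atlas k M" "1 \<le> k" and c: "c \<in> M" "p \<in> fst c" and d: "d \<in> M" "p \<in> fst d"
    and \<kappa>: "(\<kappa> \<circ> chart_inv d) differentiable (at (snd d p))"
  shows "((\<kappa> \<circ> chart_inv c) has_derivative
      frechet_derivative (\<kappa> \<circ> chart_inv d) (at (snd d p)) \<circ>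
      frechet_derivative (transition c d) (at (snd c p))) (at (snd c p))"
proof -
  let ?S = "snd c ` (fst c \<inter> fst d)"
  have Ck: "Ck_on k ?S (transition c d)" using atlas_transition[OF M(1) c(1) d(1)] .
  have p: "snd c p \<in> ?S" using c d by blast
  have tr: "transition c d (snd c q) = snd d q" if "q \<in> fst c" for q
    using that atlas_chart_inv[OF M(1) c(1)] by (simp add: transition_def)
  have "(transition c d has_derivative frechet_derivative (transition c d) (at (snd c p))) (at (snd c p))"
    using Ck_on_differentiable[OF Ck M(2) p] frechet_derivative_works by blast
  moreover have "((\<kappa> \<circ> chart_inv d) has_derivative
      frechet_derivative (\<kappa> \<circ> chart_inv d) (at (snd d p))) (at (transition c d (snd c p)))"
    using \<kappa> frechet_derivative_works tr c by auto
  ultimately have "((\<kappa> \<circ> chart_inv d) \<circ> transition c d has_derivative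
      frechet_derivative (\<kappa> \<circ> chart_inv d) (at (snd d p)) \<circ>
      frechet_derivative (transition c d) (at (snd c p))) (at (snd c p))"
    by (rule diff_chain_at)
  then show ?thesis
    by (rule has_derivative_transform_within_open[OF _ Ck_on_open[OF Ck] p])
      (auto simp: tr atlas_chart_inv[OF M(1) c(1)] atlas_chart_inv[OF M(1) d(1)])
qed

text \<open>Inverse of reading off the coordinates in \<open>c\<close>. It identifies the tangent
  space at \<open>p\<close> with the model space, so that linear algebra at a point can be done on
  \<open>'a\<close>.\<close>

definition tvec_at :: "('p, 'a::euclidean_space) atlas \<Rightarrow> ('p, 'a) chart \<Rightarrow> 'p \<Rightarrow> 'a \<Rightarrow> ('p, 'a) tvec" where
  "tvec_at M c p v = (p, \<lambda>d. if d \<in> M \<and> p \<in> fst d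
     then frechet_derivative (transition c d) (at (snd c p)) v else 0)"

lemma frechet_derivative_transition_self:
  assumes "is_atlas k M" "c \<in> M" "p \<in> fst c"
  shows "frechet_derivative (transition c c) (at (snd c p)) = (\<lambda>v. v)"
proof -
  have "frechet_derivative (\<lambda>x. x) (at (snd c p)) = frechet_derivative (transition c c) (at (snd c p))"
    by (rule frechet_derivative_cong_open[of "snd c ` fst c"])
      (use assms in \<open>auto simp: transition_def atlas_chart_open atlas_chart_inv\<close>)
  then show ?thesis by (simp add: frechet_derivative_ident)
qed

lemma tvec_at_coord:
  assumes "is_atlas k M" "c \<in> M" "p \<in> fst c"
  shows "snd (tvec_at M c p v) c = v"
  using assms frechet_derivative_transition_self[OF assms] by (simp add: tvec_at_def)

lemma fst_tvec_at [simp]: "fst (tvec_at M c p v) = p"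
  by (simp add: tvec_at_def)

lemma transition_differentiable:
  assumes "is_atlas k M" "1 \<le> k" "c \<in> M" "p \<in> fst c" "d \<in> M" "p \<in> fst d"
  shows "transition c d differentiable (at (snd c p))"
  by (rule Ck_on_differentiable[OF atlas_transition[OF assms(1,3,5)] assms(2)]) (use assms in auto)

lemma tangent_space_iff:
  "u \<in> tangent_space M p \<longleftrightarrow> fst u = p \<and>
     (\<forall>c\<in>M. \<forall>d\<in>M. p \<in> fst c \<and> p \<in> fst d \<longrightarrow>
        snd u d = frechet_derivative (transition c d) (at (snd c p)) (snd u c)) \<and>
     (\<forall>c. \<not> (c \<in> M \<and> p \<in> fst c) \<longrightarrow> snd u c = 0)"
proof (cases u)
  case (Pair q v)
  show ?thesis
    unfolding Pair tangent_space_def mem_Collect_eq prod.inject fst_conv snd_conv by blast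
qed

lemma tvec_at_in_tangent_space:
  assumes M: "is_atlas k M" "1 \<le> k" and c: "c \<in> M" "p \<in> fst c"
  shows "tvec_at M c p v \<in> tangent_space M p"
proof -
  have *: "frechet_derivative (transition c e) (at (snd c p)) v =
      frechet_derivative (transition d e) (at (snd d p)) (frechet_derivative (transition c d) (at (snd c p)) v)"
    if "d \<in> M" "p \<in> fst d" "e \<in> M" "p \<in> fst e" for d e
    using frechet_derivative_eq[OF differentiable_change_chart[OF M c that(1,2), of "snd e"]]
      transition_differentiable[OF M that]
    by (simp add: transition_def)
  have "snd (tvec_at M c p v) e = frechet_derivative (transition d e) (at (snd d p)) (snd (tvec_at M c p v) d)"
    if "d \<in> M" "e \<in> M" "p \<in> fst d \<and> p \<in> fst e" for d e
    using *[of d e] that by (simp add: tvec_at_def)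
  moreover have "snd (tvec_at M c p v) d = 0" if "\<not> (d \<in> M \<and> p \<in> fst d)" for d
    using that by (auto simp: tvec_at_def)
  ultimately show ?thesis unfolding tangent_space_iff fst_tvec_at by blast
qed

lemma fst_tangent_space: "u \<in> tangent_space M p \<Longrightarrow> fst u = p"
  unfolding tangent_space_iff by blast

lemma tangent_space_coord:
  assumes "u \<in> tangent_space M p" "c \<in> M" "p \<in> fst c" "d \<in> M" "p \<in> fst d"
  shows "snd u d = frechet_derivative (transition c d) (at (snd c p)) (snd u c)"
  using assms unfolding tangent_space_iff by blast

lemma tangent_space_junk: "u \<in> tangent_space M p \<Longrightarrow> \<not> (d \<in> M \<and> p \<in> fst d) \<Longrightarrow> snd u d = 0"
  unfolding tangent_space_iff by blast

lemma tangent_space_eq_tvec_at: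
  assumes c: "c \<in> M" "p \<in> fst c" and u: "u \<in> tangent_space M p"
  shows "u = tvec_at M c p (snd u c)"
proof (rule prod_eqI)
  show "fst u = fst (tvec_at M c p (snd u c))" using fst_tangent_space[OF u] by simp
  show "snd u = snd (tvec_at M c p (snd u c))"
  proof
    fix d
    show "snd u d = snd (tvec_at M c p (snd u c)) d"
      using tangent_space_coord[OF u c, of d] tangent_space_junk[OF u, of d]
      by (auto simp: tvec_at_def)
  qed
qed

lemma tangent_ptsE:
  assumes "u \<in> tangent_pts M"
  obtains "fst u \<in> pts M" "u \<in> tangent_space M (fst u)"
  using assms by (auto simp: tangent_pts_def dest: fst_tangent_space)

lemma tangent_ptsI: "p \<in> pts M \<Longrightarrow> u \<in> tangent_space M p \<Longrightarrow> u \<in> tangent_pts M"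
  by (auto simp: tangent_pts_def)

lemma pts_chart:
  assumes "p \<in> pts M" obtains c where "c \<in> M" "p \<in> fst c"
  using assms by (auto simp: pts_def)

lemma pts_chartI: "c \<in> M \<Longrightarrow> p \<in> fst c \<Longrightarrow> p \<in> pts M"
  by (auto simp: pts_def)

text \<open>\<open>differential\<close> evaluates in a chart picked by \<open>SOME\<close>. A change
  of chart moves the derivative of the transition map from the function to the coordinates of
  \<open>u\<close>, so every chart gives the same value.\<close>

lemma differential_eq:
  assumes M: "is_atlas k M" "1 \<le> k" and c: "c \<in> M" "p \<in> fst c"
    and u: "u \<in> tangent_space M p"
    and \<kappa>: "(\<kappa> \<circ> chart_inv c) differentiable (at (snd c p))"
  shows "differential M \<kappa> u = frechet_derivative (\<kappa> \<circ> chart_inv c) (at (snd c p)) (snd u c)"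
proof -
  define d where "d = (SOME c. c \<in> M \<and> fst u \<in> fst c)"
  have p: "fst u = p" using u by (rule fst_tangent_space)
  have d: "d \<in> M" "p \<in> fst d"
    using someI[of "\<lambda>c. c \<in> M \<and> fst u \<in> fst c" c] c p by (auto simp: d_def)
  have "snd u c = frechet_derivative (transition d c) (at (snd d p)) (snd u d)"
    using tangent_space_coord[OF u d c] .
  moreover have "frechet_derivative (\<kappa> \<circ> chart_inv d) (at (snd d p)) =
      frechet_derivative (\<kappa> \<circ> chart_inv c) (at (snd c p)) \<circ>
      frechet_derivative (transition d c) (at (snd d p))"
    using frechet_derivative_eq[OF differentiable_change_chart[OF M d c \<kappa>]] .
  ultimately show ?thesis unfolding differential_def Let_def d_def[symmetric] unfolding p by simp
qed

lemma tangent_vectors_exist: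
  assumes "is_atlas k M" "1 \<le> k" "p \<in> pts M"
  obtains u where "u \<in> tangent_space M p"
  using pts_chart[OF assms(3)] tvec_at_in_tangent_space[OF assms(1,2)] by metis

lemma tlincomb_tvec_at:
  assumes "is_atlas k M" "1 \<le> k" "c \<in> M" "p \<in> fst c"
  shows "tlincomb s (tvec_at M c p v) t (tvec_at M c p w) = tvec_at M c p (s *\<^sub>R v + t *\<^sub>R w)"
proof -
  have l: "linear (frechet_derivative (transition c d) (at (snd c p)))" if "d \<in> M" "p \<in> fst d" for d
    using linear_frechet_derivative transition_differentiable[OF assms that] by blast
  show ?thesis
  proof (rule prod_eqI)
    show "snd (tlincomb s (tvec_at M c p v) t (tvec_at M c p w)) = snd (tvec_at M c p (s *\<^sub>R v + t *\<^sub>R w))"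
    proof
      fix d
      show "snd (tlincomb s (tvec_at M c p v) t (tvec_at M c p w)) d =
          snd (tvec_at M c p (s *\<^sub>R v + t *\<^sub>R w)) d"
        using linear_add[OF l, of d] linear_scale[OF l, of d]
        by (simp add: tlincomb_def tvec_at_def)
    qed
  qed (simp add: tlincomb_def)
qed

text \<open>The first coordinate fixes the base point, and by the transformation rule the
  coordinates in one chart fix the whole tangent vector.\<close>

lemma inj_on_tangent_chart:
  assumes "d \<in> tangent_atlas M" "is_atlas k M"
  shows "inj_on (snd d) (fst d)"
proof -
  obtain c where c: "c \<in> M" "d = ({u\<in>tangent_pts M. fst u \<in> fst c}, \<lambda>u. (snd c (fst u), snd u c))"
    using assms(1) by (auto simp: tangent_atlas_def)
  have i: "inj_on (snd c) (fst c)" using assms(2) c by (simp add: is_atlas_def)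
  show ?thesis
  proof (rule inj_onI)
    fix u w assume u: "u \<in> fst d" and w: "w \<in> fst d" and eq: "snd d u = snd d w"
    have p: "fst u = fst w" using u w eq i by (auto simp: c inj_on_def)
    have rep: "v = tvec_at M c (fst v) (snd v c)" if "v \<in> fst d" for v
    proof -
      have "v \<in> tangent_pts M" "fst v \<in> fst c" using that by (auto simp: c)
      then show ?thesis by (metis tangent_ptsE tangent_space_eq_tvec_at c(1))
    qed
    have "snd u c = snd w c" using eq by (simp add: c)
    then show "u = w" using rep[OF u] rep[OF w] p by metis
  qed
qed

section \<open>Rigidity in local coordinates\<close>

text \<open>\<open>a\<close> is of first order at \<open>x0\<close> and \<open>b\<close> is
  infinitesimal, so the product is of higher than first order. Asking merely for a limit of
  \<open>b\<close> permits factors built from \<open>R\<close>, whose differentiability is not yet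
  known.\<close>

lemma has_derivative_scaleR_zero:
  fixes a :: "'m::real_normed_vector \<Rightarrow> real" and b :: "'m \<Rightarrow> 'b::real_normed_vector"
  assumes a: "(a has_derivative a') (at x0)" and a0: "a x0 = 0" and b: "(b \<longlongrightarrow> 0) (at x0)"
  shows "((\<lambda>x. a x *\<^sub>R b x) has_derivative (\<lambda>_. 0)) (at x0)"
proof -
  have lin: "bounded_linear a'" and
    lim: "((\<lambda>x. (a x - a x0 - a' (x - x0)) / norm (x - x0)) \<longlongrightarrow> 0) (at x0)"
    using a by (auto simp: has_derivative_at_within divide_inverse algebra_simps)
  obtain C where C: "\<And>x. norm (a' x) \<le> norm x * C"
    using bounded_linear.bounded[OF lin] by blast
  have quot: "((\<lambda>x. (a' (x - x0) / norm (x - x0)) *\<^sub>R b x) \<longlongrightarrow> 0) (at x0)"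
  proof (rule Lim_null_comparison)
    have "norm ((a' (x - x0) / norm (x - x0)) *\<^sub>R b x) \<le> \<bar>C\<bar> * norm (b x)" for x
    proof -
      have "\<bar>a' (x - x0)\<bar> \<le> C * norm (x - x0)"
        using C[of "x - x0"] by (simp add: mult.commute)
      also have "\<dots> \<le> \<bar>C\<bar> * norm (x - x0)" by (rule mult_right_mono) auto
      finally have "\<bar>a' (x - x0)\<bar> \<le> \<bar>C\<bar> * norm (x - x0)" .
      then have "\<bar>a' (x - x0)\<bar> / norm (x - x0) \<le> \<bar>C\<bar>"
        by (cases "x = x0") (simp_all add: divide_le_eq)
      then show ?thesis using mult_right_mono[OF _ norm_ge_zero, of _ _ "b x"] by fastforce
    qed
    then show "\<forall>\<^sub>F x in at x0. norm ((a' (x - x0) / norm (x - x0)) *\<^sub>R b x) \<le> \<bar>C\<bar> * norm (b x)"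
      by simp
    show "((\<lambda>x. \<bar>C\<bar> * norm (b x)) \<longlongrightarrow> 0) (at x0)"
      using tendsto_mult[OF tendsto_const tendsto_norm[OF b]] by simp
  qed
  have "((\<lambda>x. ((a x - a x0 - a' (x - x0)) / norm (x - x0)) *\<^sub>R b x
      + (a' (x - x0) / norm (x - x0)) *\<^sub>R b x) \<longlongrightarrow> 0) (at x0)"
    using tendsto_add[OF tendsto_scaleR[OF lim b] quot] by simp
  then have "((\<lambda>x. (a x *\<^sub>R b x) /\<^sub>R norm (x - x0)) \<longlongrightarrow> 0) (at x0)"
    by (simp add: a0 flip: scaleR_add_left add_divide_distrib) (simp add: divide_inverse mult.commute)
  then show ?thesis by (simp add: has_derivative_at_within a0)
qed

text \<open>Differentiability of \<open>R\<close> is not assumed: writing \<open>v = f1 j x0\<close> and \<open>e = f1 j - v\<close>,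
  the difference \<open>R x v - R x0 v\<close> is \<open>(f2 j - R x0 \<circ> f1 j) x - (R x - R x0) (e x)\<close>. The first
  function has derivative \<open>0\<close> at \<open>x0\<close>; in the second \<open>e\<close> is of first order, while \<open>R x - R x0\<close>
  tends to \<open>0\<close> by the same formula because orthogonal maps are bounded.\<close>

lemma orthogonal_frame_derivative_zero:
  fixes R :: "'m::euclidean_space \<Rightarrow> 'b::euclidean_space \<Rightarrow> 'b" and f1 f2 :: "'j \<Rightarrow> 'm \<Rightarrow> 'b"
  assumes S: "open S" "x0 \<in> S"
    and R: "\<And>x. x \<in> S \<Longrightarrow> orthogonal_transformation (R x)"
    and eq: "\<And>x j. x \<in> S \<Longrightarrow> f2 j x = R x (f1 j x)"
    and d1: "\<And>j. (f1 j has_derivative D j) (at x0)"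
    and d2: "\<And>j. (f2 j has_derivative (\<lambda>v. R x0 (D j v))) (at x0)"
    and onto: "\<And>v. \<exists>j. f1 j x0 = v"
  shows "((\<lambda>x. R x v) has_derivative (\<lambda>_. 0)) (at x0)"
proof -
  have lin: "linear (R x)" and nrm: "norm (R x w) = norm w" if "x \<in> S" for x w
    using R[OF that] by (auto simp: orthogonal_transformation)
  have blin: "bounded_linear (R x0)" using lin S(2) linear_conv_bounded_linear by blast
  define h where "h j x = f2 j x - R x0 (f1 j x)" for j x
  have h: "(h j has_derivative (\<lambda>_. 0)) (at x0)" for j
    using has_derivative_diff[OF d2[of j] bounded_linear.has_derivative[OF blin d1[of j]]]
    by (simp add: h_def[abs_def])
  have h0: "h j x0 = 0" for j using eq S(2) by (simp add: h_def)
  have ev: "\<forall>\<^sub>F x in at x0. x \<in> S" using S eventually_at_topological by blast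
  have split: "R x w - R x0 w = h j x - (R x (f1 j x - w) - R x0 (f1 j x - w))"
    if "x \<in> S" for x w j
    using lin[OF that] lin[OF S(2)] eq[OF that, of j] by (simp add: h_def linear_diff)
  have cont: "((\<lambda>x. R x w - R x0 w) \<longlongrightarrow> 0) (at x0)" for w
  proof -
    obtain j where j: "f1 j x0 = w" using onto by blast
    have "(f1 j \<longlongrightarrow> w) (at x0)" "(h j \<longlongrightarrow> 0) (at x0)"
      using has_derivative_continuous[OF d1[of j]] has_derivative_continuous[OF h[of j]] j h0
      by (simp_all add: continuous_at)
    then have "((\<lambda>x. norm (h j x) + 2 * norm (f1 j x - w)) \<longlongrightarrow> 0) (at x0)"
      by (auto intro!: tendsto_eq_intros)
    have bd: "norm (R x w - R x0 w) \<le> norm (h j x) + 2 * norm (f1 j x - w)" if "x \<in> S" for x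
    proof -
      have "norm (R x w - R x0 w) \<le> norm (h j x) + norm (R x (f1 j x - w) - R x0 (f1 j x - w))"
        unfolding split[OF that, of w j] by (rule norm_triangle_ineq4)
      also have "\<dots> \<le> norm (h j x) + (norm (R x (f1 j x - w)) + norm (R x0 (f1 j x - w)))"
        using norm_triangle_ineq4 by simp
      finally show ?thesis using nrm[OF that] nrm[OF S(2)] by simp
    qed
    have "\<forall>\<^sub>F x in at x0. norm (R x w - R x0 w) \<le> norm (h j x) + 2 * norm (f1 j x - w)"
      by (rule eventually_mono[OF ev bd])
    with \<open>((\<lambda>x. norm (h j x) + 2 * norm (f1 j x - w)) \<longlongrightarrow> 0) (at x0)\<close>
    show ?thesis by (rule Lim_null_comparison[rotated])
  qed
  obtain j where j: "f1 j x0 = v" using onto by blast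
  define e where "e x = f1 j x - v" for x
  have e: "(e has_derivative D j) (at x0)" "e x0 = 0"
    using d1[of j] j by (auto simp: e_def[abs_def] intro!: derivative_eq_intros)
  \<comment> \<open>\<open>R x - R x0\<close> acts on a vector that itself varies with
    \<open>x\<close>. Expanding \<open>e x\<close> in \<open>Basis\<close> reduces this to scalars
    of first order times the infinitesimal vectors \<open>R x b - R x0 b\<close>.\<close>
  have "((\<lambda>x. (e x \<bullet> b) *\<^sub>R (R x b - R x0 b)) has_derivative (\<lambda>_. 0)) (at x0)" for b
    by (rule has_derivative_scaleR_zero[OF has_derivative_inner_left[OF e(1)] _ cont]) (simp add: e(2))
  then have sum: "((\<lambda>x. \<Sum>b\<in>Basis. (e x \<bullet> b) *\<^sub>R (R x b - R x0 b)) has_derivative (\<lambda>_. \<Sum>b\<in>(Basis :: 'b set). 0)) (at x0)"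
    by (intro has_derivative_sum)
  have expand: "(\<Sum>b\<in>Basis. (e x \<bullet> b) *\<^sub>R (R x b - R x0 b)) = R x (e x) - R x0 (e x)" if "x \<in> S" for x
  proof -
    have "R y (e x) = (\<Sum>b\<in>Basis. (e x \<bullet> b) *\<^sub>R R y b)" if "y \<in> S" for y
    proof -
      have "R y (\<Sum>b\<in>Basis. (e x \<bullet> b) *\<^sub>R b) = (\<Sum>b\<in>Basis. (e x \<bullet> b) *\<^sub>R R y b)"
        by (simp add: linear_sum[OF lin[OF that]] linear_scale[OF lin[OF that]])
      then show ?thesis by (simp only: euclidean_representation)
    qed
    from this[OF that] this[OF S(2)] show ?thesis
      by (simp add: scaleR_diff_right sum_subtractf)
  qed
  have "((\<lambda>x. h j x - (\<Sum>b\<in>Basis. (e x \<bullet> b) *\<^sub>R (R x b - R x0 b)) + R x0 v) has_derivative (\<lambda>_. 0)) (at x0)"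
    using has_derivative_add[OF has_derivative_diff[OF h[of j] sum] has_derivative_const] by simp
  then show ?thesis
    by (rule has_derivative_transform_within_open[OF _ S])
      (simp add: expand, simp add: e_def flip: split)
qed

text \<open>Linear algebra at one point: \<open>P\<close> stands for the tangent map of the
  projection, \<open>G1\<close>, \<open>G2\<close> for the two configurations, \<open>H1\<close>,
  \<open>H2\<close> for the tangent maps of their shadows, \<open>e1\<close>, \<open>e2\<close> for
  those of the base maps. On the kernel of \<open>P\<close> the second component of
  \<open>H1\<close> is a linear isomorphism, which leaves one candidate for \<open>R\<close>: the
  second component of \<open>H2\<close> after the inverse of this isomorphism.\<close>

lemma orthogonal_transformation_of_equal_invariants:
  fixes P :: "'a::real_vector \<Rightarrow> 'm::real_vector" and G1 G2 H1 H2 :: "'a \<Rightarrow> 'b::euclidean_space \<times> 'b"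
  assumes lin: "linear P" "linear G1" "linear G2" "linear H1" "linear H2"
    and inj: "inj H1"
    and G: "\<And>v. fst (G1 v) = e1 (P v)" "\<And>v. fst (G2 v) = e2 (P v)"
    and H: "\<And>v. fst (H1 v) = e1 (P v)" "\<And>v. fst (H2 v) = e2 (P v)"
    and vert: "\<And>v. P v = 0 \<Longrightarrow> G1 v = H1 v" "\<And>v. P v = 0 \<Longrightarrow> G2 v = H2 v"
    and onto: "\<And>y. \<exists>v. P v = 0 \<and> snd (H1 v) = y"
    and metric: "\<And>v. P v = 0 \<Longrightarrow> norm (snd (H1 v)) = norm (snd (H2 v))"
    and sol: "\<And>z w. G1 z = (0, e1 (P w)) \<Longrightarrow> G2 z = (0, e2 (P w))"
    and con: "\<And>z w. G1 z = (e1 (P w), 0) \<Longrightarrow> G2 z = (e2 (P w), 0)"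
    and conT: "\<And>z w. H1 z = (e1 (P w), 0) \<Longrightarrow> H2 z = (e2 (P w), 0)"
  shows "\<exists>R. orthogonal_transformation R \<and> (\<forall>v. G2 v = map_prod R R (G1 v)) \<and>
    (\<forall>v. H2 v = map_prod R R (H1 v))"
proof -
  have e0: "e1 0 = 0" "e2 0 = 0"
    using H[of 0] lin by (simp_all add: linear_0)
  have inj': "v = w" if "P v = 0" "P w = 0" "snd (H1 v) = snd (H1 w)" for v w
    using inj H(1)[of v] H(1)[of w] that by (auto simp: inj_def prod_eq_iff)
  obtain \<rho> where \<rho>: "\<And>y. P (\<rho> y) = 0" "\<And>y. snd (H1 (\<rho> y)) = y" using onto by metis
  define R where "R y = snd (H2 (\<rho> y))" for y
  have R: "snd (H2 v) = R (snd (H1 v))" if "P v = 0" for v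
    using inj'[OF that \<rho>(1)] \<rho>(2) by (metis R_def)
  have snd_add: "linear (\<lambda>v. snd (H1 v))" "linear (\<lambda>v. snd (H2 v))"
    using lin by (auto intro: linear_compose[unfolded o_def] linear_snd)
  have "linear R"
  proof (rule linearI)
    fix x y
    have "R (x + y) = R (snd (H1 (\<rho> x + \<rho> y)))"
      by (simp add: linear_add[OF snd_add(1)] \<rho>)
    also have "\<dots> = snd (H2 (\<rho> x + \<rho> y))" using R \<rho>(1) by (simp add: linear_add[OF lin(1)])
    finally show "R (x + y) = R x + R y" by (simp add: linear_add[OF snd_add(2)] R_def)
  next
    fix s x
    have "R (s *\<^sub>R x) = R (snd (H1 (s *\<^sub>R \<rho> x)))"
      by (simp add: linear_scale[OF snd_add(1)] \<rho>)
    also have "\<dots> = snd (H2 (s *\<^sub>R \<rho> x))" using R \<rho>(1) by (simp add: linear_scale[OF lin(1)])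
    finally show "R (s *\<^sub>R x) = s *\<^sub>R R x" by (simp add: linear_scale[OF snd_add(2)] R_def)
  qed
  moreover have "norm (R y) = norm y" for y using metric[OF \<rho>(1)] \<rho>(2) by (simp add: R_def)
  ultimately have orth: "orthogonal_transformation R" by (simp add: orthogonal_transformation)
  have R0: "R 0 = 0" using \<open>linear R\<close> by (rule linear_0)
  have Vert1: "H1 v = (0, snd (H1 v))" "H2 v = (0, R (snd (H1 v)))" if "P v = 0" for v
    using H[of v] R[OF that] that e0 by (simp_all add: prod_eq_iff)
  \<comment> \<open>The vertical vector \<open>\<rho> (e1 (P w))\<close> is sent by
    \<open>G1\<close> to a value of the solder form. Under \<open>G2\<close> its fibre component is
    \<open>R (e1 (P w))\<close> because it is vertical, and \<open>e2 (P w)\<close> by the solder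
    hypothesis.\<close>
  have e: "e2 (P w) = R (e1 (P w))" for w
  proof -
    have v: "P (\<rho> (e1 (P w))) = 0" "snd (H1 (\<rho> (e1 (P w)))) = e1 (P w)" using \<rho> by auto
    have "G1 (\<rho> (e1 (P w))) = (0, e1 (P w))" using vert(1)[OF v(1)] Vert1(1)[OF v(1)] v(2) by simp
    from sol[OF this] show ?thesis using vert(2)[OF v(1)] Vert1(2)[OF v(1)] v(2) by simp
  qed
  \<comment> \<open>Used for the pair \<open>G1\<close>, \<open>G2\<close> and for the pair
    \<open>H1\<close>, \<open>H2\<close>. Subtracting the vertical vector with the same fibre
    component as \<open>v\<close> leaves a vector with horizontal image, to which the connection
    hypothesis applies.\<close>
  have main: "K2 v = map_prod R R (K1 v)"
    if "linear K1" "linear K2" "\<And>v. fst (K1 v) = e1 (P v)"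
      "\<And>v. P v = 0 \<Longrightarrow> K1 v = H1 v" "\<And>v. P v = 0 \<Longrightarrow> K2 v = H2 v"
      "\<And>z w. K1 z = (e1 (P w), 0) \<Longrightarrow> K2 z = (e2 (P w), 0)" for K1 K2 v
  proof -
    define w where "w = \<rho> (snd (K1 v))"
    have w: "P w = 0" "K1 w = (0, snd (K1 v))" "K2 w = (0, R (snd (K1 v)))"
      using \<rho> that(4,5)[of w] Vert1[of w] by (simp_all add: w_def)
    have "K1 (v - w) = (e1 (P v), 0)"
      using that(3)[of v] w by (simp add: linear_diff[OF that(1)] prod_eq_iff)
    from that(6)[OF this] have "K2 v = (R (e1 (P v)), 0) + (0, R (snd (K1 v)))"
      using w(3) e[of v] by (simp add: linear_diff[OF that(2)] algebra_simps)
    then show ?thesis using that(3)[of v] by (simp add: prod_eq_iff R0)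
  qed
  have "G2 v = map_prod R R (G1 v)" for v by (rule main) (use lin G vert con in auto)
  moreover have "H2 v = map_prod R R (H1 v)" for v by (rule main) (use lin H conT in auto)
  ultimately show ?thesis using orth by blast
qed

lemma linear_map_prod: "linear R \<Longrightarrow> linear (map_prod R R)"
  by (auto intro!: linearI simp: linear_add linear_scale prod_eq_iff)

lemma linear_affine_fibre:
  assumes "affine_fun (\<lambda>y. snd (g (x, y)))"
  shows "linear (\<lambda>w. snd (g (x, w)) - snd (g (x, 0)))"
proof -
  obtain A c where A: "linear A" "\<And>y. snd (g (x, y)) = A y + c"
    using assms by (auto simp: affine_fun_def)
  have "snd (g (x, w)) - snd (g (x, 0)) = A w" for w by (simp add: A(2) linear_0[OF A(1)])
  then show ?thesis using A(1) by simp
qed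

text \<open>The derivative of an affine map is its linear part. The right-hand side is free of
  \<open>y\<close>, and this later makes the rotation constant along fibres.\<close>

lemma snd_derivative_affine_fibre:
  fixes g :: "'m::euclidean_space \<times> 'f::euclidean_space \<Rightarrow> 'b::euclidean_space \<times> 'b"
  assumes aff: "affine_fun (\<lambda>y. snd (g (x, y)))" and g: "(g has_derivative D) (at (x, y))"
  shows "snd (D (0, w)) = snd (g (x, w)) - snd (g (x, 0))"
proof -
  obtain A c where A: "linear A" "\<And>y. snd (g (x, y)) = A y + c"
    using aff by (auto simp: affine_fun_def)
  have *: "snd (g (x, w)) - snd (g (x, 0)) = A w" for w by (simp add: A(2) linear_0[OF A(1)])
  have "((\<lambda>y. (x, y)) has_derivative (\<lambda>w. (0, w))) (at y)"
    by (auto intro!: derivative_eq_intros)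
  from diff_chain_at[OF this g] have "((\<lambda>y. snd (g (x, y))) has_derivative (\<lambda>w. snd (D (0, w)))) (at y)"
    by (auto simp: o_def intro!: derivative_eq_intros)
  moreover have "((\<lambda>y. snd (g (x, y))) has_derivative A) (at y)"
    unfolding A(2) using A(1) linear_conv_bounded_linear
    by (auto intro!: derivative_eq_intros bounded_linear_imp_has_derivative)
  ultimately show "snd (D (0, w)) = snd (g (x, w)) - snd (g (x, 0))"
    using has_derivative_unique * by metis
qed

text \<open>For \<open>K\<close> the configuration or the tangent map of its shadow at a point, this
  provides the preimages that the pull-backs choose. A vector with vanishing first component has the
  same image under \<open>H\<close> as some vertical vector, so it is vertical by injectivity of
  \<open>H\<close>; and on vertical vectors \<open>K\<close> and \<open>H\<close> agree.\<close>

lemma vertical_complement: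
  fixes P :: "'a::real_vector \<Rightarrow> 'm::real_vector" and K H :: "'a \<Rightarrow> 'b::real_vector \<times> 'b"
  assumes K: "linear K" "\<And>v. fst (K v) = e (P v)" "\<And>v. P v = 0 \<Longrightarrow> K v = H v"
    and H: "inj H" "linear H" "\<And>v. fst (H v) = e (P v)"
    and P: "linear P" and onto: "\<And>y. \<exists>v. P v = 0 \<and> snd (H v) = y"
  shows "inj K" "\<exists>z. K z = (0, y)" "\<exists>z. K z = (e (P w), 0)"
proof -
  have e0: "e 0 = 0"
    using H(3)[of 0] linear_0[OF H(2)] linear_0[OF P] by simp
  show "inj K"
    unfolding linear_injective_0[OF K(1)]
  proof (intro allI impI)
    fix v assume v: "K v = 0"
    obtain v' where v': "P v' = 0" "snd (H v') = snd (H v)" using onto by blast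
    have "H v' = H v" using v' K(2)[of v] v H(3)[of v] H(3)[of v'] e0 by (simp add: prod_eq_iff)
    then have "P v = 0" using H(1) v' by (auto dest: injD)
    then show "v = 0" using K(3)[of v] v linear_injective_0[OF H(2)] H(1) by auto
  qed
  have vert: "\<exists>z. P z = 0 \<and> K z = (0, y)" for y
  proof -
    obtain z where "P z = 0" "snd (H z) = y" using onto by blast
    then show ?thesis using K(3)[of z] H(3)[of z] e0 by (auto simp: prod_eq_iff)
  qed
  then show "\<exists>z. K z = (0, y)" by blast
  obtain z where "K z = (0, snd (K w))" using vert by blast
  then have "K (w - z) = (e (P w), 0)" using K(2)[of w] by (simp add: linear_diff[OF K(1)] prod_eq_iff)
  then show "\<exists>z. K z = (e (P w), 0)" by blast
qed

text \<open>The domain contains whole fibres, so derivatives in base directions can be compared at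
  different points of one fibre. The last clause says that the derivative at any single point
  already singles out \<open>R\<close>, which is what glues neighbouring pieces.\<close>

lemma rigid_of_rigid_derivative:
  fixes g1 g2 :: "'m::euclidean_space \<times> 'f::euclidean_space \<Rightarrow> 'b::euclidean_space \<times> 'b"
  assumes S: "open S" "convex S" "x0 \<in> S" and dim: "DIM('f) = DIM('b)"
    and D1: "\<And>x y. x \<in> S \<Longrightarrow> (g1 has_derivative D1 (x, y)) (at (x, y))"
    and D2: "\<And>x y. x \<in> S \<Longrightarrow> (g2 has_derivative D2 (x, y)) (at (x, y))"
    and R: "\<And>x y. x \<in> S \<Longrightarrow>
        \<exists>R. orthogonal_transformation R \<and> (\<forall>w. D2 (x, y) w = map_prod R R (D1 (x, y) w))"
    and aff1: "\<And>x. x \<in> S \<Longrightarrow> affine_fun (\<lambda>y. snd (g1 (x, y)))"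
    and aff2: "\<And>x. x \<in> S \<Longrightarrow> affine_fun (\<lambda>y. snd (g2 (x, y)))"
    and inj: "\<And>x. x \<in> S \<Longrightarrow> inj (\<lambda>y. snd (g1 (x, y)))"
  shows "\<exists>R t. \<forall>x\<in>S. \<forall>y. g2 (x, y) = map_prod R R (g1 (x, y)) + t \<and>
    (\<forall>R'. (\<forall>w. D2 (x, y) w = map_prod R' R' (D1 (x, y) w)) \<longrightarrow> R' = R)"
proof -
  define A1 where "A1 x w = snd (g1 (x, w)) - snd (g1 (x, 0))" for x w
  define A2 where "A2 x w = snd (g2 (x, w)) - snd (g2 (x, 0))" for x w
  have A1: "snd (D1 (x, y) (0, w)) = A1 x w" and A2: "snd (D2 (x, y) (0, w)) = A2 x w"
    if "x \<in> S" for x y w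
    using snd_derivative_affine_fibre[OF aff1 D1] snd_derivative_affine_fibre[OF aff2 D2] that by (simp_all add: A1_def A2_def)
  have surj: "surj (A1 x)" if "x \<in> S" for x
  proof -
    have "linear (A1 x)" using linear_affine_fibre[OF aff1] that by (simp add: A1_def[abs_def])
    moreover have "inj (A1 x)" using inj[OF that] by (simp add: inj_def A1_def)
    ultimately show ?thesis using linear_injective_imp_surjective dim by fastforce
  qed
  \<comment> \<open>A rotation is chosen at fibre coordinate \<open>0\<close> only;
    \<open>uniq\<close> then shows that it is the right one on the whole fibre over
    \<open>x\<close>.\<close>
  define Q where "Q x = (SOME R. orthogonal_transformation R \<and>
      (\<forall>w. D2 (x, 0) w = map_prod R R (D1 (x, 0) w)))" for x
  have Q': "orthogonal_transformation (Q x) \<and> (\<forall>w. D2 (x, 0) w = map_prod (Q x) (Q x) (D1 (x, 0) w))"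
    if "x \<in> S" for x
    unfolding Q_def by (rule someI_ex[OF R[OF that]])
  have Q: "orthogonal_transformation (Q x)" "D2 (x, 0) w = map_prod (Q x) (Q x) (D1 (x, 0) w)"
    if "x \<in> S" for x w
    using Q'[OF that] by blast+
  have QA: "A2 x w = Q x (A1 x w)" if "x \<in> S" for x w
    using Q(2)[OF that, of "(0, w)"] A1[OF that, of 0 w] A2[OF that, of 0 w] by simp
  \<comment> \<open>The fibre directions \<open>(0, w)\<close> decide: their images under
    \<open>A1 x\<close> do not depend on \<open>y\<close> and fill the whole space.\<close>
  have uniq: "R' = Q x" if x: "x \<in> S" and R': "\<forall>w. D2 (x, y) w = map_prod R' R' (D1 (x, y) w)" for x y R'
  proof
    fix v
    obtain w where w: "v = A1 x w" using surj[OF x] by blast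
    show "R' v = Q x v"
      using R'[rule_format, of "(0, w)"] A1[OF x, of y w] A2[OF x, of y w] QA[OF x, of w] w by simp
  qed
  have D12: "D2 (x, y) w = map_prod (Q x) (Q x) (D1 (x, y) w)" if x: "x \<in> S" for x y w
    using R[OF x, of y] uniq[OF x] by metis
  \<comment> \<open>Differentiates the linear part, applied to a fixed \<open>w\<close>, along the
    base. Since one rotation serves the whole fibre, it can be pulled out of the difference of the
    two derivatives.\<close>
  have dA: "((\<lambda>x. snd (g (x, w)) - snd (g (x, 0))) has_derivative
       (\<lambda>v. snd (D (x, w) (v, 0)) - snd (D (x, 0) (v, 0)))) (at x)"
    if "\<And>y. (g has_derivative D (x, y)) (at (x, y))"
    for g :: "'m \<times> 'f \<Rightarrow> 'b \<times> 'b" and D x w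
  proof -
    have "((\<lambda>x. (x, w)) has_derivative (\<lambda>v. (v, 0))) (at x)" for w :: 'f
      by (auto intro!: derivative_eq_intros)
    from diff_chain_at[OF this that]
    have "((\<lambda>x. snd (g (x, w))) has_derivative (\<lambda>v. snd (D (x, w) (v, 0)))) (at x)" for w
      by (auto simp: o_def intro!: derivative_eq_intros)
    then show ?thesis by (auto intro!: derivative_eq_intros)
  qed
  have Qlin: "linear (Q x)" if "x \<in> S" for x
    using Q(1)[OF that] by (simp add: orthogonal_transformation)
  have "((\<lambda>x. Q x v) has_derivative (\<lambda>_. 0)) (at x)" if x: "x \<in> S" for x v
  proof (rule orthogonal_frame_derivative_zero[where S = S and R = Q
        and ?f1.0 = "\<lambda>w x. A1 x w" and ?f2.0 = "\<lambda>w x. A2 x w"])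
    show "((\<lambda>x. A1 x w) has_derivative (\<lambda>v. snd (D1 (x, w) (v, 0)) - snd (D1 (x, 0) (v, 0)))) (at x)" for w
      unfolding A1_def by (rule dA[OF D1[OF x]])
    have "((\<lambda>x. A2 x w) has_derivative (\<lambda>v. snd (D2 (x, w) (v, 0)) - snd (D2 (x, 0) (v, 0)))) (at x)" for w
      unfolding A2_def by (rule dA[OF D2[OF x]])
    then show "((\<lambda>x. A2 x w) has_derivative
        (\<lambda>v. Q x (snd (D1 (x, w) (v, 0)) - snd (D1 (x, 0) (v, 0))))) (at x)" for w
      by (simp add: D12[OF x] linear_diff[OF Qlin[OF x]])
    show "\<exists>j. A1 x j = v" for v using surj[OF x] by (metis surjD)
  qed (use QA S(1) x Q(1) in auto)
  then have const: "Q x v = Q x0 v" if "x \<in> S" for x v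
    using has_derivative_zero_unique[OF S(2), of "\<lambda>x. Q x v" x x0] that S(3)
    by (metis has_derivative_at_withinI)
  then have Qc: "Q x = Q x0" if "x \<in> S" for x using that by blast
  define t where "t = g2 (x0, 0) - map_prod (Q x0) (Q x0) (g1 (x0, 0))"
  have bl: "bounded_linear (map_prod (Q x0) (Q x0))"
    using linear_map_prod[OF Qlin[OF S(3)]] linear_conv_bounded_linear by blast
  have "((\<lambda>z. g2 z - map_prod (Q x0) (Q x0) (g1 z)) has_derivative (\<lambda>_. 0)) (at z within S \<times> UNIV)"
    if z: "z \<in> S \<times> UNIV" for z
  proof -
    obtain x y where xy: "z = (x, y)" "x \<in> S" using z by auto
    have "((\<lambda>z. g2 z - map_prod (Q x0) (Q x0) (g1 z)) has_derivative
        (\<lambda>v. D2 (x, y) v - map_prod (Q x0) (Q x0) (D1 (x, y) v))) (at z)"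
      using has_derivative_diff[OF D2[OF xy(2)] bounded_linear.has_derivative[OF bl D1[OF xy(2)]]] xy by blast
    then show ?thesis using D12[OF xy(2)] Qc[OF xy(2)] has_derivative_at_withinI by simp
  qed
  then have "g2 z - map_prod (Q x0) (Q x0) (g1 z) = t" if "z \<in> S \<times> UNIV" for z
    unfolding t_def
    by (rule has_derivative_zero_unique[OF convex_Times[OF S(2) convex_UNIV] _ that])
      (use S(3) in auto)
  then have "g2 (x, y) = map_prod (Q x0) (Q x0) (g1 (x, y)) + t" if "x \<in> S" for x y
    using that by (simp add: algebra_simps)
  moreover have "R' = Q x0" if "x \<in> S" "\<forall>w. D2 (x, y) w = map_prod R' R' (D1 (x, y) w)" for x y R'
    using uniq[OF that] Qc[OF that(1)] by simp
  ultimately show ?thesis by blast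
qed

section \<open>Smooth maps and their differentials\<close>

lemma vec_manifold_simps [simp]:
  "pts vec_manifold = UNIV" "c \<in> vec_manifold \<longleftrightarrow> c = (UNIV, id)"
  "chart_inv (UNIV, id) = id" "transition (UNIV, id) (UNIV, id) = id"
  by (auto simp: vec_manifold_def pts_def chart_inv_def transition_def inv_id[unfolded id_def] id_def)

lemma is_atlas_vec_manifold: "is_atlas k (vec_manifold :: ('v::euclidean_space, 'v) atlas)"
proof -
  have "Ck_on k UNIV (id :: 'v \<Rightarrow> 'v)" using Ck_on_affine[OF linear_ident, of k 0] by (simp add: id_def)
  then show ?thesis by (simp add: is_atlas_def)
qed

lemma openin_mtop_vec_manifold:
  "openin (mtop (vec_manifold :: ('v::euclidean_space, 'v) atlas)) W \<longleftrightarrow> open W"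
  unfolding openin_mtop[OF is_atlas_vec_manifold[of 0]] by simp

lemma vec_tvec_simps [simp]: "fst (vec_tvec x w) = x" "vec_coord (vec_tvec x w) = w"
  by (auto simp: vec_tvec_def vec_coord_def)

lemma vec_tvec_eq_iff [simp]: "vec_tvec x w = vec_tvec x' w' \<longleftrightarrow> x = x' \<and> w = w'"
  using vec_tvec_simps by metis

lemma tangent_space_vec_manifold:
  fixes p :: "'a::euclidean_space"
  shows "u \<in> tangent_space vec_manifold p \<longleftrightarrow> u = vec_tvec p (vec_coord u)"
proof -
  have "frechet_derivative id (at x) = id" for x :: 'a
    by (rule frechet_derivative_eq) (rule has_derivative_id)
  then have "u \<in> tangent_space vec_manifold p \<longleftrightarrow>
      fst u = p \<and> (\<forall>c. c \<noteq> (UNIV, id) \<longrightarrow> snd u c = 0)"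
    unfolding tangent_space_iff by simp
  moreover have "u = vec_tvec p (vec_coord u) \<longleftrightarrow>
      fst u = p \<and> snd u = (\<lambda>c. if c = (UNIV, id) then snd u (UNIV, id) else 0)"
    unfolding vec_tvec_def vec_coord_def by (metis fst_conv prod.collapse snd_conv)
  moreover have "snd u = (\<lambda>c. if c = (UNIV, id) then snd u (UNIV, id) else 0) \<longleftrightarrow>
      (\<forall>c. c \<noteq> (UNIV, id) \<longrightarrow> snd u c = 0)"
    unfolding fun_eq_iff[of "snd u"] by metis
  ultimately show ?thesis by blast
qed

lemma vec_tvec_in_tangent [simp]:
  "vec_tvec p w \<in> tangent_space vec_manifold p" "vec_tvec p w \<in> tangent_pts vec_manifold"
  by (auto simp: tangent_space_vec_manifold tangent_pts_def)

lemma tangent_pts_vec_manifold: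
  "u \<in> tangent_pts vec_manifold \<longleftrightarrow> u = vec_tvec (fst u) (vec_coord u)"
  unfolding tangent_pts_def vec_manifold_simps tangent_space_vec_manifold[symmetric]
  using fst_tangent_space by (metis UN_iff UNIV_I)

lemma tangent_pts_vec_manifoldE:
  assumes "u \<in> tangent_pts vec_manifold"
  obtains z w where "u = vec_tvec z w"
  by (rule that) (rule iffD1[OF tangent_pts_vec_manifold assms])

lemma differential_vec_manifold:
  "differential vec_manifold \<kappa> u = frechet_derivative \<kappa> (at (fst u)) (vec_coord u)"
proof -
  have "(SOME c. c \<in> vec_manifold \<and> fst u \<in> fst c) = (UNIV, id)" by (rule some_equality) auto
  then show ?thesis by (simp add: differential_def vec_coord_def)
qed

lemma tangent_map_vec_manifold:
  assumes "u \<in> tangent_pts M"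
  shows "tangent_map M vec_manifold h u = vec_tvec (h (fst u)) (differential M h u)"
proof -
  have "id \<circ> h = h" by auto
  then show ?thesis using assms by (auto simp: tangent_map_def vec_tvec_def)
qed

lemma smooth_map_Ck:
  assumes "smooth_map k M N h" "c \<in> M" "d \<in> N"
  shows "Ck_on k (snd c ` {p \<in> fst c. h p \<in> fst d}) (snd d \<circ> h \<circ> chart_inv c)"
  using assms by (simp add: smooth_map_def)

lemma smooth_map_in: "smooth_map k M N h \<Longrightarrow> p \<in> pts M \<Longrightarrow> h p \<in> pts N"
  by (auto simp: smooth_map_def)

lemma smooth_map_differentiable:
  assumes "smooth_map k M N h" "1 \<le> k" "c \<in> M" "p \<in> fst c" "d \<in> N" "h p \<in> fst d"
  shows "(snd d \<circ> h \<circ> chart_inv c) differentiable (at (snd c p))"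
  by (rule Ck_on_differentiable[OF smooth_map_Ck[OF assms(1,3,5)] assms(2)]) (use assms in auto)

lemma smooth_map_vec_differentiable:
  assumes "smooth_map k M vec_manifold h" "1 \<le> k" "c \<in> M" "p \<in> fst c"
  shows "(h \<circ> chart_inv c) differentiable (at (snd c p))"
proof -
  have "id \<circ> h \<circ> chart_inv c = h \<circ> chart_inv c" by (simp add: comp_def)
  then show ?thesis using smooth_map_differentiable[OF assms, of "(UNIV, id)"] by simp
qed

lemma has_derivative_chain_smooth_map:
  assumes M: "is_atlas k M" and N: "is_atlas k N" and h: "smooth_map k M N h" and k: "1 \<le> k"
    and c: "c \<in> M" "p \<in> fst c" and d: "d \<in> N" "h p \<in> fst d"
    and \<kappa>: "(\<kappa> \<circ> chart_inv d) differentiable (at (snd d (h p)))"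
  shows "((\<kappa> \<circ> h \<circ> chart_inv c) has_derivative
      frechet_derivative (\<kappa> \<circ> chart_inv d) (at (snd d (h p))) \<circ>
      frechet_derivative (snd d \<circ> h \<circ> chart_inv c) (at (snd c p))) (at (snd c p))"
proof -
  let ?S = "snd c ` {p \<in> fst c. h p \<in> fst d}"
  have Ck: "Ck_on k ?S (snd d \<circ> h \<circ> chart_inv c)" by (rule smooth_map_Ck[OF h c(1) d(1)])
  have p: "snd c p \<in> ?S" using c d by blast
  have "((snd d \<circ> h \<circ> chart_inv c) has_derivative
      frechet_derivative (snd d \<circ> h \<circ> chart_inv c) (at (snd c p))) (at (snd c p))"
    using smooth_map_differentiable[OF h k c d] frechet_derivative_works by blast
  moreover have "((\<kappa> \<circ> chart_inv d) has_derivative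
      frechet_derivative (\<kappa> \<circ> chart_inv d) (at (snd d (h p))))
        (at ((snd d \<circ> h \<circ> chart_inv c) (snd c p)))"
    using \<kappa> frechet_derivative_works atlas_chart_inv[OF M c] by auto
  ultimately have "((\<kappa> \<circ> chart_inv d) \<circ> (snd d \<circ> h \<circ> chart_inv c) has_derivative
      frechet_derivative (\<kappa> \<circ> chart_inv d) (at (snd d (h p))) \<circ>
      frechet_derivative (snd d \<circ> h \<circ> chart_inv c) (at (snd c p))) (at (snd c p))"
    by (rule diff_chain_at)
  then show ?thesis
    by (rule has_derivative_transform_within_open[OF _ Ck_on_open[OF Ck] p])
      (auto simp: atlas_chart_inv[OF M c(1)] atlas_chart_inv[OF N d(1)])
qed

lemma tangent_map_coord:
  assumes M: "is_atlas k M" and h: "smooth_map k M N h" and k: "1 \<le> k"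
    and c: "c \<in> M" "p \<in> fst c" and d: "d \<in> N" "h p \<in> fst d" and u: "u \<in> tangent_space M p"
  shows "snd (tangent_map M N h u) d =
    frechet_derivative (snd d \<circ> h \<circ> chart_inv c) (at (snd c p)) (snd u c)"
proof -
  have "u \<in> tangent_pts M" using u c by (auto simp: tangent_pts_def pts_def)
  moreover have "fst u = p" using u by (rule fst_tangent_space)
  ultimately have "snd (tangent_map M N h u) d = differential M (snd d \<circ> h) u"
    using d by (simp add: tangent_map_def)
  then show ?thesis
    using differential_eq[OF M k c u smooth_map_differentiable[OF h k c d]] by simp
qed

lemma fst_tangent_map: "u \<in> tangent_pts M \<Longrightarrow> fst (tangent_map M N h u) = h (fst u)"
  by (simp add: tangent_map_def)

lemma tangent_map_in_tangent_space:
  assumes M: "is_atlas k M" and N: "is_atlas k N" and h: "smooth_map k M N h" and k: "1 \<le> k"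
    and p: "p \<in> pts M" and u: "u \<in> tangent_space M p"
  shows "tangent_map M N h u \<in> tangent_space N (h p)"
proof -
  obtain c where c: "c \<in> M" "p \<in> fst c" using p by (rule pts_chart)
  have up: "u \<in> tangent_pts M" "fst u = p" using u p by (auto simp: tangent_pts_def dest: fst_tangent_space)
  let ?w = "tangent_map M N h u"
  have "snd ?w e = frechet_derivative (transition d e) (at (snd d (h p))) (snd ?w d)"
    if d: "d \<in> N" and e: "e \<in> N" and hp: "h p \<in> fst d \<and> h p \<in> fst e" for d e
  proof -
    have "(snd e \<circ> chart_inv d) differentiable (at (snd d (h p)))"
      using transition_differentiable[OF N k d _ e] hp by (simp add: transition_def)
    from frechet_derivative_eq[OF has_derivative_chain_smooth_map[OF M N h k c d _ this]] hp
    show ?thesis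
      using tangent_map_coord[OF M h k c d _ u] tangent_map_coord[OF M h k c e _ u]
      by (simp add: transition_def)
  qed
  moreover have "snd ?w d = 0" if "\<not> (d \<in> N \<and> h p \<in> fst d)" for d
    using that up by (auto simp: tangent_map_def)
  moreover have "fst ?w = h p" using up by (simp add: fst_tangent_map)
  ultimately show ?thesis unfolding tangent_space_iff by blast
qed

lemma differential_comp_smooth_map:
  assumes M: "is_atlas k M" and N: "is_atlas k N" and h: "smooth_map k M N h" and k: "1 \<le> k"
    and p: "p \<in> pts M" and u: "u \<in> tangent_space M p" and d: "d \<in> N" "h p \<in> fst d"
    and \<kappa>: "(\<kappa> \<circ> chart_inv d) differentiable (at (snd d (h p)))"
  shows "differential M (\<kappa> \<circ> h) u = differential N \<kappa> (tangent_map M N h u)"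
proof -
  obtain c where c: "c \<in> M" "p \<in> fst c" using p by (rule pts_chart)
  note D = has_derivative_chain_smooth_map[OF M N h k c d \<kappa>]
  have "differential M (\<kappa> \<circ> h) u = frechet_derivative (\<kappa> \<circ> h \<circ> chart_inv c) (at (snd c p)) (snd u c)"
    by (rule differential_eq[OF M k c u]) (use D in \<open>auto simp: differentiable_def\<close>)
  also have "\<dots> = frechet_derivative (\<kappa> \<circ> chart_inv d) (at (snd d (h p))) (snd (tangent_map M N h u) d)"
    using frechet_derivative_eq[OF D] tangent_map_coord[OF M h k c d u] by simp
  also have "\<dots> = differential N \<kappa> (tangent_map M N h u)"
    using differential_eq[OF N k d tangent_map_in_tangent_space[OF M N h k p u] \<kappa>] by simp
  finally show ?thesis .
qed

lemma differentiable_chart_cong: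
  assumes M: "is_atlas k M" and c: "c \<in> M" "p \<in> fst c" and eq: "\<And>q. q \<in> pts M \<Longrightarrow> \<kappa> q = \<kappa>' q"
    and \<kappa>: "(\<kappa> \<circ> chart_inv c) differentiable (at (snd c p))"
  shows "(\<kappa>' \<circ> chart_inv c) differentiable (at (snd c p))"
  by (rule differentiable_cong_open[OF atlas_chart_open[OF M c(1)] _ _ \<kappa>])
    (use c atlas_chart_inv[OF M c(1)] eq pts_chartI[OF c(1)] in \<open>auto\<close>)

text \<open>\<open>differential\<close> sees its function through \<open>chart_inv c\<close> on the
  open image of a chart. Hence the default values of extensional maps outside the manifold do not
  affect derivatives.\<close>

lemma differential_cong:
  assumes M: "is_atlas k M" and p: "fst u \<in> pts M" and eq: "\<And>q. q \<in> pts M \<Longrightarrow> \<kappa> q = \<kappa>' q"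
  shows "differential M \<kappa> u = differential M \<kappa>' u"
proof -
  define c where "c = (SOME c. c \<in> M \<and> fst u \<in> fst c)"
  obtain c' where "c' \<in> M" "fst u \<in> fst c'" using p by (rule pts_chart)
  then have c: "c \<in> M" "fst u \<in> fst c"
    using someI[of "\<lambda>c. c \<in> M \<and> fst u \<in> fst c" c'] by (auto simp: c_def)
  have "frechet_derivative (\<kappa> \<circ> chart_inv c) (at (snd c (fst u))) =
      frechet_derivative (\<kappa>' \<circ> chart_inv c) (at (snd c (fst u)))"
    by (rule frechet_derivative_cong_open[OF atlas_chart_open[OF M c(1)]])
      (use c atlas_chart_inv[OF M c(1)] eq pts_chartI[OF c(1)] in \<open>auto\<close>)
  then show ?thesis unfolding differential_def Let_def c_def[symmetric] by simp
qed

lemma differential_affine_comp: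
  fixes K :: "'b::euclidean_space \<Rightarrow> 'c::real_normed_vector"
  assumes M: "is_atlas k M" "1 \<le> k" and c: "c \<in> M" "p \<in> fst c" and u: "u \<in> tangent_space M p"
    and K: "linear K" and \<kappa>: "(\<kappa> \<circ> chart_inv c) differentiable (at (snd c p))"
  shows "differential M (\<lambda>q. K (\<kappa> q) + t) u = K (differential M \<kappa> u)"
proof -
  have "((\<lambda>q. K (\<kappa> q) + t) \<circ> chart_inv c has_derivative
     (\<lambda>v. K (frechet_derivative (\<kappa> \<circ> chart_inv c) (at (snd c p)) v))) (at (snd c p))"
    using frechet_derivative_affine_comp[OF K \<kappa>] by (simp add: comp_def)
  then show ?thesis
    using differential_eq[OF M c u \<kappa>] differential_eq[OF M c u] frechet_derivative_eq
    by (metis (no_types, lifting) differentiable_def)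
qed

section \<open>Configurations\<close>

lemma EE_simps [simp]: "total EE = vec_manifold" "base EE = vec_manifold" "proj EE = fst"
  "trivs EE = {(UNIV, snd)}"
  by (simp_all add: EE_def)

locale material_bundle =
  fixes r :: enat
    and B :: "('p, 'a::euclidean_space, 'q, 'm::euclidean_space, 'f::euclidean_space) bundle_data"
  assumes r: "1 \<le> r" and B: "affine_bundle (r + 1) B" and rank: "DIM('f) = 3"
begin

lemma r1: "1 \<le> r + 1"
  using r by (metis add.commute add_increasing zero_le)

lemma atlas: "is_atlas (r + 1) (total B)" "is_atlas (r + 1) (base B)"
  using B by (auto simp: affine_bundle_def manifold_def)

lemma proj_smooth: "smooth_map (r + 1) (total B) (base B) (proj B)"
  using B by (simp add: affine_bundle_def)

lemma proj_in: "X \<in> pts (total B) \<Longrightarrow> proj B X \<in> pts (base B)"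
  by (rule smooth_map_in[OF proj_smooth])

lemma proj_onto: "q \<in> pts (base B) \<Longrightarrow> \<exists>X\<in>pts (total B). proj B X = q"
proof -
  assume q: "q \<in> pts (base B)"
  have "proj B ` pts (total B) = pts (base B)" using B by (simp add: affine_bundle_def)
  then show ?thesis using q by (metis imageE)
qed

lemma Tproj_in: "X \<in> pts (total B) \<Longrightarrow> u \<in> tangent_space (total B) X \<Longrightarrow>
    Tproj B u \<in> tangent_space (base B) (proj B X)"
  unfolding Tproj_def by (rule tangent_map_in_tangent_space[OF atlas proj_smooth r1])

lemma tangent_space_nonempty: "X \<in> pts (total B) \<Longrightarrow> \<exists>u. u \<in> tangent_space (total B) X"
  using tangent_vectors_exist[OF atlas(1) r1] by metis

lemma trivs_cover:
  assumes "X \<in> pts (total B)" obtains t where "t \<in> trivs B" "proj B X \<in> fst t"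
proof -
  have "pts (base B) = (\<Union>(U, \<psi>)\<in>trivs B. U)" using B by (simp add: affine_bundle_def)
  then show ?thesis using that proj_in[OF assms] by fastforce
qed

text \<open>Every point carries a tangent vector, so the base points of the values of
  \<open>L\<close> pin down \<open>l\<close> on the bundle, and extensionality pins it down
  elsewhere. This justifies the \<open>THE\<close> in \<open>shadow\<close>.\<close>

lemma shadow_eq:
  assumes "l \<in> extensional (pts (total B))"
    and "\<And>p u. p \<in> pts (total B) \<Longrightarrow> u \<in> tangent_space (total B) p \<Longrightarrow> fst (L u) = l p"
  shows "shadow B L = l"
  unfolding shadow_def
proof (rule the_equality)
  show "l \<in> extensional (pts (total B)) \<and> (\<forall>u\<in>tangent_pts (total B). fst (L u) = l (fst u))"
    using assms by (auto elim: tangent_ptsE)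
next
  fix l' assume l': "l' \<in> extensional (pts (total B)) \<and>
    (\<forall>u\<in>tangent_pts (total B). fst (L u) = l' (fst u))"
  show "l' = l"
  proof (rule extensionalityI)
    fix p assume p: "p \<in> pts (total B)"
    then obtain u where u: "u \<in> tangent_space (total B) p" using tangent_space_nonempty by blast
    then have "fst u = p" "u \<in> tangent_pts (total B)"
      using fst_tangent_space[OF u] tangent_ptsI[OF p u] by simp_all
    then show "l' p = l p" using l' assms(2)[OF p u] by metis
  qed (use l' assms in auto)
qed

text \<open>Surjectivity of the projection gives uniqueness on the base; the restriction settles the
  values elsewhere.\<close>

lemma base_map_eq:
  assumes "\<And>a. a \<in> pts (total B) \<Longrightarrow> proj D (l a) = lb (proj B a)"
  shows "base_map B D l = restrict lb (pts (base B))"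
  unfolding base_map_def
proof (rule the_equality)
  show "restrict lb (pts (base B)) \<in> extensional (pts (base B)) \<and>
    (\<forall>a\<in>pts (total B). proj D (l a) = restrict lb (pts (base B)) (proj B a))"
    using assms proj_in by auto
next
  fix m assume m: "m \<in> extensional (pts (base B)) \<and>
    (\<forall>a\<in>pts (total B). proj D (l a) = m (proj B a))"
  show "m = restrict lb (pts (base B))"
  proof (rule extensionalityI)
    fix q assume "q \<in> pts (base B)"
    then show "m q = restrict lb (pts (base B)) q" using m assms proj_onto by fastforce
  qed (use m in auto)
qed

context
  fixes l :: "'p \<Rightarrow> E_tot" assumes l: "l \<in> Aff_maps r B EE"
begin

lemma Aff_ext: "l \<in> extensional (pts (total B))"
  using l by (simp add: Aff_maps_def)

lemma Aff_smooth: "smooth_map (r + 1) (total B) vec_manifold l"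
  using l by (simp add: Aff_maps_def)

lemma Aff_differentiable:
  "c \<in> total B \<Longrightarrow> X \<in> fst c \<Longrightarrow> (l \<circ> chart_inv c) differentiable (at (snd c X))"
  using smooth_map_vec_differentiable[OF Aff_smooth r1] .

lemma Aff_base_map:
  obtains lb where "smooth_map (r + 1) (base B) vec_manifold lb"
    "base_map B EE l = restrict lb (pts (base B))"
    "\<And>a. a \<in> pts (total B) \<Longrightarrow> fst (l a) = lb (proj B a)"
    "\<And>t x. t \<in> trivs B \<Longrightarrow> x \<in> fst t \<Longrightarrow> \<exists>h. affine_fun h \<and> (\<forall>a\<in>fibre B x. snd (l a) = h (snd t a))"
proof -
  obtain lb where lb: "smooth_map (r + 1) (base B) vec_manifold lb"
    "\<forall>a\<in>pts (total B). fst (l a) = lb (proj B a)"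
    "\<forall>(U, \<psi>)\<in>trivs B. \<forall>x\<in>U. \<exists>h. affine_fun h \<and> (\<forall>a\<in>fibre B x. snd (l a) = h (\<psi> a))"
    using l by (auto simp: Aff_maps_def)
  show ?thesis
  proof (rule that[OF lb(1)])
    show "base_map B EE l = restrict lb (pts (base B))"
      by (rule base_map_eq) (use lb(2) in simp)
    show "\<exists>h. affine_fun h \<and> (\<forall>a\<in>fibre B x. snd (l a) = h (snd t a))"
      if "t \<in> trivs B" "x \<in> fst t" for t x
      using lb(3) that by (cases t) auto
  qed (use lb(2) in blast)
qed

lemma base_map_differentiable:
  assumes "c \<in> base B" "q \<in> fst c"
  shows "(base_map B EE l \<circ> chart_inv c) differentiable (at (snd c q))"
proof -
  obtain lb where lb: "smooth_map (r + 1) (base B) vec_manifold lb"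
    "base_map B EE l = restrict lb (pts (base B))" by (rule Aff_base_map)
  show ?thesis
    by (rule differentiable_chart_cong[OF atlas(2) assms, of lb])
      (use lb smooth_map_vec_differentiable[OF lb(1) r1 assms] in auto)
qed

lemma fst_Aff: "a \<in> pts (total B) \<Longrightarrow> fst (l a) = base_map B EE l (proj B a)"
  using proj_in by (rule_tac Aff_base_map) auto

lemma Aff_fibre:
  "t \<in> trivs B \<Longrightarrow> x \<in> fst t \<Longrightarrow> \<exists>h. affine_fun h \<and> (\<forall>a\<in>fibre B x. snd (l a) = h (snd t a))"
  by (rule_tac Aff_base_map) blast

lemma Tbase_map_eq:
  assumes "w \<in> tangent_pts (base B)"
  shows "Tbase_map B EE l w = vec_tvec (base_map B EE l (fst w)) (differential (base B) (base_map B EE l) w)"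
  unfolding Tbase_map_def EE_simps using tangent_map_vec_manifold[OF assms] .

text \<open>Both sides differentiate the same function: the first component of \<open>l\<close> is
  the base map after the projection.\<close>

lemma fst_differential:
  assumes X: "X \<in> pts (total B)" and u: "u \<in> tangent_space (total B) X"
  shows "fst (differential (total B) l u) = differential (base B) (base_map B EE l) (Tproj B u)"
proof -
  obtain c where c: "c \<in> total B" "X \<in> fst c" using X by (rule pts_chart)
  obtain d where d: "d \<in> base B" "proj B X \<in> fst d" using proj_in[OF X] by (rule pts_chart)
  have "fst (differential (total B) l u) = differential (total B) (\<lambda>q. fst (l q) + 0) u"
    using differential_affine_comp[OF atlas(1) r1 c u linear_fst Aff_differentiable[OF c], of 0] by simp
  also have "\<dots> = differential (total B) (base_map B EE l \<circ> proj B) u"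
    by (rule differential_cong[OF atlas(1)])
      (use X fst_tangent_space[OF u] fst_Aff in auto)
  also have "\<dots> = differential (base B) (base_map B EE l) (tangent_map (total B) (base B) (proj B) u)"
    by (rule differential_comp_smooth_map[OF atlas proj_smooth r1 X u d base_map_differentiable[OF d]])
  finally show ?thesis by (simp add: Tproj_def)
qed

end

lemma pa_over_shadow:
  assumes "pa_over r B EE l F" shows "shadow B F = l"
proof (rule shadow_eq)
  show "l \<in> extensional (pts (total B))" using assms by (simp add: pa_over_def Aff_ext)
  show "fst (F u) = l p" if "p \<in> pts (total B)" "u \<in> tangent_space (total B) p" for p u
    using assms that unfolding pa_over_def vb_morphism_over_def by (metis fst_tangent_space)
qed

lemma Conf_pa: "F \<in> Conf r B \<Longrightarrow> pa_over r B EE (shadow B F) F"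
  using pa_over_shadow by (auto simp: Conf_def L_pa_def)

lemma shadow_tangent_map:
  assumes "l \<in> Aff_maps r B EE"
  shows "shadow B (tangent_map (total B) vec_manifold l) = l"
  by (rule shadow_eq[OF Aff_ext[OF assms]])
    (simp add: fst_tangent_map tangent_ptsI fst_tangent_space)

context
  fixes F assumes F: "F \<in> Conf r B"
begin

lemma Conf_Aff: "shadow B F \<in> Aff_maps r B EE"
  using Conf_pa[OF F] by (simp add: pa_over_def)

lemma Conf_ext: "F \<in> extensional (tangent_pts (total B))"
  using Conf_pa[OF F] by (simp add: pa_over_def vb_morphism_over_def)

lemma Conf_eq:
  assumes "X \<in> pts (total B)" "u \<in> tangent_space (total B) X"
  shows "F u = vec_tvec (shadow B F X) (vec_coord (F u))"
proof -
  have "F u \<in> tangent_space vec_manifold (shadow B F X)"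
    using Conf_pa[OF F] assms by (simp add: pa_over_def vb_morphism_over_def)
  then show ?thesis unfolding tangent_space_vec_manifold .
qed

lemma Conf_lincomb:
  assumes "X \<in> pts (total B)" "u \<in> tangent_space (total B) X" "w \<in> tangent_space (total B) X"
  shows "vec_coord (F (tlincomb s u t w)) = s *\<^sub>R vec_coord (F u) + t *\<^sub>R vec_coord (F w)"
proof -
  have "F (tlincomb s u t w) = tlincomb s (F u) t (F w)"
    using Conf_pa[OF F] assms by (simp add: pa_over_def vb_morphism_over_def)
  then show ?thesis by (simp add: tlincomb_def vec_coord_def)
qed

text \<open>In canonical coordinates the ambient projection reads off first components, so this is
  the compatibility of \<open>F\<close> with the tangent map of its base map. With
  \<open>fst_differential\<close> it follows that \<open>F\<close> and the tangent map of its shadow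
  can differ only in the second component.\<close>

lemma Conf_fst:
  assumes X: "X \<in> pts (total B)" and u: "u \<in> tangent_space (total B) X"
  shows "fst (vec_coord (F u)) = differential (base B) (base_map B EE (shadow B F)) (Tproj B u)"
proof -
  have up: "u \<in> tangent_pts (total B)" by (rule tangent_ptsI[OF X u])
  have wp: "Tproj B u \<in> tangent_pts (base B)"
    by (rule tangent_ptsI[OF proj_in[OF X] Tproj_in[OF X u]])
  have Fu: "F u = vec_tvec (shadow B F X) (vec_coord (F u))" by (rule Conf_eq[OF X u])
  have Fp: "F u \<in> tangent_pts vec_manifold" by (subst Fu) simp
  have "Tproj EE (F u) = vec_tvec (fst (fst (F u))) (differential vec_manifold fst (F u))"
    unfolding Tproj_def EE_simps using tangent_map_vec_manifold[OF Fp] .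
  moreover have "differential vec_manifold fst (F u) = fst (vec_coord (F u))"
    unfolding differential_vec_manifold
    using frechet_derivative_eq[OF bounded_linear_imp_has_derivative[OF bounded_linear_fst]] by metis
  moreover have "Tproj EE (F u) = Tbase_map B EE (shadow B F) (Tproj B u)"
    using Conf_pa[OF F] up by (simp add: pa_over_def)
  ultimately show ?thesis using Tbase_map_eq[OF Conf_Aff wp] by (metis vec_tvec_simps(2))
qed

lemma Conf_vertical:
  assumes "X \<in> pts (total B)" "u \<in> vertical_space B X"
  shows "vec_coord (F u) = differential (total B) (shadow B F) u"
proof -
  have "u \<in> tangent_space (total B) X" using assms by (simp add: vertical_space_def)
  then have up: "u \<in> tangent_pts (total B)" by (rule tangent_ptsI[OF assms(1)])
  have "F u = tangent_map (total B) vec_manifold (shadow B F) u"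
    using Conf_pa[OF F] assms by (simp add: pa_over_def)
  then show ?thesis using tangent_map_vec_manifold[OF up, of "shadow B F"] by simp
qed

lemma shadow_inj: "inj_on (shadow B F) (pts (total B))"
proof -
  have "embedding_map (mtop (total B)) (mtop vec_manifold) (shadow B F)"
    using F by (simp add: Conf_def smooth_embedding_def)
  then show ?thesis
    using embedding_map_def homeomorphic_imp_injective_map topspace_mtop[OF atlas(1)]
    by metis
qed

lemma differential_shadow_inj:
  assumes X: "X \<in> pts (total B)"
  shows "inj_on (differential (total B) (shadow B F)) (tangent_space (total B) X)"
proof -
  have "inj_on (tangent_map (total B) vec_manifold (shadow B F)) (tangent_space (total B) X)"
    using F X by (simp add: Conf_def smooth_embedding_def)
  moreover have "tangent_map (total B) vec_manifold (shadow B F) u =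
      vec_tvec (shadow B F X) (differential (total B) (shadow B F) u)"
    if "u \<in> tangent_space (total B) X" for u
    using tangent_map_vec_manifold[OF tangent_ptsI[OF X that]] fst_tangent_space[OF that] by simp
  ultimately show ?thesis by (simp add: inj_on_def)
qed

end

end

section \<open>Inverses of the local trivialisations and their derivatives in coordinates\<close>

definition triv_section ::
  "('p, 'a, 'q, 'm, 'f) bundle_data \<Rightarrow> ('q set \<times> ('p \<Rightarrow> 'f)) \<Rightarrow> 'q \<times> 'f \<Rightarrow> 'p" where
  "triv_section B t = inv_into {a \<in> pts (total B). proj B a \<in> fst t} (\<lambda>a. (proj B a, snd t a))"

text \<open>The source carries the product of the base chart \<open>d\<close> with the identity on
  the typical fibre, cut down to the part of the base over which \<open>t\<close> is defined; the
  target carries the chart \<open>c\<close>.\<close>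

definition triv_section_deriv ::
  "('p, 'a::euclidean_space, 'q, 'm::euclidean_space, 'f::euclidean_space) bundle_data \<Rightarrow>
    ('q set \<times> ('p \<Rightarrow> 'f)) \<Rightarrow> ('q, 'm) chart \<Rightarrow> ('p, 'a) chart \<Rightarrow> 'm \<times> 'f \<Rightarrow> 'm \<times> 'f \<Rightarrow> 'a" where
  "triv_section_deriv B t d c z = frechet_derivative
     (snd c \<circ> triv_section B t \<circ> chart_inv ((fst d \<inter> fst t) \<times> UNIV, map_prod (snd d) id)) (at z)"

lemma pts_open_submanifold: "pts (open_submanifold M W) = pts M \<inter> W"
  by (auto simp: pts_def open_submanifold_def)

lemma pts_prod_manifold: "pts (prod_manifold M N) = pts M \<times> pts N"
  by (fastforce simp: pts_def prod_manifold_def)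

context material_bundle
begin

lemma triv:
  assumes "t \<in> trivs B"
  shows "openin (mtop (base B)) (fst t)"
    and "diffeo (r + 1) (open_submanifold (total B) {a \<in> pts (total B). proj B a \<in> fst t})
      (prod_manifold (open_submanifold (base B) (fst t)) vec_manifold) (\<lambda>a. (proj B a, snd t a))"
proof -
  have "\<forall>(U, \<psi>)\<in>trivs B. openin (mtop (base B)) U \<and>
        diffeo (r + 1) (open_submanifold (total B) {a \<in> pts (total B). proj B a \<in> U})
          (prod_manifold (open_submanifold (base B) U) vec_manifold)
          (\<lambda>a. (proj B a, \<psi> a))"
    using B by (simp add: affine_bundle_def)
  then have *: "openin (mtop (base B)) (fst t) \<and>
        diffeo (r + 1) (open_submanifold (total B) {a \<in> pts (total B). proj B a \<in> fst t})
          (prod_manifold (open_submanifold (base B) (fst t)) vec_manifold)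
          (\<lambda>a. (proj B a, snd t a))"
    using assms by (simp add: case_prod_beta)
  from * show "openin (mtop (base B)) (fst t)" by blast
  from * show "diffeo (r + 1) (open_submanifold (total B) {a \<in> pts (total B). proj B a \<in> fst t})
      (prod_manifold (open_submanifold (base B) (fst t)) vec_manifold) (\<lambda>a. (proj B a, snd t a))" by blast
qed

lemma triv_subset: "t \<in> trivs B \<Longrightarrow> fst t \<subseteq> pts (base B)"
  using openin_subset[OF triv(1)] topspace_mtop[OF atlas(2)] by simp

lemma triv_bij:
  assumes "t \<in> trivs B"
  shows "bij_betw (\<lambda>a. (proj B a, snd t a)) {a \<in> pts (total B). proj B a \<in> fst t} (fst t \<times> UNIV)"
proof -
  have "pts (base B) \<inter> fst t = fst t" using triv_subset[OF assms] by blast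
  moreover have "pts (total B) \<inter> {a \<in> pts (total B). proj B a \<in> fst t} =
    {a \<in> pts (total B). proj B a \<in> fst t}" by blast
  ultimately show ?thesis
    using triv(2)[OF assms]
    by (simp add: diffeo_def pts_open_submanifold pts_prod_manifold)
qed

lemma triv_section:
  assumes t: "t \<in> trivs B" and q: "q \<in> fst t"
  shows "triv_section B t (q, y) \<in> pts (total B)"
    and "proj B (triv_section B t (q, y)) = q"
    and "snd t (triv_section B t (q, y)) = y"
proof -
  have "(q, y) \<in> (\<lambda>a. (proj B a, snd t a)) ` {a \<in> pts (total B). proj B a \<in> fst t}"
    using bij_betw_imp_surj_on[OF triv_bij[OF t]] q by simp
  note i = inv_into_into[OF this] f_inv_into_f[OF this]
  show "triv_section B t (q, y) \<in> pts (total B)" "proj B (triv_section B t (q, y)) = q"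
    "snd t (triv_section B t (q, y)) = y"
    using i by (simp_all add: triv_section_def)
qed

lemma triv_section_proj:
  assumes t: "t \<in> trivs B" and a: "a \<in> pts (total B)" "proj B a \<in> fst t"
  shows "triv_section B t (proj B a, snd t a) = a"
  unfolding triv_section_def
  using inv_into_f_f[OF bij_betw_imp_inj_on[OF triv_bij[OF t]], of a] a by simp

text \<open>Passes from charts of the total space to trivialising coordinates, where affinity in the
  fibre variable can be exploited. The functions of interest are the base chart after the
  projection, and the shadow.\<close>

lemma triv_section_has_derivative:
  assumes t: "t \<in> trivs B" and d: "d \<in> base B" "q \<in> fst d" "q \<in> fst t"
    and c: "c \<in> total B" "triv_section B t (q, y) \<in> fst c"
    and \<kappa>: "(\<kappa> \<circ> chart_inv c) differentiable (at (snd c (triv_section B t (q, y))))"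
  shows "((\<lambda>(x, y). \<kappa> (triv_section B t (chart_inv d x, y))) has_derivative
      frechet_derivative (\<kappa> \<circ> chart_inv c) (at (snd c (triv_section B t (q, y)))) \<circ>
      triv_section_deriv B t d c (snd d q, y)) (at (snd d q, y))"
proof -
  let ?W = "{a \<in> pts (total B). proj B a \<in> fst t}"
  let ?C = "((fst d \<inter> fst t) \<times> UNIV, map_prod (snd d) id) :: ('q \<times> 'f, 'm \<times> 'f) chart"
  let ?D = "(fst c \<inter> ?W, snd c)"
  let ?s = "triv_section B t"
  have smooth: "smooth_map (r + 1) (prod_manifold (open_submanifold (base B) (fst t)) vec_manifold)
      (open_submanifold (total B) ?W) ?s"
  proof -
    have "pts (open_submanifold (total B) ?W) = ?W" by (auto simp: pts_open_submanifold)
    then show ?thesis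
      using triv(2)[OF t] by (simp add: diffeo_def triv_section_def)
  qed
  have C: "?C \<in> prod_manifold (open_submanifold (base B) (fst t)) vec_manifold"
    using d(1) by (force simp: prod_manifold_def open_submanifold_def image_iff)
  have D: "?D \<in> open_submanifold (total B) ?W"
    using c(1) by (force simp: open_submanifold_def)
  let ?S = "snd ?C ` {p \<in> fst ?C. ?s p \<in> fst ?D}"
  have Ck: "Ck_on (r + 1) ?S (snd ?D \<circ> ?s \<circ> chart_inv ?C)"
    by (rule smooth_map_Ck[OF smooth C D])
  \<comment> \<open>The charts of the open submanifold are cut down to the trivialised part, where
    all values of \<open>triv_section\<close> lie anyway.\<close>
  have in_D: "?s (q', y') \<in> fst ?D \<longleftrightarrow> ?s (q', y') \<in> fst c" if "q' \<in> fst t" for q' y'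
    using triv_section[OF t that] that by simp
  have p: "(snd d q, y) \<in> ?S" using d c in_D[OF d(3), of y] by force
  have injd: "inj_on (snd d) (fst d)" using atlas(2) d(1) by (simp add: is_atlas_def)
  then have "inj_on (snd d) (fst d \<inter> fst t)" by (rule inj_on_subset) simp
  then have injC: "inj_on (snd ?C) (fst ?C)" by (auto simp: inj_on_def)
  have invC: "chart_inv ?C (snd d q', y') = (q', y')" if "q' \<in> fst d" "q' \<in> fst t" for q' y'
    using chart_inv_snd[OF injC, of "(q', y')"] that by simp
  have "((snd c \<circ> ?s \<circ> chart_inv ?C) has_derivative triv_section_deriv B t d c (snd d q, y)) (at (snd d q, y))"
    unfolding triv_section_deriv_def
    using Ck_on_differentiable[OF Ck r1 p] by (simp flip: frechet_derivative_works)
  moreover have "((\<kappa> \<circ> chart_inv c) has_derivative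
      frechet_derivative (\<kappa> \<circ> chart_inv c) (at (snd c (?s (q, y)))))
      (at ((snd c \<circ> ?s \<circ> chart_inv ?C) (snd d q, y)))"
    using \<kappa> by (simp add: invC[OF d(2,3)] flip: frechet_derivative_works)
  ultimately have "((\<kappa> \<circ> chart_inv c) \<circ> (snd c \<circ> ?s \<circ> chart_inv ?C) has_derivative
      frechet_derivative (\<kappa> \<circ> chart_inv c) (at (snd c (?s (q, y)))) \<circ>
      triv_section_deriv B t d c (snd d q, y)) (at (snd d q, y))"
    by (rule diff_chain_at)
  then show ?thesis
  proof (rule has_derivative_transform_within_open[OF _ Ck_on_open[OF Ck] p])
    fix z assume "z \<in> ?S"
    then obtain q' y' where z: "z = (snd d q', y')" "q' \<in> fst d" "q' \<in> fst t" "?s (q', y') \<in> fst c"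
      by auto
    show "((\<kappa> \<circ> chart_inv c) \<circ> (snd c \<circ> ?s \<circ> chart_inv ?C)) z =
        (case z of (x, y) \<Rightarrow> \<kappa> (?s (chart_inv d x, y)))"
      using z invC[OF z(2,3)] atlas_chart_inv[OF atlas(1) c(1) z(4)] chart_inv_snd[OF injd z(2)] by simp
  qed
qed

text \<open>The base component of the shadow is constant along a fibre, so injectivity of the shadow
  becomes injectivity of its fibre component.\<close>

lemma Conf_triv_fibre:
  assumes F: "F \<in> Conf r B" and t: "t \<in> trivs B" and q: "q \<in> fst t"
  shows "affine_fun (\<lambda>y. snd (shadow B F (triv_section B t (q, y))))"
    and "inj (\<lambda>y. snd (shadow B F (triv_section B t (q, y))))"
proof -
  obtain h where h: "affine_fun h" "\<And>a. a \<in> fibre B q \<Longrightarrow> snd (shadow B F a) = h (snd t a)"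
    using Aff_fibre[OF Conf_Aff[OF F] t q] by blast
  have "snd (shadow B F (triv_section B t (q, y))) = h y" for y
    using h(2)[of "triv_section B t (q, y)"] triv_section[OF t q] by (simp add: fibre_def)
  then show "affine_fun (\<lambda>y. snd (shadow B F (triv_section B t (q, y))))" using h(1) by presburger
  show "inj (\<lambda>y. snd (shadow B F (triv_section B t (q, y))))"
  proof (rule injI)
    fix y y' assume "snd (shadow B F (triv_section B t (q, y))) = snd (shadow B F (triv_section B t (q, y')))"
    moreover have "fst (shadow B F (triv_section B t (q, y))) = base_map B EE (shadow B F) q" for y
      using fst_Aff[OF Conf_Aff[OF F]] triv_section[OF t q] by metis
    ultimately have "shadow B F (triv_section B t (q, y)) = shadow B F (triv_section B t (q, y'))"
      by (simp add: prod_eq_iff)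
    then have "triv_section B t (q, y) = triv_section B t (q, y')"
      using inj_onD[OF shadow_inj[OF F]] triv_section[OF t q] by blast
    then show "y = y'" using triv_section(3)[OF t q] by metis
  qed
qed

end

text \<open>The two \<open>inv_into\<close> terms denote one element. Seen from \<open>f\<close> it
  is \<open>z\<close>, by injectivity; seen from \<open>g\<close> it is a genuine preimage of
  \<open>b\<close>, because \<open>b\<close> is attained.\<close>

lemma inv_into_eqD:
  assumes "inv_into A f a = inv_into A g b" "inj_on f A" "z \<in> A" "f z = a" "b \<in> g ` A"
  shows "g z = b"
  using assms by (metis f_inv_into_f inv_into_f_f)

text \<open>The tangent maps at a point in coordinates: \<open>fibre_map F\<close>, \<open>Dshadow F\<close>, \<open>Dproj\<close> and
  \<open>Dbase F\<close> are \<open>F\<^sub>X\<close>, \<open>T\<^sub>X\<phi>\<close>, \<open>T\<^sub>X\<pi>\<close> and the tangent map of the base map of \<open>\<phi>\<close>.\<close>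

locale bundle_point = material_bundle r B
  for r :: enat
    and B :: "('p, 'a::euclidean_space, 'q, 'm::euclidean_space, 'f::euclidean_space) bundle_data" +
  fixes X :: 'p and c :: "('p, 'a) chart" and d :: "('q, 'm) chart" and t :: "'q set \<times> ('p \<Rightarrow> 'f)"
  assumes c: "c \<in> total B" "X \<in> fst c" and d: "d \<in> base B" "proj B X \<in> fst d"
    and t: "t \<in> trivs B" "proj B X \<in> fst t"
begin

abbreviation "vec_at \<equiv> tvec_at (total B) c X"

definition "Dproj = frechet_derivative (snd d \<circ> proj B \<circ> chart_inv c) (at (snd c X))"

definition "Dshadow F = frechet_derivative (shadow B F \<circ> chart_inv c) (at (snd c X))"

definition "fibre_map F v = vec_coord (F (vec_at v))"

definition "Dbase F = frechet_derivative (base_map B EE (shadow B F) \<circ> chart_inv d) (at (snd d (proj B X)))"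

lemma X: "X \<in> pts (total B)"
  using c by (rule pts_chartI)

lemma vec_at: "vec_at v \<in> tangent_space (total B) X"
  by (rule tvec_at_in_tangent_space[OF atlas(1) r1 c])

lemma vec_at_coord: "snd (vec_at v) c = v"
  by (rule tvec_at_coord[OF atlas(1) c])

lemma vec_at_onto: "u \<in> tangent_space (total B) X \<Longrightarrow> u = vec_at (snd u c)"
  by (rule tangent_space_eq_tvec_at[OF c])

lemma X_eq: "triv_section B t (proj B X, snd t X) = X"
  by (rule triv_section_proj[OF t(1) X t(2)])

lemma proj_differentiable: "(snd d \<circ> proj B \<circ> chart_inv c) differentiable (at (snd c X))"
  by (rule smooth_map_differentiable[OF proj_smooth r1 c d])

lemma linear_Dproj: "linear Dproj"
  unfolding Dproj_def by (rule linear_frechet_derivative[OF proj_differentiable])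

lemma Tproj_vec_at:
  "Tproj B (vec_at v) = tvec_at (base B) d (proj B X) (Dproj v)"
proof -
  have "snd (Tproj B (vec_at v)) d = Dproj v"
    unfolding Tproj_def Dproj_def
    using tangent_map_coord[OF atlas(1) proj_smooth r1 c d vec_at] vec_at_coord by simp
  then show ?thesis
    using tangent_space_eq_tvec_at[OF d Tproj_in[OF X vec_at]] by metis
qed

lemma tvec_at_zero: "tvec_at (base B) d (proj B X) 0 = tzero (proj B X)"
proof -
  have "frechet_derivative (transition d e) (at (snd d (proj B X))) 0 = 0"
    if "e \<in> base B" "proj B X \<in> fst e" for e
    by (rule linear_0[OF linear_frechet_derivative[OF transition_differentiable[OF atlas(2) r1 d that]]])
  then show ?thesis by (auto simp: tvec_at_def tzero_def)
qed

lemma vertical_vec_at: "Dproj v = 0 \<Longrightarrow> vec_at v \<in> vertical_space B X"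
  using Tproj_vec_at[of v] tvec_at_zero vec_at by (simp add: vertical_space_def)

text \<open>In trivialising coordinates the projection is the first projection. In particular the
  directions \<open>(0, w)\<close> yield vertical vectors.\<close>

lemma Dproj_section:
  "Dproj (triv_section_deriv B t d c (snd d (proj B X), snd t X) w) = fst w"
proof -
  let ?S = "snd d ` (fst t \<inter> fst d) \<times> (UNIV :: 'f set)"
  have "open (snd d ` (fst t \<inter> fst d))"
    using triv(1)[OF t(1)] d(1) openin_mtop[OF atlas(2)] by blast
  then have S: "open ?S" by (rule open_Times) simp
  have z: "(snd d (proj B X), snd t X) \<in> ?S" using d t by blast
  have injd: "inj_on (snd d) (fst d)" using atlas(2) d(1) by (simp add: is_atlas_def)
  have "((\<lambda>(x, y). (snd d \<circ> proj B) (triv_section B t (chart_inv d x, y))) has_derivative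
      Dproj \<circ> triv_section_deriv B t d c (snd d (proj B X), snd t X)) (at (snd d (proj B X), snd t X))"
    using triv_section_has_derivative[OF t(1) d t(2) c(1), of "snd t X" "snd d \<circ> proj B"]
      c proj_differentiable unfolding X_eq Dproj_def by blast
  then have "(fst has_derivative Dproj \<circ> triv_section_deriv B t d c (snd d (proj B X), snd t X))
      (at (snd d (proj B X), snd t X))"
    by (rule has_derivative_transform_within_open[OF _ S z])
      (use triv_section(2)[OF t(1)] chart_inv_snd[OF injd] in auto)
  then have "Dproj \<circ> triv_section_deriv B t d c (snd d (proj B X), snd t X) = fst"
    by (rule has_derivative_unique) (rule bounded_linear_imp_has_derivative[OF bounded_linear_fst])
  then show ?thesis by (metis comp_apply)
qed

context
  fixes F assumes F: "F \<in> Conf r B"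
begin

lemma shadow_differentiable: "(shadow B F \<circ> chart_inv c) differentiable (at (snd c X))"
  by (rule Aff_differentiable[OF Conf_Aff[OF F] c])

lemma differential_vec_at: "differential (total B) (shadow B F) (vec_at v) = Dshadow F v"
  unfolding Dshadow_def
  using differential_eq[OF atlas(1) r1 c vec_at shadow_differentiable] vec_at_coord by simp

lemma differential_base:
  "differential (base B) (base_map B EE (shadow B F)) (tvec_at (base B) d (proj B X) w) = Dbase F w"
  unfolding Dbase_def
  using differential_eq[OF atlas(2) r1 d tvec_at_in_tangent_space[OF atlas(2) r1 d]
      base_map_differentiable[OF Conf_Aff[OF F] d]] tvec_at_coord[OF atlas(2) d] by simp

lemma linear_Dshadow: "linear (Dshadow F)"
  unfolding Dshadow_def by (rule linear_frechet_derivative[OF shadow_differentiable])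

lemma linear_fibre_map: "linear (fibre_map F)"
proof -
  have *: "fibre_map F (s *\<^sub>R v + s' *\<^sub>R w) = s *\<^sub>R fibre_map F v + s' *\<^sub>R fibre_map F w" for s s' v w
    unfolding fibre_map_def using Conf_lincomb[OF F X vec_at vec_at]
      tlincomb_tvec_at[OF atlas(1) r1 c] by metis
  show ?thesis
    by (rule linearI) (use *[of 1 _ 1] *[of _ _ 0] in simp_all)
qed

lemma inj_Dshadow: "inj (Dshadow F)"
proof (rule injI)
  fix v w assume "Dshadow F v = Dshadow F w"
  then have "vec_at v = vec_at w"
    using inj_onD[OF differential_shadow_inj[OF F X] _ vec_at vec_at] differential_vec_at by metis
  then show "v = w" using vec_at_coord by metis
qed

lemma fst_Dshadow: "fst (Dshadow F v) = Dbase F (Dproj v)"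
  using fst_differential[OF Conf_Aff[OF F] X vec_at]
  by (simp add: differential_vec_at Tproj_vec_at differential_base)

lemma fst_fibre_map: "fst (fibre_map F v) = Dbase F (Dproj v)"
  using Conf_fst[OF F X vec_at] unfolding fibre_map_def
  by (simp add: Tproj_vec_at differential_base)

lemma fibre_map_vertical: "Dproj v = 0 \<Longrightarrow> fibre_map F v = Dshadow F v"
  using Conf_vertical[OF F X vertical_vec_at] differential_vec_at by (simp add: fibre_map_def)

lemma shadow_section_has_derivative:
  "((\<lambda>(x, y). shadow B F (triv_section B t (chart_inv d x, y))) has_derivative
    Dshadow F \<circ> triv_section_deriv B t d c (snd d (proj B X), snd t X)) (at (snd d (proj B X), snd t X))"
  using triv_section_has_derivative[OF t(1) d t(2) c(1), of "snd t X" "shadow B F"]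
    c shadow_differentiable unfolding X_eq Dshadow_def by blast

text \<open>This is where the rank enters: the linear part of the fibre component of the shadow is
  injective between spaces of dimension three, hence onto, and its values are derivatives along
  vertical vectors.\<close>

lemma Dshadow_onto: "\<exists>v. Dproj v = 0 \<and> snd (Dshadow F v) = y"
proof -
  let ?g = "\<lambda>(x, y). shadow B F (triv_section B t (chart_inv d x, y))"
  let ?x = "snd d (proj B X)"
  let ?A = "\<lambda>w. snd (?g (?x, w)) - snd (?g (?x, 0))"
  have inv: "chart_inv d ?x = proj B X" by (rule atlas_chart_inv[OF atlas(2) d])
  have aff: "affine_fun (\<lambda>y. snd (?g (?x, y)))" and inj: "inj (\<lambda>y. snd (?g (?x, y)))"
    using Conf_triv_fibre[OF F t] by (simp_all add: inv)
  have "inj ?A" using inj by (simp add: inj_def)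
  then have "surj ?A"
    by (intro linear_injective_imp_surjective linear_affine_fibre[OF aff]) (simp_all add: rank)
  then obtain w where w: "y = ?A w" by blast
  have "snd ((Dshadow F \<circ> triv_section_deriv B t d c (?x, snd t X)) (0, w)) = ?A w"
    by (rule snd_derivative_affine_fibre[OF aff shadow_section_has_derivative])
  then show ?thesis using w Dproj_section[of "(0, w)"] by (metis comp_apply fst_conv)
qed

lemmas complement_fibre_map = vertical_complement[OF linear_fibre_map fst_fibre_map
    fibre_map_vertical inj_Dshadow linear_Dshadow fst_Dshadow linear_Dproj Dshadow_onto]

lemmas complement_Dshadow = vertical_complement[OF linear_Dshadow fst_Dshadow
    refl inj_Dshadow linear_Dshadow fst_Dshadow linear_Dproj Dshadow_onto]

lemma Conf_vec_at: "F (vec_at v) = vec_tvec (shadow B F X) (fibre_map F v)"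
  unfolding fibre_map_def by (rule Conf_eq[OF F X vec_at])

lemma Tshadow_vec_at:
  "tangent_map (total B) vec_manifold (shadow B F) (vec_at v) = vec_tvec (shadow B F X) (Dshadow F v)"
  using tangent_map_vec_manifold[OF tangent_ptsI[OF X vec_at], of "shadow B F"]
  by (simp add: differential_vec_at)

text \<open>Apart from the choice of a preimage under \<open>L\<close>, a pull-back uses only the
  shadow of \<open>L\<close>. So one formula covers both \<open>F\<close> and the tangent map of its
  shadow.\<close>

lemma pull_back_vec_at:
  assumes "shadow B L = shadow B F"
  shows "pull_back B \<kappa> L X (tvec_at (base B) d (proj B X) w) =
    inv_into (tangent_space (total B) X) L
      (\<kappa> (shadow B F X) (vec_tvec (base_map B EE (shadow B F) (proj B X)) (Dbase F w)))"
proof -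
  have w: "tvec_at (base B) d (proj B X) w \<in> tangent_space (base B) (proj B X)"
    by (rule tvec_at_in_tangent_space[OF atlas(2) r1 d])
  have "tvec_at (base B) d (proj B X) w \<in> tangent_pts (base B)"
    by (rule tangent_ptsI[OF proj_in[OF X] w])
  from Tbase_map_eq[OF Conf_Aff[OF F] this] show ?thesis
    using w X by (simp add: pull_back_def assms differential_base)
qed

end

text \<open>Turns an equality of pull-backs into an implication between coordinate equations, the
  form in which the solder and connection hypotheses of
  \<open>orthogonal_transformation_of_equal_invariants\<close> are stated.\<close>

lemma pull_back_eqD:
  assumes eq: "inv_into (tangent_space (total B) X) L (vec_tvec a k) =
      inv_into (tangent_space (total B) X) L' (vec_tvec a' k')"
    and L: "\<And>v. L (vec_at v) = vec_tvec a (K v)" and L': "\<And>v. L' (vec_at v) = vec_tvec a' (K' v)"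
    and K: "inj K" "K z = k" and K': "\<exists>z. K' z = k'"
  shows "K' z = k'"
proof -
  have "inj_on L (tangent_space (total B) X)"
  proof (rule inj_onI)
    fix u w assume u: "u \<in> tangent_space (total B) X" and w: "w \<in> tangent_space (total B) X"
      and Luw: "L u = L w"
    then have "K (snd u c) = K (snd w c)"
      using L vec_at_onto[OF u] vec_at_onto[OF w] by (metis vec_tvec_simps(2))
    then show "u = w" using K(1) vec_at_onto[OF u] vec_at_onto[OF w] by (metis injD)
  qed
  moreover have "vec_tvec a' k' \<in> L' ` tangent_space (total B) X"
    using K' L' vec_at by (metis imageI)
  ultimately have "L' (vec_at z) = vec_tvec a' k'"
    using inv_into_eqD[OF eq _ vec_at] L K(2) by metis
  then show ?thesis using L' by (metis vec_tvec_simps(2))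
qed

lemma rotation_at_point:
  assumes F: "F1 \<in> Conf r B" "F2 \<in> Conf r B" and inv: "invariants B F1 = invariants B F2"
  shows "\<exists>R. orthogonal_transformation R \<and>
    (\<forall>v. fibre_map F2 v = map_prod R R (fibre_map F1 v)) \<and>
    (\<forall>v. Dshadow F2 v = map_prod R R (Dshadow F1 v))"
proof (rule orthogonal_transformation_of_equal_invariants[where P = Dproj and ?e1.0 = "Dbase F1" and ?e2.0 = "Dbase F2"])
  let ?T = "\<lambda>F. tangent_map (total B) vec_manifold (shadow B F)"
  note sT = shadow_tangent_map[OF Conf_Aff]
  have eqs: "pull_back_metric_v B F1 = pull_back_metric_v B F2"
    "pull_back B solder F1 = pull_back B solder F2"
    "pull_back B connection F1 = pull_back B connection F2"
    "pull_back B connection (?T F1) = pull_back B connection (?T F2)"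
    using inv by (simp_all add: invariants_def)
  show "norm (snd (Dshadow F1 v)) = norm (snd (Dshadow F2 v))" if v: "Dproj v = 0" for v
  proof -
    have V: "vec_at v \<in> vertical_space B X" by (rule vertical_vec_at[OF v])
    \<comment> \<open>On a vertical vector the first component vanishes, so \<open>iota\<close>
      leaves the second one. Diagonal values of the form suffice, since a linear map that preserves
      norms is orthogonal.\<close>
    have m: "pull_back_metric_v B F (vec_at v, vec_at v) = (norm (snd (Dshadow F v)))\<^sup>2"
      if F: "F \<in> Conf r B" for F
    proof -
      have "Dbase F 0 = 0"
        unfolding Dbase_def
        by (rule linear_0[OF linear_frechet_derivative[OF base_map_differentiable[OF Conf_Aff[OF F] d]]])
      then have "fst (fibre_map F v) = 0" using fst_fibre_map[OF F] v by simp
      moreover have "pull_back_metric_v B F (vec_at v, vec_at v) = pseudo_metric (F (vec_at v)) (F (vec_at v))"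
        using V X by (auto simp: pull_back_metric_v_def)
      ultimately show ?thesis
        using fibre_map_vertical[OF F v]
        by (simp add: pseudo_metric_def euclid_metric_def iota_def Conf_vec_at[OF F] power2_norm_eq_inner)
    qed
    show ?thesis using m[OF F(1)] m[OF F(2)] eqs(1) by simp
  qed
  show "fibre_map F2 z = (0, Dbase F2 (Dproj w))" if z: "fibre_map F1 z = (0, Dbase F1 (Dproj w))" for z w
  proof (rule pull_back_eqD[OF _ Conf_vec_at[OF F(1)] Conf_vec_at[OF F(2)]
        complement_fibre_map(1)[OF F(1)] z complement_fibre_map(2)[OF F(2)]])
    show "inv_into (tangent_space (total B) X) F1 (vec_tvec (shadow B F1 X) (0, Dbase F1 (Dproj w))) =
        inv_into (tangent_space (total B) X) F2 (vec_tvec (shadow B F2 X) (0, Dbase F2 (Dproj w)))"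
      using pull_back_vec_at[OF F(1) refl, of solder "Dproj w"]
        pull_back_vec_at[OF F(2) refl, of solder "Dproj w"] eqs(2) by (simp add: solder_def)
  qed
  show "fibre_map F2 z = (Dbase F2 (Dproj w), 0)" if z: "fibre_map F1 z = (Dbase F1 (Dproj w), 0)" for z w
  proof (rule pull_back_eqD[OF _ Conf_vec_at[OF F(1)] Conf_vec_at[OF F(2)]
        complement_fibre_map(1)[OF F(1)] z complement_fibre_map(3)[OF F(2)]])
    show "inv_into (tangent_space (total B) X) F1 (vec_tvec (shadow B F1 X) (Dbase F1 (Dproj w), 0)) =
        inv_into (tangent_space (total B) X) F2 (vec_tvec (shadow B F2 X) (Dbase F2 (Dproj w), 0))"
      using pull_back_vec_at[OF F(1) refl, of connection "Dproj w"]
        pull_back_vec_at[OF F(2) refl, of connection "Dproj w"] eqs(3) by (simp add: connection_def)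
  qed
  show "Dshadow F2 z = (Dbase F2 (Dproj w), 0)" if z: "Dshadow F1 z = (Dbase F1 (Dproj w), 0)" for z w
  proof (rule pull_back_eqD[OF _ Tshadow_vec_at[OF F(1)] Tshadow_vec_at[OF F(2)]
        complement_Dshadow(1)[OF F(1)] z complement_Dshadow(3)[OF F(2)]])
    show "inv_into (tangent_space (total B) X) (?T F1) (vec_tvec (shadow B F1 X) (Dbase F1 (Dproj w), 0)) =
        inv_into (tangent_space (total B) X) (?T F2) (vec_tvec (shadow B F2 X) (Dbase F2 (Dproj w), 0))"
      using pull_back_vec_at[OF F(1) sT[OF F(1)], of connection "Dproj w"]
        pull_back_vec_at[OF F(2) sT[OF F(2)], of connection "Dproj w"] eqs(4) by (simp add: connection_def)
  qed
qed (use F in \<open>simp_all add: linear_Dproj linear_fibre_map linear_Dshadow inj_Dshadow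
      fst_fibre_map fst_Dshadow fibre_map_vertical Dshadow_onto\<close>)

end

section \<open>The generalised Galilean group\<close>

text \<open>Normal form of the generalised Galilean maps. The first half of \<open>t\<close> is the
  translation of space; the second half shifts the fibres and is invisible to
  \<open>iota\<close>.\<close>

definition galilean :: "(R3 \<Rightarrow> R3) \<Rightarrow> E_tot \<Rightarrow> E_tot \<Rightarrow> E_tot" where
  "galilean R t z = map_prod R R z + t"

lemma has_derivative_linear_translate:
  fixes K :: "'a::euclidean_space \<Rightarrow> 'b::real_normed_vector"
  assumes "linear K"
  shows "((\<lambda>z. K z + t) has_derivative K) (at z)"
  using has_derivative_add[OF bounded_linear_imp_has_derivative has_derivative_const, of K] assms
  by (simp add: linear_conv_bounded_linear)

lemma tangent_map_affine:
  fixes K :: "'a::euclidean_space \<Rightarrow> 'b::euclidean_space"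
  assumes "linear K"
  shows "tangent_map vec_manifold vec_manifold (\<lambda>z. K z + t) (vec_tvec z w) = vec_tvec (K z + t) (K w)"
  using tangent_map_vec_manifold[OF vec_tvec_in_tangent(2), of "\<lambda>z. K z + t" z w]
    frechet_derivative_eq[OF has_derivative_linear_translate[OF assms]]
  by (simp add: differential_vec_manifold)

lemma tangent_map_galilean:
  assumes "linear R"
  shows "tangent_map vec_manifold vec_manifold (galilean R t) (vec_tvec z w) =
    vec_tvec (galilean R t z) (map_prod R R w)"
  unfolding galilean_def[abs_def] by (rule tangent_map_affine[OF linear_map_prod[OF assms]])

lemma mtop_vec_manifold: "mtop (vec_manifold :: ('v::euclidean_space, 'v) atlas) = euclidean"
  by (simp add: topology_eq openin_mtop_vec_manifold)

lemma continuous_map_mtop_vec_manifold: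
  fixes h :: "'a::euclidean_space \<Rightarrow> 'b::euclidean_space"
  assumes "continuous_on UNIV h"
  shows "continuous_map (mtop vec_manifold) (mtop vec_manifold) h"
  using assms by (simp add: mtop_vec_manifold)

lemma smooth_map_affine:
  fixes K :: "'a::euclidean_space \<Rightarrow> 'b::euclidean_space"
  assumes "linear K"
  shows "smooth_map k vec_manifold vec_manifold (\<lambda>z. K z + t)"
proof -
  have "continuous_on UNIV (\<lambda>z. K z + t)"
    using assms by (intro continuous_intros linear_continuous_on) (simp add: linear_conv_bounded_linear)
  then show ?thesis
    using continuous_map_mtop_vec_manifold Ck_on_affine[OF assms, of k t]
    by (simp add: smooth_map_def comp_def)
qed

text \<open>On vectors \<open>iota\<close> adds the two components, and acting by the same linear
  \<open>R\<close> on both commutes with this addition.\<close>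

lemma galilean_in_TGGal:
  assumes R: "orthogonal_transformation R"
  shows "tangent_map vec_manifold vec_manifold (galilean R t) \<in> TGGal r"
proof -
  have lin: "linear R" using R by (simp add: orthogonal_transformation)
  have Aff: "galilean R t \<in> Aff_maps r EE EE"
  proof -
    have "affine_fun (\<lambda>y. R y + snd t)" using lin by (auto simp: affine_fun_def)
    then have "\<exists>h. affine_fun h \<and> (\<forall>a\<in>fibre EE x. snd (galilean R t a) = h (snd a))" for x
      by (intro exI[of _ "\<lambda>y. R y + snd t"]) (simp add: galilean_def)
    moreover have "smooth_map (r + 1) vec_manifold vec_manifold (galilean R t)"
      unfolding galilean_def[abs_def] by (rule smooth_map_affine[OF linear_map_prod[OF lin]])
    moreover have "smooth_map (r + 1) vec_manifold vec_manifold (\<lambda>x. R x + fst t)"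
      by (rule smooth_map_affine[OF lin])
    moreover have "fst (galilean R t a) = R (fst a) + fst t" for a by (simp add: galilean_def)
    ultimately show ?thesis
      unfolding Aff_maps_def by simp blast
  qed
  have "orthogonal_matrix (matrix R)" using R orthogonal_transformation_matrix by blast
  then have "(\<lambda>x. R x + fst t) \<in> Gal"
    unfolding Gal_def using fun_cong[OF matrix_vector_mul(2)[OF lin]] by (fastforce intro: exI[of _ "matrix R"])
  then have "tangent_map vec_manifold vec_manifold (\<lambda>x. R x + fst t) \<in> TGal" by (simp add: TGal_def)
  moreover have "iota (tangent_map vec_manifold vec_manifold (galilean R t) u) =
      tangent_map vec_manifold vec_manifold (\<lambda>x. R x + fst t) (iota u)"
    if "u \<in> tangent_pts vec_manifold" for u
  proof -
    obtain z w where u: "u = vec_tvec z w" using \<open>u \<in> _\<close> by (rule tangent_pts_vec_manifoldE)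
    show ?thesis
      unfolding u tangent_map_galilean[OF lin] iota_def tangent_map_affine[OF lin] vec_tvec_simps
      by (simp add: galilean_def linear_add[OF lin])
  qed
  ultimately show ?thesis
    unfolding TGGal_def mem_Collect_eq EE_simps
    using Aff by (intro exI[of _ "galilean R t"] conjI refl bexI ballI)
qed

text \<open>Comparing base points under \<open>iota\<close> gives
  \<open>fst (a z) = R (fst z) + s\<close>. Differentiation yields the first half of the derivative
  of \<open>a\<close>; comparing vectors prescribes the sum of both halves, hence also the second.
  The derivative is thus the constant \<open>R \<times> R\<close>, which integrates to an affine
  map.\<close>

lemma TGGal_galilean:
  assumes "Q \<in> TGGal r"
  obtains R t where "orthogonal_transformation R" "Q = tangent_map vec_manifold vec_manifold (galilean R t)"
proof -
  obtain a O' where Q: "Q = tangent_map vec_manifold vec_manifold a" and a: "a \<in> Aff_maps r EE EE"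
    and O': "O' \<in> TGal" "\<And>u. u \<in> tangent_pts vec_manifold \<Longrightarrow>
      iota (tangent_map vec_manifold vec_manifold a u) = O' (iota u)"
    using assms by (auto simp: TGGal_def simp del: split_paired_All)
  obtain A s where A: "orthogonal_matrix A"
    and OA: "O' = tangent_map vec_manifold vec_manifold (\<lambda>x. A *v x + s)"
    using O'(1) by (auto simp: TGal_def Gal_def)
  define R where "R = (\<lambda>x. A *v x)"
  have lin: "linear R" unfolding R_def by simp
  have R: "orthogonal_transformation R"
    using A lin unfolding orthogonal_transformation_matrix R_def by simp
  have smooth: "smooth_map (r + 1) vec_manifold vec_manifold a"
    using a by (simp add: Aff_maps_def)
  have diff: "a differentiable (at z)" for z
    using smooth_map_vec_differentiable[OF smooth, of "(UNIV, id)" z]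
    by (simp add: add_increasing)
  have main: "fst (a z) = R (fst z) + s \<and> fst (frechet_derivative a (at z) w) + snd (frechet_derivative a (at z) w)
      = R (fst w + snd w)" for z w
  proof -
    have "iota (tangent_map vec_manifold vec_manifold a (vec_tvec z w)) =
        vec_tvec (fst (a z)) (fst (frechet_derivative a (at z) w) + snd (frechet_derivative a (at z) w))"
      using tangent_map_vec_manifold[OF vec_tvec_in_tangent(2), of a z w]
      by (simp add: iota_def differential_vec_manifold)
    moreover have "O' (iota (vec_tvec z w)) = vec_tvec (R (fst z) + s) (R (fst w + snd w))"
      unfolding OA R_def[symmetric] iota_def vec_tvec_simps
      using tangent_map_affine[OF lin, of s] by (simp add: R_def)
    ultimately show ?thesis using O'(2)[of "vec_tvec z w"] by simp
  qed
  have D: "(a has_derivative map_prod R R) (at z)" for z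
  proof -
    have a': "(a has_derivative frechet_derivative a (at z)) (at z)"
      using diff by (simp flip: frechet_derivative_works)
    have "((\<lambda>z. fst (a z)) has_derivative (\<lambda>w. fst (frechet_derivative a (at z) w))) (at z)"
      using has_derivative_fst[OF a'] .
    moreover have "((\<lambda>z. fst (a z)) has_derivative (\<lambda>w. R (fst w))) (at z)"
      using has_derivative_linear_translate[OF linear_compose[OF linear_fst lin], of s z] main
      by (simp add: comp_def)
    ultimately have "(\<lambda>w. fst (frechet_derivative a (at z) w)) = (\<lambda>w. R (fst w))"
      by (rule has_derivative_unique)
    then have f: "fst (frechet_derivative a (at z) w) = R (fst w)" for w by (rule fun_cong)
    have "frechet_derivative a (at z) w = map_prod R R w" for w
      using main[of z w] f[of w] by (simp add: prod_eq_iff linear_add[OF lin])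
    then have "frechet_derivative a (at z) = map_prod R R" by blast
    then show ?thesis using a' by simp
  qed
  define t where "t = a 0"
  have "((\<lambda>z. a z - map_prod R R z) has_derivative (\<lambda>_. 0)) (at z within UNIV)" for z
    using has_derivative_diff[OF D has_derivative_linear_translate[OF linear_map_prod[OF lin], of 0]]
    by simp
  then have *: "a z - map_prod R R z = a 0 - map_prod R R 0" for z
    by (rule has_derivative_zero_unique[OF convex_UNIV]) auto
  have "a z = galilean R t z" for z
  proof -
    have "a z = (a z - map_prod R R z) + map_prod R R z" by simp
    also have "\<dots> = (a 0 - map_prod R R 0) + map_prod R R z" by (simp only: *[of z])
    also have "\<dots> = galilean R t z"
      by (simp only: linear_0[OF linear_map_prod[OF lin]] galilean_def t_def diff_zero add.commute)
    finally show ?thesis .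
  qed
  then have "a = galilean R t" by (rule ext)
  then show ?thesis using that R Q by blast
qed


section \<open>Equal invariants imply Galilean equivalence\<close>

text \<open>Seen in another chart, the set is the preimage of \<open>S\<close> under a transition
  map, which is continuous.\<close>

lemma openin_mtop_chart:
  assumes M: "is_atlas k M" and c: "c \<in> M" and S: "open S"
  shows "openin (mtop M) {p \<in> fst c. snd c p \<in> S}"
  unfolding openin_mtop[OF M]
proof (intro conjI ballI)
  show "{p \<in> fst c. snd c p \<in> S} \<subseteq> pts M" using c by (auto simp: pts_def)
  fix e assume e: "e \<in> M"
  let ?V = "snd e ` (fst e \<inter> fst c)"
  have Ck: "Ck_on k ?V (transition e c)" by (rule atlas_transition[OF M e c])
  then have "Ck_on_nat 0 ?V (transition e c)" unfolding Ck_on_def by (metis zero_enat_def zero_le)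
  then have "open (?V \<inter> transition e c -` S)"
    using continuous_open_preimage[OF _ Ck_on_open[OF Ck] S] by simp
  moreover have "?V \<inter> transition e c -` S = snd e ` ({p \<in> fst c. snd c p \<in> S} \<inter> fst e)"
    using atlas_chart_inv[OF M e] by (auto simp: transition_def)
  ultimately show "open (snd e ` ({p \<in> fst c. snd c p \<in> S} \<inter> fst e))" by simp
qed

lemma connected_space_locally_constant:
  assumes "connected_space T" "x \<in> topspace T" "y \<in> topspace T"
    and loc: "\<And>x. x \<in> topspace T \<Longrightarrow> \<exists>W. openin T W \<and> x \<in> W \<and> (\<forall>y\<in>W. f y = f x)"
  shows "f x = f y"
proof -
  have op: "openin T {z \<in> topspace T. P (f z)}" for P
  proof (subst openin_subopen, intro ballI)
    fix z assume z: "z \<in> {z \<in> topspace T. P (f z)}"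
    then obtain W where W: "openin T W" "z \<in> W" "\<forall>y\<in>W. f y = f z" using loc by blast
    have "y \<in> topspace T \<and> P (f y)" if y: "y \<in> W" for y
      using openin_subset[OF W(1)] y z bspec[OF W(3) y] by auto
    then show "\<exists>W. openin T W \<and> z \<in> W \<and> W \<subseteq> {z \<in> topspace T. P (f z)}"
      using W by blast
  qed
  have "topspace T - {z \<in> topspace T. f z = f x} = {z \<in> topspace T. f z \<noteq> f x}" by blast
  then have "closedin T {z \<in> topspace T. f z = f x}"
    using op[of "\<lambda>v. v \<noteq> f x"] by (simp add: closedin_def)
  then have "{z \<in> topspace T. f z = f x} = topspace T"
    using assms(1,2) op[of "\<lambda>v. v = f x"] unfolding connected_space_clopen_in by blast
  then have "y \<in> {z \<in> topspace T. f z = f x}" using assms(3) by blast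
  then show ?thesis by simp
qed

context material_bundle
begin

text \<open>Chart-free form of the relation found in \<open>rotation_at_point\<close>. The charts
  and the trivialisation used there depend on the point, whereas rotations at different points have
  to be compared.\<close>

definition rotates :: "(('p, 'a) tvec \<Rightarrow> (E_tot, E_tot) tvec) \<Rightarrow>
    (('p, 'a) tvec \<Rightarrow> (E_tot, E_tot) tvec) \<Rightarrow> 'p \<Rightarrow> (R3 \<Rightarrow> R3) \<Rightarrow> bool" where
  "rotates F1 F2 X R \<longleftrightarrow> orthogonal_transformation R \<and> (\<forall>u\<in>tangent_space (total B) X.
     vec_coord (F2 u) = map_prod R R (vec_coord (F1 u)) \<and>
     differential (total B) (shadow B F2) u = map_prod R R (differential (total B) (shadow B F1) u))"

lemma rotates_exists:
  assumes F: "F1 \<in> Conf r B" "F2 \<in> Conf r B" and inv: "invariants B F1 = invariants B F2"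
    and X: "X \<in> pts (total B)"
  shows "\<exists>R. rotates F1 F2 X R"
proof -
  obtain c where c: "c \<in> total B" "X \<in> fst c" using X by (rule pts_chart)
  obtain d where d: "d \<in> base B" "proj B X \<in> fst d" using proj_in[OF X] by (rule pts_chart)
  obtain t where t: "t \<in> trivs B" "proj B X \<in> fst t" using X by (rule trivs_cover)
  interpret bundle_point r B X c d t by unfold_locales (use c d t in auto)
  obtain R where R: "orthogonal_transformation R"
    "\<And>v. fibre_map F2 v = map_prod R R (fibre_map F1 v)"
    "\<And>v. Dshadow F2 v = map_prod R R (Dshadow F1 v)"
    using rotation_at_point[OF F inv] by blast
  have "vec_coord (F2 u) = map_prod R R (vec_coord (F1 u)) \<and>
     differential (total B) (shadow B F2) u = map_prod R R (differential (total B) (shadow B F1) u)"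
    if u: "u \<in> tangent_space (total B) X" for u
    using R(2,3)[of "snd u c"] vec_at_onto[OF u]
      differential_vec_at[OF F(1), of "snd u c"] differential_vec_at[OF F(2), of "snd u c"]
    unfolding fibre_map_def by metis
  then show ?thesis using R(1) unfolding rotates_def by blast
qed

text \<open>Carries the rigidity in trivialising coordinates back to the bundle. The uniqueness
  clause ensures that any choice of a rotation at each point is constant on
  \<open>W\<close>.\<close>

lemma locally_galilean:
  assumes F: "F1 \<in> Conf r B" "F2 \<in> Conf r B" and inv: "invariants B F1 = invariants B F2"
    and X: "X \<in> pts (total B)"
  shows "\<exists>W R s. openin (mtop (total B)) W \<and> X \<in> W \<and>
    (\<forall>Y\<in>W. shadow B F2 Y = map_prod R R (shadow B F1 Y) + s \<and> (\<forall>R'. rotates F1 F2 Y R' \<longrightarrow> R' = R))"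
proof -
  obtain d where d: "d \<in> base B" "proj B X \<in> fst d" using proj_in[OF X] by (rule pts_chart)
  obtain t where t: "t \<in> trivs B" "proj B X \<in> fst t" using X by (rule trivs_cover)
  have "open (snd d ` (fst t \<inter> fst d))"
    using triv(1)[OF t(1)] d(1) openin_mtop[OF atlas(2)] by blast
  then obtain \<epsilon> where \<epsilon>: "0 < \<epsilon>" "ball (snd d (proj B X)) \<epsilon> \<subseteq> snd d ` (fst t \<inter> fst d)"
    using open_contains_ball d t by (metis IntI imageI)
  \<comment> \<open>A ball, because the coordinate argument integrates a vanishing derivative over a
    convex set.\<close>
  define S where "S = ball (snd d (proj B X)) \<epsilon>"
  have injd: "inj_on (snd d) (fst d)" using atlas(2) d(1) by (simp add: is_atlas_def)
  have Sd: "chart_inv d x \<in> fst t \<and> chart_inv d x \<in> fst d \<and> snd d (chart_inv d x) = x" if x: "x \<in> S" for x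
  proof -
    obtain q where "q \<in> fst t" "q \<in> fst d" "x = snd d q" using x \<epsilon>(2) by (auto simp: S_def)
    then show ?thesis using chart_inv_snd[OF injd] by simp
  qed
  define g where "g F = (\<lambda>(x, y). shadow B F (triv_section B t (chart_inv d x, y)))"
    for F :: "('p, 'a) tvec \<Rightarrow> (E_tot, E_tot) tvec"
  define D where "D F z = frechet_derivative (g F) (at z)" for F z
  have at: "(g F1 has_derivative D F1 (x, y)) (at (x, y)) \<and>
      (g F2 has_derivative D F2 (x, y)) (at (x, y)) \<and>
      (\<forall>R. rotates F1 F2 (triv_section B t (chart_inv d x, y)) R \<longrightarrow>
        (\<forall>w. D F2 (x, y) w = map_prod R R (D F1 (x, y) w)))"
    if x: "x \<in> S" for x y
  proof -
    define Y where "Y = triv_section B t (chart_inv d x, y)"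
    have Y: "Y \<in> pts (total B)" "proj B Y = chart_inv d x" "snd t Y = y"
      using triv_section[OF t(1)] Sd[OF x] by (auto simp: Y_def)
    \<comment> \<open>The chart \<open>c\<close> changes with \<open>(x, y)\<close>, but
      \<open>g\<close> and its derivative do not involve it, so the local picture can be set up
      afresh at each point.\<close>
    obtain c where c: "c \<in> total B" "Y \<in> fst c" using Y(1) by (rule pts_chart)
    interpret bundle_point r B Y c d t
      by unfold_locales (use c d(1) t(1) Sd[OF x] Y(2) in auto)
    have der: "(g F has_derivative Dshadow F \<circ> triv_section_deriv B t d c (x, y)) (at (x, y))"
      if F: "F \<in> Conf r B" for F
      using shadow_section_has_derivative[OF F] Sd[OF x] Y by (simp add: g_def)
    note D_eq = frechet_derivative_eq[OF der, folded D_def]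
    have "\<forall>w. D F2 (x, y) w = map_prod R R (D F1 (x, y) w)" if R: "rotates F1 F2 Y R" for R
    proof
      fix w
      let ?v = "triv_section_deriv B t d c (x, y) w"
      have "differential (total B) (shadow B F2) (vec_at ?v) =
          map_prod R R (differential (total B) (shadow B F1) (vec_at ?v))"
        using R vec_at unfolding rotates_def by blast
      then show "D F2 (x, y) w = map_prod R R (D F1 (x, y) w)"
        by (simp add: D_eq[OF F(1)] D_eq[OF F(2)] differential_vec_at[OF F(1)] differential_vec_at[OF F(2)])
    qed
    then show ?thesis using der D_eq F by (simp add: Y_def)
  qed
  have "\<exists>R s. \<forall>x\<in>S. \<forall>y. g F2 (x, y) = map_prod R R (g F1 (x, y)) + s \<and>
    (\<forall>R'. (\<forall>w. D F2 (x, y) w = map_prod R' R' (D F1 (x, y) w)) \<longrightarrow> R' = R)"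
  proof (rule rigid_of_rigid_derivative[where ?x0.0 = "snd d (proj B X)"])
    fix x assume x: "x \<in> S"
    show "\<exists>R. orthogonal_transformation R \<and> (\<forall>w. D F2 (x, y) w = map_prod R R (D F1 (x, y) w))" for y
      using rotates_exists[OF F inv, of "triv_section B t (chart_inv d x, y)"]
        at[OF x, of y] triv_section(1)[OF t(1)] Sd[OF x] unfolding rotates_def by blast
    show "affine_fun (\<lambda>y. snd (g F1 (x, y)))" "affine_fun (\<lambda>y. snd (g F2 (x, y)))"
      "inj (\<lambda>y. snd (g F1 (x, y)))"
      using Conf_triv_fibre[OF F(1) t(1), of "chart_inv d x"] Conf_triv_fibre[OF F(2) t(1), of "chart_inv d x"]
        Sd[OF x] by (simp_all add: g_def)
  qed (use at \<epsilon> rank in \<open>simp_all add: S_def\<close>)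
  then obtain R s where Rs: "\<And>x y. x \<in> S \<Longrightarrow> g F2 (x, y) = map_prod R R (g F1 (x, y)) + s"
    "\<And>x y R'. x \<in> S \<Longrightarrow> (\<forall>w. D F2 (x, y) w = map_prod R' R' (D F1 (x, y) w)) \<Longrightarrow> R' = R"
    by blast
  define U where "U = fst t \<inter> {q \<in> fst d. snd d q \<in> S}"
  define W where "W = {Y \<in> topspace (mtop (total B)). proj B Y \<in> U}"
  have "openin (mtop (base B)) U"
    unfolding U_def
    by (rule openin_Int[OF triv(1)[OF t(1)] openin_mtop_chart[OF atlas(2) d(1)]]) (simp add: S_def)
  moreover have "continuous_map (mtop (total B)) (mtop (base B)) (proj B)"
    using proj_smooth by (simp add: smooth_map_def)
  ultimately have "openin (mtop (total B)) W"
    unfolding W_def by (rule openin_continuous_map_preimage[rotated])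
  moreover have "X \<in> W"
    using X d t \<epsilon>(1) by (simp add: W_def U_def S_def topspace_mtop[OF atlas(1)])
  moreover have "shadow B F2 Y = map_prod R R (shadow B F1 Y) + s \<and> (\<forall>R'. rotates F1 F2 Y R' \<longrightarrow> R' = R)"
    if "Y \<in> W" for Y
  proof -
    have Y: "Y \<in> pts (total B)" "proj B Y \<in> fst t" "proj B Y \<in> fst d" "snd d (proj B Y) \<in> S"
      using that by (auto simp: W_def U_def topspace_mtop[OF atlas(1)])
    have "triv_section B t (chart_inv d (snd d (proj B Y)), snd t Y) = Y"
      using triv_section_proj[OF t(1) Y(1,2)] chart_inv_snd[OF injd Y(3)] by simp
    then show ?thesis
      using Rs(1)[OF Y(4), of "snd t Y"] Rs(2)[OF Y(4), of "snd t Y"] at[OF Y(4), of "snd t Y"]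
      by (simp add: g_def)
  qed
  ultimately show ?thesis by blast
qed

lemma galilean_of_equal_invariants:
  assumes F: "F1 \<in> Conf r B" "F2 \<in> Conf r B" and inv: "invariants B F1 = invariants B F2"
  shows "\<exists>Q\<in>TGGal r. F2 = compose (tangent_pts (total B)) Q F1"
proof -
  have conn: "connected_space (mtop (total B))" using B by (simp add: affine_bundle_def)
  define \<rho> where "\<rho> X = (SOME R. rotates F1 F2 X R)" for X
  \<comment> \<open>Rotation and translation are paired so that connectedness is applied once. The
    choice made in \<open>\<rho>\<close> is harmless: \<open>locally_galilean\<close> leaves a
    single candidate.\<close>
  define f where "f X = (\<rho> X, shadow B F2 X - map_prod (\<rho> X) (\<rho> X) (shadow B F1 X))" for X
  have \<rho>: "rotates F1 F2 X (\<rho> X)" if "X \<in> pts (total B)" for X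
    unfolding \<rho>_def by (rule someI_ex[OF rotates_exists[OF F inv that]])
  have f: "f X = f Y" if "X \<in> pts (total B)" "Y \<in> pts (total B)" for X Y
  proof (rule connected_space_locally_constant[OF conn])
    show "X \<in> topspace (mtop (total B))" "Y \<in> topspace (mtop (total B))"
      using that by (simp_all add: topspace_mtop[OF atlas(1)])
    fix Z assume "Z \<in> topspace (mtop (total B))"
    then obtain W R s where W: "openin (mtop (total B)) W" "Z \<in> W"
      and WR: "\<And>Y. Y \<in> W \<Longrightarrow> shadow B F2 Y = map_prod R R (shadow B F1 Y) + s"
        "\<And>Y R'. Y \<in> W \<Longrightarrow> rotates F1 F2 Y R' \<Longrightarrow> R' = R"
      using locally_galilean[OF F inv, of Z] by (auto simp: topspace_mtop[OF atlas(1)])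
    have "f Y = (R, s)" if "Y \<in> W" for Y
    proof -
      have "Y \<in> pts (total B)"
        using openin_subset[OF W(1)] that by (auto simp: topspace_mtop[OF atlas(1)])
      then have "\<rho> Y = R" using WR(2)[OF that \<rho>] by blast
      then show ?thesis using WR(1)[OF that] by (simp add: f_def)
    qed
    then show "\<exists>W. openin (mtop (total B)) W \<and> Z \<in> W \<and> (\<forall>Y\<in>W. f Y = f Z)"
      using W by metis
  qed
  obtain R s where R: "orthogonal_transformation R"
    and RX: "\<And>X. X \<in> pts (total B) \<Longrightarrow> f X = (R, s) \<and> rotates F1 F2 X R"
  proof (cases "pts (total B) = {}")
    \<comment> \<open>Over an empty bundle the condition on \<open>R\<close> and \<open>s\<close> is
      vacuous; the identity serves as the orthogonal map.\<close>
    case True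
    then show ?thesis using that[OF orthogonal_transformation_id[unfolded id_def]] by auto
  next
    case False
    then obtain X where X: "X \<in> pts (total B)" by blast
    show ?thesis
    proof (rule that[of "fst (f X)" "snd (f X)"])
      show "orthogonal_transformation (fst (f X))" using \<rho>[OF X] by (simp add: f_def rotates_def)
      show "f Y = (fst (f X), snd (f X)) \<and> rotates F1 F2 Y (fst (f X))" if "Y \<in> pts (total B)" for Y
        using f[OF that X] \<rho>[OF that] by (auto simp: f_def)
    qed
  qed
  have lin: "linear R" using R by (simp add: orthogonal_transformation)
  let ?Q = "tangent_map vec_manifold vec_manifold (galilean R s)"
  have "F2 = compose (tangent_pts (total B)) ?Q F1"
  proof (rule extensionalityI[OF Conf_ext[OF F(2)] compose_extensional])
    fix u assume u: "u \<in> tangent_pts (total B)"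
    define X where "X = fst u"
    have X: "X \<in> pts (total B)" "u \<in> tangent_space (total B) X"
      using u by (auto simp: X_def elim: tangent_ptsE)
    have "shadow B F2 X = galilean R s (shadow B F1 X)"
      using RX[OF X(1)] by (auto simp: f_def galilean_def)
    moreover have "vec_coord (F2 u) = map_prod R R (vec_coord (F1 u))"
      using RX[OF X(1)] X(2) unfolding rotates_def by blast
    ultimately have "F2 u = ?Q (vec_tvec (shadow B F1 X) (vec_coord (F1 u)))"
      using Conf_eq[OF F(2) X] tangent_map_galilean[OF lin] by metis
    then show "F2 u = compose (tangent_pts (total B)) ?Q F1 u"
      using u Conf_eq[OF F(1) X] by (simp add: compose_def)
  qed
  then show ?thesis using galilean_in_TGGal[OF R] by blast
qed

end

section \<open>Galilean equivalence implies equal invariants\<close>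

text \<open>Used for both \<open>\<E>\<close> and \<open>T\<E>\<close>, whose atlases consist of one global chart \<open>e\<close> each.\<close>

locale affine_chart_map =
  fixes e :: "('q, 'b::euclidean_space) chart" and \<theta> :: "'q \<Rightarrow> 'q" and K :: "'b \<Rightarrow> 'b" and t :: 'b
  assumes e: "bij_betw (snd e) (fst e) UNIV"
    and K: "linear K" "inj K"
    and \<theta>: "\<And>q. q \<in> fst e \<Longrightarrow> \<theta> q \<in> fst e" "\<And>q. q \<in> fst e \<Longrightarrow> snd e (\<theta> q) = K (snd e q) + t"
begin

lemma openin_mtop_e: "openin (mtop {e}) W \<longleftrightarrow> W \<subseteq> fst e \<and> open (snd e ` W)"
proof -
  have "openin (mtop {e}) W \<longleftrightarrow> W \<subseteq> pts {e} \<and> (\<forall>c\<in>{e}. open (snd c ` (W \<inter> fst c)))"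
    by (rule openin_mtop_iff) (use e in \<open>auto simp: bij_betw_def\<close>)
  then show ?thesis by (auto simp: pts_def Int_absorb2)
qed

lemma topspace_mtop_e: "topspace (mtop {e}) = fst e"
proof -
  have "openin (mtop {e}) (fst e)" using e by (simp add: openin_mtop_e bij_betw_def)
  then show ?thesis using openin_mtop_e[of "topspace (mtop {e})"] openin_subset by blast
qed

lemma surj_K: "surj K"
  by (rule linear_injective_imp_surjective[OF K refl])

lemma coord_image:
  assumes "W \<subseteq> fst e" shows "snd e ` (\<theta> ` W) = (\<lambda>x. t + x) ` K ` snd e ` W"
proof -
  have "snd e (\<theta> q) = t + K (snd e q)" if "q \<in> W" for q
    using \<theta>(2)[of q] that assms by (simp add: subset_iff add.commute)
  then show ?thesis by (simp add: image_image cong: image_cong)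
qed

text \<open>In the chart \<open>e\<close> the map is an invertible affine map: its openness is that
  of the linear surjection \<open>K\<close>, which is onto by injectivity and dimension.\<close>

lemma homeomorphic_map_e: "homeomorphic_map (mtop {e}) (mtop {e}) \<theta>"
proof (rule bijective_open_imp_homeomorphic_map)
  show "continuous_map (mtop {e}) (mtop {e}) \<theta>"
    unfolding continuous_map_def topspace_mtop_e
  proof (intro conjI allI impI funcsetI)
    fix W assume "openin (mtop {e}) W"
    then have W: "W \<subseteq> fst e" "open (snd e ` W)" by (simp_all add: openin_mtop_e)
    have "snd e ` {q \<in> fst e. \<theta> q \<in> W} = (\<lambda>x. K x + t) -` (snd e ` W)"
    proof (intro set_eqI iffI)
      fix x assume "x \<in> (\<lambda>x. K x + t) -` (snd e ` W)"
      then obtain w where w: "w \<in> W" "K x + t = snd e w" by auto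
      obtain q where q: "q \<in> fst e" "x = snd e q" using e by (auto simp: bij_betw_def)
      have "\<theta> q = w"
        using e inj_onD[of "snd e" "fst e" "\<theta> q" w] \<theta>[OF q(1)] q w W(1) by (auto simp: bij_betw_def)
      then show "x \<in> snd e ` {q \<in> fst e. \<theta> q \<in> W}" using q w by blast
    next
      fix x assume "x \<in> snd e ` {q \<in> fst e. \<theta> q \<in> W}"
      then obtain q where "q \<in> fst e" "\<theta> q \<in> W" "x = snd e q" by blast
      then show "x \<in> (\<lambda>x. K x + t) -` (snd e ` W)" using \<theta>(2)[of q] by (metis imageI vimageI)
    qed
    moreover have "continuous_on UNIV (\<lambda>x. K x + t)"
      using K(1) by (intro continuous_intros linear_continuous_on) (simp add: linear_conv_bounded_linear)
    then have "open ((\<lambda>x. K x + t) -` (snd e ` W))" using W(2) by (rule open_vimage[rotated])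
    ultimately show "openin (mtop {e}) {q \<in> fst e. \<theta> q \<in> W}" by (simp add: openin_mtop_e)
  qed (use \<theta> in auto)
  show "open_map (mtop {e}) (mtop {e}) \<theta>"
    unfolding open_map_def
  proof (intro allI impI)
    fix W assume "openin (mtop {e}) W"
    then have W: "W \<subseteq> fst e" "open (snd e ` W)" by (simp_all add: openin_mtop_e)
    have "open ((\<lambda>x. t + x) ` K ` snd e ` W)"
      by (rule open_translation[OF open_surjective_linear_image[OF W(2) K(1) surj_K]])
    then show "openin (mtop {e}) (\<theta> ` W)"
      using coord_image[OF W(1)] W(1) \<theta>(1) by (auto simp: openin_mtop_e)
  qed
  have "snd e ` (\<theta> ` fst e) = UNIV"
    unfolding coord_image[OF subset_refl] using e surj_K by (simp add: bij_betw_def surj_plus)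
  show "\<theta> ` topspace (mtop {e}) = topspace (mtop {e})"
    unfolding topspace_mtop_e
  proof (intro equalityI subsetI)
    fix q assume q: "q \<in> fst e"
    obtain w where "w \<in> fst e" "snd e q = snd e (\<theta> w)"
      using \<open>snd e ` (\<theta> ` fst e) = UNIV\<close> by (metis UNIV_I imageE)
    then show "q \<in> \<theta> ` fst e" using e q \<theta>(1) inj_onD[of "snd e" "fst e" q "\<theta> w"] by (auto simp: bij_betw_def)
  qed (use \<theta>(1) in auto)
  show "inj_on \<theta> (topspace (mtop {e}))"
    unfolding topspace_mtop_e
  proof (rule inj_onI)
    fix q w assume q: "q \<in> fst e" and w: "w \<in> fst e" and "\<theta> q = \<theta> w"
    then have "K (snd e q) = K (snd e w)" using \<theta>(2)[OF q] \<theta>(2)[OF w] by simp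
    then have "snd e q = snd e w" using K(2) by (rule injD[rotated])
    then show "q = w" using e q w by (auto simp: bij_betw_def dest: inj_onD)
  qed
qed

section \<open>Composition of smooth maps and embeddings with an invertible affine map\<close>

context
  fixes M :: "('p, 'a::euclidean_space) atlas" and k :: enat and h h' :: "'p \<Rightarrow> 'q"
  assumes M: "\<And>c. c \<in> M \<Longrightarrow> inj_on (snd c) (fst c)"
    and h': "\<And>p. p \<in> pts M \<Longrightarrow> h' p = \<theta> (h p)"
    and smooth: "smooth_map k M {e} h"
begin

lemma h_in: "p \<in> pts M \<Longrightarrow> h p \<in> fst e"
  using smooth_map_in[OF smooth] by (simp add: pts_def)

lemma chart_comp:
  assumes c: "c \<in> M" "p \<in> fst c"
  shows "(snd e \<circ> h' \<circ> chart_inv c) (snd c p) = K ((snd e \<circ> h \<circ> chart_inv c) (snd c p)) + t"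
  using chart_inv_snd[OF M[OF c(1)] c(2)] h'[OF pts_chartI[OF c]] \<theta>(2)[OF h_in[OF pts_chartI[OF c]]]
  by simp

lemma smooth_map_chart:
  assumes c: "c \<in> M"
  shows "Ck_on k (snd c ` fst c) (snd e \<circ> h \<circ> chart_inv c)"
proof -
  have "{p \<in> fst c. h p \<in> fst e} = fst c" using h_in pts_chartI[OF c] by blast
  then show ?thesis using smooth_map_Ck[OF smooth c, of e] by simp
qed

text \<open>\<open>h'\<close> is tied to \<open>\<theta> \<circ> h\<close> on the points of
  \<open>M\<close> and not everywhere, because maps such as \<open>\<phi>'\<close> and
  \<open>F'\<close>, to which this is applied, are extensional.\<close>

lemma smooth_map_comp: "smooth_map k M {e} h'"
  unfolding smooth_map_def
proof (intro conjI ballI)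
  show "h' \<in> pts M \<rightarrow> pts {e}" using h' h_in \<theta>(1) by (auto simp: pts_def)
  have sub: "topspace (mtop M) \<subseteq> pts M" by (rule topspace_mtop_subset) (rule M)
  have "continuous_map (mtop M) (mtop {e}) (\<theta> \<circ> h)"
    using smooth homeomorphic_imp_continuous_map[OF homeomorphic_map_e]
    by (auto simp: smooth_map_def intro: continuous_map_compose)
  then show "continuous_map (mtop M) (mtop {e}) h'"
    by (rule continuous_map_eq) (use sub h' in auto)
  fix c d assume c: "c \<in> M" and "d \<in> {e}"
  then have d: "d = e" by simp
  have S: "{p \<in> fst c. h' p \<in> fst d} = fst c"
    using h_in h' \<theta>(1) pts_chartI[OF c] by (auto simp: d)
  show "Ck_on k (snd c ` {p \<in> fst c. h' p \<in> fst d}) (snd d \<circ> h' \<circ> chart_inv c)"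
    unfolding S unfolding d
    by (rule Ck_on_cong[OF Ck_on_affine_comp[OF K(1) smooth_map_chart[OF c], of t]])
      (use chart_comp[OF c] in auto)
qed

lemma tangent_map_comp_inj:
  assumes k: "1 \<le> k" and p: "p \<in> pts M"
    and inj: "inj_on (tangent_map M {e} h) (tangent_space M p)"
  shows "inj_on (tangent_map M {e} h') (tangent_space M p)"
proof (rule inj_onI)
  fix u w assume u: "u \<in> tangent_space M p" and w: "w \<in> tangent_space M p"
    and eq: "tangent_map M {e} h' u = tangent_map M {e} h' w"
  have fst_eq: "fst u = p" "fst w = p" by (rule fst_tangent_space[OF u] fst_tangent_space[OF w])+
  have pt: "u \<in> tangent_pts M" "w \<in> tangent_pts M" by (rule tangent_ptsI[OF p u] tangent_ptsI[OF p w])+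
  have he: "h p \<in> fst e" "h' p \<in> fst e" using h_in[OF p] h'[OF p] \<theta>(1) by auto
  have diff: "differential M (snd e \<circ> h') v = K (differential M (snd e \<circ> h) v)" if "fst v = p" for v
  proof -
    \<comment> \<open>\<open>M\<close> may be a tangent atlas, for which \<open>is_atlas\<close> is
      not at hand, so chart independence of \<open>differential\<close> cannot be invoked. The
      computation uses the very chart that \<open>differential\<close> selects.\<close>
    define c where "c = (SOME c. c \<in> M \<and> p \<in> fst c)"
    obtain c' where "c' \<in> M" "p \<in> fst c'" using p by (rule pts_chart)
    then have c: "c \<in> M" "p \<in> fst c"
      using someI[of "\<lambda>c. c \<in> M \<and> p \<in> fst c" c'] by (auto simp: c_def)
    note Ck = smooth_map_chart[OF c(1)]
    have x: "snd c p \<in> snd c ` fst c" using c by blast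
    have "frechet_derivative (snd e \<circ> h' \<circ> chart_inv c) (at (snd c p)) =
        frechet_derivative (\<lambda>x. K ((snd e \<circ> h \<circ> chart_inv c) x) + t) (at (snd c p))"
      by (rule frechet_derivative_cong_open[OF Ck_on_open[OF Ck] x]) (use chart_comp[OF c(1)] in auto)
    also have "\<dots> = (\<lambda>v. K (frechet_derivative (snd e \<circ> h \<circ> chart_inv c) (at (snd c p)) v))"
      by (rule frechet_derivative_eq[OF frechet_derivative_affine_comp[OF K(1) Ck_on_differentiable[OF Ck k x]]])
    finally show ?thesis unfolding differential_def that Let_def c_def[symmetric] by simp
  qed
  have "snd (tangent_map M {e} h' u) e = snd (tangent_map M {e} h' w) e" using eq by simp
  then have "differential M (snd e \<circ> h') u = differential M (snd e \<circ> h') w"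
    using pt he fst_eq by (simp add: tangent_map_def)
  then have "differential M (snd e \<circ> h) u = differential M (snd e \<circ> h) w"
    using diff[OF fst_eq(1)] diff[OF fst_eq(2)] injD[OF K(2)] by metis
  then have "tangent_map M {e} h u = tangent_map M {e} h w"
    using pt fst_eq by (auto simp: tangent_map_def fun_eq_iff)
  then show "u = w" using inj_onD[OF inj _ u w] by blast
qed

lemma smooth_embedding_comp:
  assumes k: "1 \<le> k" and emb: "smooth_embedding k M {e} h"
  shows "smooth_embedding k M {e} h'"
  unfolding smooth_embedding_def
proof (intro conjI ballI)
  show "smooth_map k M {e} h'" by (rule smooth_map_comp)
  show "inj_on (tangent_map M {e} h') (tangent_space M p)" if "p \<in> pts M" for p
    by (rule tangent_map_comp_inj[OF k that]) (use emb that in \<open>simp add: smooth_embedding_def\<close>)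
  have sub: "topspace (mtop M) \<subseteq> pts M" by (rule topspace_mtop_subset) (rule M)
  have "embedding_map (mtop {e}) (mtop {e}) \<theta>"
    using homeomorphic_map_e surjective_embedding_map by blast
  then have "embedding_map (mtop M) (mtop {e}) (\<theta> \<circ> h)"
    using emb by (auto simp: smooth_embedding_def intro: embedding_map_compose)
  then show "embedding_map (mtop M) (mtop {e}) h'"
    by (rule embedding_map_eq) (use sub h' in auto)
qed

end

end

lemma affine_fun_comp:
  assumes "affine_fun h" "linear K"
  shows "affine_fun (\<lambda>y. K (h y) + c)"
proof -
  obtain A a where A: "linear A" "\<And>y. h y = A y + a" using assms(1) by (auto simp: affine_fun_def)
  have "linear (\<lambda>y. K (A y))" using linear_compose[OF A(1) assms(2)] by (simp add: comp_def)
  moreover have "K (h y) + c = K (A y) + (K a + c)" for y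
    by (simp add: A(2) linear_add[OF assms(2)])
  ultimately show ?thesis unfolding affine_fun_def by blast
qed

section \<open>The action of one Galilean map on one configuration\<close>

locale galilean_action = material_bundle r B
  for r :: enat
    and B :: "('p, 'a::euclidean_space, 'q, 'm::euclidean_space, 'f::euclidean_space) bundle_data" +
  fixes R :: "R3 \<Rightarrow> R3" and s :: E_tot and F :: "('p, 'a) tvec \<Rightarrow> (E_tot, E_tot) tvec"
  assumes R: "orthogonal_transformation R" and F: "F \<in> Conf r B"
begin

definition "Q = tangent_map vec_manifold vec_manifold (galilean R s)"
definition "F' = compose (tangent_pts (total B)) Q F"
definition "\<phi> = shadow B F"
text \<open>The expected shadow of \<open>F'\<close>, composed extensionally because
  \<open>Aff_maps\<close> consists of extensional maps. That it is the shadow is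
  \<open>shadow_F'\<close>.\<close>

definition "\<phi>' = compose (pts (total B)) (galilean R s) \<phi>"
definition "b = base_map B EE \<phi>"
definition "b' = base_map B EE \<phi>'"

lemma linR: "linear R"
  using R by (simp add: orthogonal_transformation)

lemma linRR: "linear (map_prod R R)"
  by (rule linear_map_prod[OF linR])

lemma injR: "inj R"
  by (rule orthogonal_transformation_inj[OF R])

lemma Q_vec_tvec: "Q (vec_tvec z w) = vec_tvec (galilean R s z) (map_prod R R w)"
  unfolding Q_def by (rule tangent_map_galilean[OF linR])

lemma RR_eq_iff: "map_prod R R w = map_prod R R w' \<longleftrightarrow> w = w'"
  by (cases w; cases w') (simp add: inj_eq[OF injR])

lemma injRR: "inj (map_prod R R)"
  by (simp add: inj_def RR_eq_iff)

lemma galilean_eq_iff: "galilean R s z = galilean R s z' \<longleftrightarrow> z = z'"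
  by (simp add: galilean_def RR_eq_iff)

lemma Q_inj: "Q (vec_tvec z w) = Q (vec_tvec z' w') \<longleftrightarrow> vec_tvec z w = vec_tvec z' w'"
  by (simp add: Q_vec_tvec galilean_eq_iff RR_eq_iff)

lemma \<phi>_Aff: "\<phi> \<in> Aff_maps r B EE"
  unfolding \<phi>_def by (rule Conf_Aff[OF F])

lemma F_eq: "X \<in> pts (total B) \<Longrightarrow> u \<in> tangent_space (total B) X \<Longrightarrow>
    F u = vec_tvec (\<phi> X) (vec_coord (F u))"
  unfolding \<phi>_def by (rule Conf_eq[OF F])

lemma \<phi>'_eq: "X \<in> pts (total B) \<Longrightarrow> \<phi>' X = galilean R s (\<phi> X)"
  by (simp add: \<phi>'_def compose_def)

lemma F'_Q: "u \<in> tangent_pts (total B) \<Longrightarrow> F' u = Q (F u)"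
  by (simp add: F'_def compose_def)

lemma F'_eq:
  assumes "X \<in> pts (total B)" "u \<in> tangent_space (total B) X"
  shows "F' u = vec_tvec (\<phi>' X) (map_prod R R (vec_coord (F u)))"
  using F'_Q[OF tangent_ptsI[OF assms]] F_eq[OF assms] Q_vec_tvec \<phi>'_eq[OF assms(1)] by metis

lemma charts_inj: "c \<in> total B \<Longrightarrow> inj_on (snd c) (fst c)"
  using atlas(1) by (simp add: is_atlas_def)

lemma chart_map_E: "affine_chart_map (UNIV, id) (galilean R s) (map_prod R R) s"
  by (rule affine_chart_map.intro) (simp_all add: linRR injRR galilean_def)

lemma chart_map_base: "affine_chart_map (UNIV, id) (\<lambda>x. R x + fst s) R (fst s)"
  by (rule affine_chart_map.intro) (simp_all add: linR injR)

definition tangent_chart :: "((E_tot, E_tot) tvec, E_tot \<times> E_tot) chart" where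
  "tangent_chart = (tangent_pts vec_manifold, \<lambda>u. (fst u, vec_coord u))"

lemma tangent_atlas_vec: "tangent_atlas vec_manifold = {tangent_chart}"
  by (simp add: tangent_atlas_def tangent_chart_def vec_manifold_def vec_coord_def)

text \<open>The derivative of a Galilean map is constant, so its tangent map is affine in base point
  and vector jointly. Translation moves base points but not vectors, hence the constant
  \<open>(s, 0)\<close>.\<close>

lemma chart_map_TE: "affine_chart_map tangent_chart Q (map_prod (map_prod R R) (map_prod R R)) (s, 0)"
proof (rule affine_chart_map.intro)
  show "bij_betw (snd tangent_chart) (fst tangent_chart) UNIV"
  proof (rule bij_betw_byWitness[where f' = "\<lambda>(z, w). vec_tvec z w"])
    show "\<forall>u\<in>fst tangent_chart. (\<lambda>(z, w). vec_tvec z w) (snd tangent_chart u) = u"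
      by (auto simp: tangent_chart_def elim: tangent_pts_vec_manifoldE)
  qed (auto simp: tangent_chart_def)
  show "Q q \<in> fst tangent_chart" if "q \<in> fst tangent_chart" for q
  proof -
    have "q \<in> tangent_pts vec_manifold" using that by (simp add: tangent_chart_def)
    then obtain z w where "q = vec_tvec z w" by (rule tangent_pts_vec_manifoldE)
    then show ?thesis by (simp add: Q_vec_tvec tangent_chart_def)
  qed
  show "snd tangent_chart (Q q) = map_prod (map_prod R R) (map_prod R R) (snd tangent_chart q) + (s, 0)"
    if "q \<in> fst tangent_chart" for q
  proof -
    have "q \<in> tangent_pts vec_manifold" using that by (simp add: tangent_chart_def)
    then obtain z w where "q = vec_tvec z w" by (rule tangent_pts_vec_manifoldE)
    then show ?thesis by (simp add: Q_vec_tvec tangent_chart_def galilean_def)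
  qed
qed (rule linear_map_prod[OF linRR] prod.inj_map[OF injRR injRR])+

lemma vec_singleton: "(vec_manifold :: ('v, 'v) atlas) = {(UNIV, id)}"
  by (simp add: vec_manifold_def)

lemma \<phi>'_Aff: "\<phi>' \<in> Aff_maps r B EE"
proof -
  obtain lb where lb: "smooth_map (r + 1) (base B) vec_manifold lb"
    "\<And>a. a \<in> pts (total B) \<Longrightarrow> fst (\<phi> a) = lb (proj B a)"
    by (rule Aff_base_map[OF \<phi>_Aff]) blast
  have lb': "smooth_map (r + 1) (base B) vec_manifold (\<lambda>x. R (lb x) + fst s)"
    unfolding vec_singleton
    by (rule affine_chart_map.smooth_map_comp[OF chart_map_base])
      (use atlas(2) lb(1) in \<open>auto simp: is_atlas_def vec_singleton\<close>)
  have \<phi>': "smooth_map (r + 1) (total B) vec_manifold \<phi>'"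
    unfolding vec_singleton
    by (rule affine_chart_map.smooth_map_comp[OF chart_map_E charts_inj \<phi>'_eq])
      (use Aff_smooth[OF \<phi>_Aff] in \<open>auto simp: vec_singleton\<close>)
  have proj: "fst (\<phi>' a) = R (lb (proj B a)) + fst s" if "a \<in> pts (total B)" for a
    using \<phi>'_eq[OF that] lb(2)[OF that] by (simp add: galilean_def)
  have fib: "\<exists>h. affine_fun h \<and> (\<forall>a\<in>fibre B x. snd (\<phi>' a) = h (snd t a))"
    if t: "t \<in> trivs B" "x \<in> fst t" for t x
  proof -
    obtain h where h: "affine_fun h" "\<forall>a\<in>fibre B x. snd (\<phi> a) = h (snd t a)"
      using Aff_fibre[OF \<phi>_Aff t] by blast
    have "affine_fun (\<lambda>y. R (h y) + snd s)" by (rule affine_fun_comp[OF h(1) linR])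
    moreover have "snd (\<phi>' a) = R (h (snd t a)) + snd s" if "a \<in> fibre B x" for a
      using h(2) that \<phi>'_eq[of a] by (simp add: fibre_def galilean_def)
    ultimately show ?thesis by blast
  qed
  show ?thesis
    unfolding Aff_maps_def mem_Collect_eq EE_simps
  proof (intro conjI exI[of _ "\<lambda>x. R (lb x) + fst s"])
    show "\<phi>' \<in> extensional (pts (total B))" by (simp add: \<phi>'_def)
    show "\<forall>(U, \<psi>)\<in>trivs B. \<forall>(U', \<psi>')\<in>{(UNIV, snd)}. \<forall>x\<in>U. R (lb x) + fst s \<in> U' \<longrightarrow>
        (\<exists>h. affine_fun h \<and> (\<forall>a\<in>fibre B x. \<psi>' (\<phi>' a) = h (\<psi> a)))"
      using fib by fastforce
  qed (use \<phi>' lb' proj in auto)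
qed

lemma differential_\<phi>':
  assumes X: "X \<in> pts (total B)" and u: "u \<in> tangent_space (total B) X"
  shows "differential (total B) \<phi>' u = map_prod R R (differential (total B) \<phi> u)"
proof -
  obtain c where c: "c \<in> total B" "X \<in> fst c" using X by (rule pts_chart)
  have "differential (total B) \<phi>' u = differential (total B) (\<lambda>q. map_prod R R (\<phi> q) + s) u"
    by (rule differential_cong[OF atlas(1)])
      (use X fst_tangent_space[OF u] \<phi>'_eq in \<open>auto simp: galilean_def\<close>)
  also have "\<dots> = map_prod R R (differential (total B) \<phi> u)"
    by (rule differential_affine_comp[OF atlas(1) r1 c u linRR Aff_differentiable[OF \<phi>_Aff c]])
  finally show ?thesis .
qed

lemma b'_eq: "q \<in> pts (base B) \<Longrightarrow> b' q = R (b q) + fst s"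
  using proj_onto[of q] fst_Aff[OF \<phi>_Aff] fst_Aff[OF \<phi>'_Aff] \<phi>'_eq
  by (force simp: b_def b'_def galilean_def)

lemma differential_b':
  assumes q: "q \<in> pts (base B)" and w: "w \<in> tangent_space (base B) q"
  shows "differential (base B) b' w = R (differential (base B) b w)"
proof -
  obtain c where c: "c \<in> base B" "q \<in> fst c" using q by (rule pts_chart)
  have "differential (base B) b' w = differential (base B) (\<lambda>q. R (b q) + fst s) w"
    by (rule differential_cong[OF atlas(2)]) (use q fst_tangent_space[OF w] b'_eq in auto)
  also have "\<dots> = R (differential (base B) b w)"
    unfolding b_def
    by (rule differential_affine_comp[OF atlas(2) r1 c w linR base_map_differentiable[OF \<phi>_Aff c]])
  finally show ?thesis .
qed

lemma Tbase_map_\<phi>':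
  assumes q: "q \<in> pts (base B)" and w: "w \<in> tangent_space (base B) q"
  shows "Tbase_map B EE \<phi>' w = vec_tvec (b' q) (R (differential (base B) b w))"
    and "Tbase_map B EE \<phi> w = vec_tvec (b q) (differential (base B) b w)"
  using Tbase_map_eq[OF \<phi>'_Aff tangent_ptsI[OF q w]] Tbase_map_eq[OF \<phi>_Aff tangent_ptsI[OF q w]]
    fst_tangent_space[OF w] differential_b'[OF q w]
  by (simp_all add: b_def b'_def)

lemma Tproj_EE: "Tproj EE (vec_tvec z w) = vec_tvec (fst z) (fst w)"
proof -
  have "frechet_derivative fst (at z) w = fst w"
    using frechet_derivative_eq[OF bounded_linear_imp_has_derivative[OF bounded_linear_fst]] by metis
  then show ?thesis
    unfolding Tproj_def EE_simps
    using tangent_map_vec_manifold[OF vec_tvec_in_tangent(2), of fst z w]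
    by (simp add: differential_vec_manifold)
qed

lemma smooth_F: "smooth_map r (tangent_atlas (total B)) {tangent_chart} F"
  using F by (simp add: Conf_def smooth_embedding_def tangent_atlas_vec)

lemma pts_tangent_atlas: "pts (tangent_atlas (total B)) \<subseteq> tangent_pts (total B)"
  by (auto simp: pts_def tangent_atlas_def)

lemma F'_Q_atlas: "u \<in> pts (tangent_atlas (total B)) \<Longrightarrow> F' u = Q (F u)"
  by (rule F'_Q[OF subsetD[OF pts_tangent_atlas]])

text \<open>\<open>F'\<close> and the tangent map of \<open>\<phi>'\<close> arise from those of
  \<open>F\<close> and \<open>\<phi>\<close> by the constant linear map \<open>R \<times> R\<close>
  on vectors. So agreement on vertical vectors, compatibility with the base maps and affine
  dependence on the fibre coordinate all carry over.\<close>

lemma pa_F': "pa_over r B EE \<phi>' F'"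
  unfolding pa_over_def EE_simps
proof (intro conjI)
  have pa: "pa_over r B EE \<phi> F" unfolding \<phi>_def by (rule Conf_pa[OF F])
  show "\<phi>' \<in> Aff_maps r B EE" by (rule \<phi>'_Aff)
  show "vb_morphism_over r (total B) vec_manifold \<phi>' F'"
    unfolding vb_morphism_over_def
  proof (intro conjI ballI allI)
    show "F' \<in> extensional (tangent_pts (total B))" by (simp add: F'_def)
    show "smooth_map r (tangent_atlas (total B)) (tangent_atlas vec_manifold) F'"
      unfolding tangent_atlas_vec
      by (rule affine_chart_map.smooth_map_comp[OF chart_map_TE _ F'_Q_atlas smooth_F])
        (rule inj_on_tangent_chart[OF _ atlas(1)])
    fix X u assume X: "X \<in> pts (total B)" and u: "u \<in> tangent_space (total B) X"
    show "F' u \<in> tangent_space vec_manifold (\<phi>' X)" by (simp add: F'_eq[OF X u])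
    fix w x y assume w: "w \<in> tangent_space (total B) X"
    \<comment> \<open>\<open>F'_eq\<close> speaks about vectors of the tangent space, so the
      combination must first be shown to be one.\<close>
    have l: "tlincomb x u y w \<in> tangent_space (total B) X"
    proof -
      obtain c where c: "c \<in> total B" "X \<in> fst c" using X by (rule pts_chart)
      show ?thesis
        using tlincomb_tvec_at[OF atlas(1) r1 c] tangent_space_eq_tvec_at[OF c u]
          tangent_space_eq_tvec_at[OF c w] tvec_at_in_tangent_space[OF atlas(1) r1 c] by metis
    qed
    show "F' (tlincomb x u y w) = tlincomb x (F' u) y (F' w)"
      unfolding F'_eq[OF X u] F'_eq[OF X w] F'_eq[OF X l] Conf_lincomb[OF F X u w]
      by (auto simp: tlincomb_def vec_tvec_def linear_add[OF linRR] linear_scale[OF linRR])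
  qed
  show "\<forall>u\<in>tangent_pts (total B). Tproj EE (F' u) = Tbase_map B EE \<phi>' (Tproj B u)"
  proof
    fix u assume "u \<in> tangent_pts (total B)"
    then obtain X: "fst u \<in> pts (total B)" and u: "u \<in> tangent_space (total B) (fst u)"
      by (rule tangent_ptsE)
    have "fst (vec_coord (F u)) = differential (base B) b (Tproj B u)"
      using Conf_fst[OF F X u] by (simp add: b_def \<phi>_def)
    then show "Tproj EE (F' u) = Tbase_map B EE \<phi>' (Tproj B u)"
      unfolding F'_eq[OF X u] Tproj_EE Tbase_map_\<phi>'(1)[OF proj_in[OF X] Tproj_in[OF X u]]
      using fst_Aff[OF \<phi>'_Aff X] by (simp add: b'_def)
  qed
  show "\<forall>X\<in>pts (total B). \<forall>u\<in>vertical_space B X. F' u = tangent_map (total B) vec_manifold \<phi>' u"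
  proof (intro ballI)
    fix X u assume X: "X \<in> pts (total B)" and v: "u \<in> vertical_space B X"
    then have u: "u \<in> tangent_space (total B) X" by (simp add: vertical_space_def)
    show "F' u = tangent_map (total B) vec_manifold \<phi>' u"
      using tangent_map_vec_manifold[OF tangent_ptsI[OF X u], of \<phi>'] fst_tangent_space[OF u]
        Conf_vertical[OF F X v] differential_\<phi>'[OF X u] F'_eq[OF X u] by (simp add: \<phi>_def)
  qed
  \<comment> \<open>Trivialising coordinates of the ambient bundle are the canonical ones, so the
    affinity condition concerns \<open>vec_coord\<close> itself.\<close>
  have id: "differential vec_manifold (triv_coords EE (UNIV, id) (UNIV, snd)) u = vec_coord u" for u
  proof -
    have "triv_coords EE (UNIV, id) (UNIV, snd) = (\<lambda>z. z)" by (auto simp: triv_coords_def)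
    then show ?thesis by (simp add: differential_vec_manifold frechet_derivative_ident)
  qed
  show "\<forall>c\<in>base B. \<forall>t\<in>trivs B. \<forall>d\<in>vec_manifold. \<forall>t'\<in>{(UNIV, snd)}.
        \<forall>x \<in> fst c \<inter> fst t. base_map B EE \<phi>' x \<in> fst d \<inter> fst t' \<longrightarrow>
        (\<forall>w. \<exists>h. affine_fun h \<and>
           (\<forall>a\<in>fibre B x. \<forall>u\<in>tangent_space (total B) a.
              differential (total B) (triv_coords B c t) u = w \<longrightarrow>
              differential vec_manifold (triv_coords EE d t') (F' u) = h (snd t a)))"
  proof (intro ballI impI allI)
    fix c t x w and d :: "(R3, R3) chart" and t' :: "R3 set \<times> (E_tot \<Rightarrow> R3)"
    assume c: "c \<in> base B" and t: "t \<in> trivs B" and d: "d \<in> vec_manifold"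
      and t': "t' \<in> {(UNIV, snd)}" and x: "x \<in> fst c \<inter> fst t"
    have pa': "\<forall>c\<in>base B. \<forall>t\<in>trivs B. \<forall>d\<in>base EE. \<forall>t'\<in>trivs EE.
        \<forall>x \<in> fst c \<inter> fst t. base_map B EE \<phi> x \<in> fst d \<inter> fst t' \<longrightarrow>
        (\<forall>w. \<exists>h. affine_fun h \<and>
           (\<forall>a\<in>fibre B x. \<forall>u\<in>tangent_space (total B) a.
              differential (total B) (triv_coords B c t) u = w \<longrightarrow>
              differential (total EE) (triv_coords EE d t') (F u) = h (snd t a)))"
      using pa unfolding pa_over_def by blast
    have "\<exists>h. affine_fun h \<and> (\<forall>a\<in>fibre B x. \<forall>u\<in>tangent_space (total B) a.
        differential (total B) (triv_coords B c t) u = w \<longrightarrow> vec_coord (F u) = h (snd t a))"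
      using pa'[rule_format, OF c t, of "(UNIV, id)" "(UNIV, snd)" x w] x by (simp add: id)
    then obtain h where h: "affine_fun h"
      "\<And>a u. a \<in> fibre B x \<Longrightarrow> u \<in> tangent_space (total B) a \<Longrightarrow>
        differential (total B) (triv_coords B c t) u = w \<Longrightarrow> vec_coord (F u) = h (snd t a)"
      by blast
    have dt: "d = (UNIV, id)" "t' = (UNIV, snd)" using d t' by simp_all
    show "\<exists>h. affine_fun h \<and> (\<forall>a\<in>fibre B x. \<forall>u\<in>tangent_space (total B) a.
        differential (total B) (triv_coords B c t) u = w \<longrightarrow>
        differential vec_manifold (triv_coords EE d t') (F' u) = h (snd t a))"
    proof (intro exI[of _ "\<lambda>y. map_prod R R (h y) + 0"] conjI ballI impI)
      show "affine_fun (\<lambda>y. map_prod R R (h y) + 0)" by (rule affine_fun_comp[OF h(1) linRR])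
      fix a u assume a: "a \<in> fibre B x" and u: "u \<in> tangent_space (total B) a"
        and "differential (total B) (triv_coords B c t) u = w"
      from h(2)[OF this] show "differential vec_manifold (triv_coords EE d t') (F' u) =
          map_prod R R (h (snd t a)) + 0"
        unfolding dt id using F'_eq[OF _ u] a by (simp add: fibre_def)
    qed
  qed
qed

lemma shadow_F': "shadow B F' = \<phi>'"
  by (rule pa_over_shadow[OF pa_F'])

lemma F'_Conf: "F' \<in> Conf r B"
  unfolding Conf_def mem_Collect_eq
proof (intro conjI)
  show "F' \<in> L_pa r B EE" using pa_F' by (auto simp: L_pa_def)
  have "smooth_embedding r (tangent_atlas (total B)) {tangent_chart} F"
    using F by (simp add: Conf_def tangent_atlas_vec)
  then show "smooth_embedding r (tangent_atlas (total B)) (tangent_atlas (total EE)) F'"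
    unfolding EE_simps tangent_atlas_vec
    by (intro affine_chart_map.smooth_embedding_comp[OF chart_map_TE _ F'_Q_atlas smooth_F r]
        inj_on_tangent_chart[OF _ atlas(1)])
  have "smooth_embedding (r + 1) (total B) {(UNIV, id)} \<phi>"
    using F by (simp add: Conf_def vec_singleton \<phi>_def)
  moreover have "smooth_map (r + 1) (total B) {(UNIV, id)} \<phi>"
    using Aff_smooth[OF \<phi>_Aff] by (simp add: vec_singleton)
  ultimately show "smooth_embedding (r + 1) (total B) (total EE) (shadow B F')"
    unfolding EE_simps vec_singleton shadow_F'
    by (intro affine_chart_map.smooth_embedding_comp[OF chart_map_E charts_inj \<phi>'_eq _ r1])
qed

text \<open>The connection and the solder form are equivariant under \<open>R\<close> acting on both
  components. A vector therefore solves the equation behind the pull-back under \<open>L'\<close>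
  exactly if it solves the one under \<open>L\<close>, and \<open>inv_into\<close> chooses equally
  from equal predicates.\<close>

lemma pull_back_Q:
  assumes L: "\<And>X u. X \<in> pts (total B) \<Longrightarrow> u \<in> tangent_space (total B) X \<Longrightarrow>
      L u = vec_tvec (\<phi> X) (k u) \<and> L' u = Q (L u)"
    and sh: "shadow B L = \<phi>" "shadow B L' = \<phi>'"
    and \<kappa>: "\<kappa> = connection \<or> \<kappa> = solder"
  shows "pull_back B \<kappa> L' = pull_back B \<kappa> L"
  unfolding pull_back_def sh
proof (intro restrict_ext)
  fix X w assume X: "X \<in> pts (total B)" and w: "w \<in> tangent_space (base B) (proj B X)"
  have R0: "R 0 = 0" by (rule linear_0[OF linR])
  obtain v where v: "\<kappa> (\<phi> X) (Tbase_map B EE \<phi> w) = vec_tvec (\<phi> X) v"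
    "\<kappa> (\<phi>' X) (Tbase_map B EE \<phi>' w) = vec_tvec (\<phi>' X) (map_prod R R v)"
    using \<kappa> Tbase_map_\<phi>'[OF proj_in[OF X] w] by (auto simp: connection_def solder_def R0)
  have "L' u = vec_tvec (\<phi>' X) (map_prod R R v) \<longleftrightarrow> L u = vec_tvec (\<phi> X) v"
    if "u \<in> tangent_space (total B) X" for u
    using L[OF X that] Q_inj[of "\<phi> X" "k u" "\<phi> X" v] Q_vec_tvec[of "\<phi> X" v] \<phi>'_eq[OF X] by metis
  then show "inv_into (tangent_space (total B) X) L' (\<kappa> (\<phi>' X) (Tbase_map B EE \<phi>' w)) =
      inv_into (tangent_space (total B) X) L (\<kappa> (\<phi> X) (Tbase_map B EE \<phi> w))"
    unfolding v inv_into_def by (metis (mono_tags, lifting))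
qed

lemma invariants_F': "invariants B F' = invariants B F"
proof -
  have "pull_back_metric_v B F' = pull_back_metric_v B F"
    unfolding pull_back_metric_v_def
  proof (rule restrict_ext, clarify)
    fix X u w assume X: "X \<in> pts (total B)" and "u \<in> vertical_space B X" "w \<in> vertical_space B X"
    then have u: "u \<in> tangent_space (total B) X" "w \<in> tangent_space (total B) X"
      by (simp_all add: vertical_space_def)
    have "R (fst x) + R (snd x) = R (fst x + snd x)" for x by (simp add: linear_add[OF linR])
    moreover have "R x \<bullet> R y = x \<bullet> y" for x y using R by (simp add: orthogonal_transformation_def)
    ultimately show "pseudo_metric (F' u) (F' w) = pseudo_metric (F u) (F w)"
      by (simp add: F'_eq[OF X u(1)] F'_eq[OF X u(2)] pseudo_metric_def euclid_metric_def iota_def)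
  qed
  moreover have "pull_back B \<kappa> F' = pull_back B \<kappa> F" if "\<kappa> = connection \<or> \<kappa> = solder" for \<kappa>
  proof (rule pull_back_Q[where k = "\<lambda>u. vec_coord (F u)", OF _ _ shadow_F' that])
    show "shadow B F = \<phi>" by (simp add: \<phi>_def)
    show "F u = vec_tvec (\<phi> X) (vec_coord (F u)) \<and> F' u = Q (F u)"
      if "X \<in> pts (total B)" "u \<in> tangent_space (total B) X" for X u
      using F_eq[OF that] F'_Q[OF tangent_ptsI[OF that]] by blast
  qed
  moreover have "pull_back B connection (tangent_map (total B) vec_manifold \<phi>') =
      pull_back B connection (tangent_map (total B) vec_manifold \<phi>)"
  proof (rule pull_back_Q[where k = "differential (total B) \<phi>"])
    fix X u assume X: "X \<in> pts (total B)" and u: "u \<in> tangent_space (total B) X"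
    show "tangent_map (total B) vec_manifold \<phi> u = vec_tvec (\<phi> X) (differential (total B) \<phi> u) \<and>
        tangent_map (total B) vec_manifold \<phi>' u = Q (tangent_map (total B) vec_manifold \<phi> u)"
      using tangent_map_vec_manifold[OF tangent_ptsI[OF X u], of \<phi>]
        tangent_map_vec_manifold[OF tangent_ptsI[OF X u], of \<phi>'] fst_tangent_space[OF u]
        differential_\<phi>'[OF X u] \<phi>'_eq[OF X] by (simp add: Q_vec_tvec)
  qed (simp_all add: shadow_tangent_map \<phi>_Aff \<phi>'_Aff)
  ultimately show ?thesis by (simp add: invariants_def shadow_F' \<phi>_def)
qed

end

section \<open>Frame invariance as factorisation through the invariants\<close>

context material_bundle
begin

text \<open>Membership in \<open>Conf\<close> accompanies the equality because a factorisation of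
  \<open>\<omega>\<close> determines its values on configurations only.\<close>

lemma invariants_compose_TGGal:
  assumes F: "F \<in> Conf r B" and Q: "Q \<in> TGGal r"
  shows "compose (tangent_pts (total B)) Q F \<in> Conf r B"
    and "invariants B (compose (tangent_pts (total B)) Q F) = invariants B F"
proof -
  obtain R s where R: "orthogonal_transformation R"
    and Q: "Q = tangent_map vec_manifold vec_manifold (galilean R s)"
    using Q by (rule TGGal_galilean)
  interpret g: galilean_action r B R s F by unfold_locales (use R F in auto)
  show "compose (tangent_pts (total B)) Q F \<in> Conf r B"
    using g.F'_Conf by (simp add: g.F'_def g.Q_def Q)
  show "invariants B (compose (tangent_pts (total B)) Q F) = invariants B F"
    using g.invariants_F' by (simp add: g.F'_def g.Q_def Q)
qed

end

text \<open>Candidates for \<open>\<omega>'\<close> are extensional, so uniqueness is equality of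
  functions: every value on the image of \<open>invariants B\<close> is forced by
  \<open>\<omega>\<close>.\<close>

theorem mainTheorem2:
  fixes r :: enat
    and B :: "('p, 'a::euclidean_space, 'q, 'm::euclidean_space, 'f::euclidean_space) bundle_data"
    and S :: "'s set"
    and \<omega> :: "(('p, 'a) tvec \<Rightarrow> (E_tot, E_tot) tvec) \<Rightarrow> 's"
  assumes "1 \<le> r"
    and "affine_bundle (r + 1) B"
    and "DIM('f) = 3"
    and "DIM('m) \<in> {1, 2, 3}"
    and "\<omega> \<in> Conf r B \<rightarrow> S"
  shows "(frame_invariant r B \<omega> \<longleftrightarrow>
        (\<exists>\<omega>'. \<omega>' \<in> (invariants B ` Conf r B) \<rightarrow>\<^sub>E S \<and>
           (\<forall>F\<in>Conf r B. \<omega> F = \<omega>' (invariants B F)))) \<and>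
      (\<exists>\<^sub>\<le>\<^sub>1\<omega>'. \<omega>' \<in> (invariants B ` Conf r B) \<rightarrow>\<^sub>E S \<and>
         (\<forall>F\<in>Conf r B. \<omega> F = \<omega>' (invariants B F)))"
proof (intro conjI)
  interpret material_bundle r B by unfold_locales (rule assms(1-3))+
  show "frame_invariant r B \<omega> \<longleftrightarrow>
      (\<exists>\<omega>'. \<omega>' \<in> (invariants B ` Conf r B) \<rightarrow>\<^sub>E S \<and> (\<forall>F\<in>Conf r B. \<omega> F = \<omega>' (invariants B F)))"
  proof
    assume inv: "frame_invariant r B \<omega>"
    have *: "\<omega> F = \<omega> G" if "F \<in> Conf r B" "G \<in> Conf r B" "invariants B F = invariants B G" for F G
      using galilean_of_equal_invariants[OF that] inv that(1) unfolding frame_invariant_def by metis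
    \<comment> \<open>A representative configuration is chosen for each value of the invariants; by
      \<open>*\<close> the result does not depend on it.\<close>
    define \<omega>' where "\<omega>' = (\<lambda>i\<in>invariants B ` Conf r B. \<omega> (SOME F. F \<in> Conf r B \<and> invariants B F = i))"
    have eq: "\<omega>' (invariants B F) = \<omega> F" if F: "F \<in> Conf r B" for F
    proof -
      define G where "G = (SOME G. G \<in> Conf r B \<and> invariants B G = invariants B F)"
      have "G \<in> Conf r B \<and> invariants B G = invariants B F"
        unfolding G_def by (rule someI[of _ F]) (simp add: F)
      then have "\<omega> G = \<omega> F" using * F by blast
      then show ?thesis using F by (simp add: \<omega>'_def G_def)
    qed
    have "\<omega>' \<in> (invariants B ` Conf r B) \<rightarrow>\<^sub>E S"
    proof (rule PiE_I)
      fix i assume "i \<in> invariants B ` Conf r B"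
      then obtain F where F: "F \<in> Conf r B" "i = invariants B F" by blast
      show "\<omega>' i \<in> S" unfolding F(2) eq[OF F(1)] by (rule funcset_mem[OF assms(5) F(1)])
    qed (simp add: \<omega>'_def)
    then show "\<exists>\<omega>'. \<omega>' \<in> (invariants B ` Conf r B) \<rightarrow>\<^sub>E S \<and>
        (\<forall>F\<in>Conf r B. \<omega> F = \<omega>' (invariants B F))"
      by (intro exI[of _ \<omega>'] conjI ballI) (simp_all only: eq)
  next
    assume "\<exists>\<omega>'. \<omega>' \<in> (invariants B ` Conf r B) \<rightarrow>\<^sub>E S \<and>
      (\<forall>F\<in>Conf r B. \<omega> F = \<omega>' (invariants B F))"
    then obtain \<omega>' where \<omega>': "\<And>F. F \<in> Conf r B \<Longrightarrow> \<omega> F = \<omega>' (invariants B F)" by blast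
    show "frame_invariant r B \<omega>"
      unfolding frame_invariant_def
    proof (intro ballI)
      fix F Q assume F: "F \<in> Conf r B" and Q: "Q \<in> TGGal r"
      show "\<omega> F = \<omega> (compose (tangent_pts (total B)) Q F)"
        using \<omega>'[OF F] \<omega>'[OF invariants_compose_TGGal(1)[OF F Q]]
          invariants_compose_TGGal(2)[OF F Q] by simp
    qed
  qed
  show "\<exists>\<^sub>\<le>\<^sub>1\<omega>'. \<omega>' \<in> (invariants B ` Conf r B) \<rightarrow>\<^sub>E S \<and>
      (\<forall>F\<in>Conf r B. \<omega> F = \<omega>' (invariants B F))"
  proof (rule Uniq_I)
    fix \<omega>1 \<omega>2
    assume 1: "\<omega>1 \<in> (invariants B ` Conf r B) \<rightarrow>\<^sub>E S \<and> (\<forall>F\<in>Conf r B. \<omega> F = \<omega>1 (invariants B F))"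
      and 2: "\<omega>2 \<in> (invariants B ` Conf r B) \<rightarrow>\<^sub>E S \<and> (\<forall>F\<in>Conf r B. \<omega> F = \<omega>2 (invariants B F))"
    show "\<omega>1 = \<omega>2"
    proof (rule PiE_ext[OF conjunct1[OF 1] conjunct1[OF 2]])
      fix i assume "i \<in> invariants B ` Conf r B"
      then obtain F where "F \<in> Conf r B" "i = invariants B F" by blast
      then show "\<omega>1 i = \<omega>2 i" using 1 2 by metis
    qed
  qed
qed

end
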